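(* Let $\phi=\frac{1+\sqrt5}{2}$, let $\tau_1$ be a Penrose tiling of $\mathbb{R}^2$ by kites and darts with edges of lengths $1$ and $\phi$, let $\psi$ be the area of a dart of $\tau_1$, and let $Y$ be the separated net created by $\tau_1$. With $\rho=\frac{\phi^2}{(1+\phi^2)\psi}$, $$\prod_{i=1}^{\infty}E_\rho(2^i)<\infty.$$
   Context: Kites and darts: let $\phi=\frac{1+\sqrt5}{2}$. The kite is the convex quadrilateral with consecutive edge lengths $\phi,1,1,\phi$ and angles $72^\circ$ at the tip (where the two long edges meet), $72^\circ$ at each of the two wings (where a long and a short edge meet), and $144^\circ$ at the tail (where the two short edges meet). The dart is the non-convex quadrilateral with consecutive edge lengths $\phi,1,1,\phi$ and angles $72^\circ$ at the tip (where the two long edges meet), $36^\circ$ at each of the two wings, and $216^\circ$ at the reflex vertex (where the two short edges meet). Label by $H$ the two wings of the kite and the tip and reflex vertex of the dart; label by $T$ the tip and tail of the kite and the two wings of the dart. A Penrose tiling of $\mathbb{R}^2$ (with kites and darts) is a tiling of the plane by congruent copies of the kite and the dart, meeting edge to edge, such that at every vertex of the tiling all the tile corners meeting there carry the same label. A separated net is a discrete set $Y\subseteq\mathbb{R}^2$ for which there are $c_1,c_2>0$ such that $d(x,y)\ge c_1$ for all distinct $x,y\in Y$, and for every $x\in\mathbb{R}^2$ there is $y\in Y$ with $d(x,y)\le c_2$. The separated net created by a tiling (with tiles of bounded diameter) is a set obtained by placing exactly one point in each tile, so that the points of different tiles are at distance at least some fixed $c_1>0$. For $\rho>0$ and a square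 $\mathcal{U}=[j_1,j_1+l]\times[j_2,j_2+l]$ with $l=2^i$ and $i,j_1,j_2\in\mathbb{N}$, let $|\mathcal{U}|$ be the area of $\mathcal{U}$, $\sharp$ denote cardinality, and $$e_\rho(\mathcal{U})=\max\left\{\frac{\rho|\mathcal{U}|}{\sharp(\mathcal{U}\cap Y)},\frac{\sharp(\mathcal{U}\cap Y)}{\rho|\mathcal{U}|}\right\},\qquad E_\rho(2^i)=\sup\, e_\rho(\mathcal{U}),$$ the supremum being over all such squares $\mathcal{U}$ of side length $2^i$ (i.e. over all $j_1,j_2\in\mathbb{N}$).
   Formalization: The supremum defining E_ρ(2^i) is taken only over squares that contain a point of Y, since e_ρ is undefined (or infinite) on a square without points of Y; such squares of side 2 can occur, while squares of side at least 4 always meet Y. *)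

theory Defs
  imports "HOL-Analysis.Analysis"
begin

section \<open>Kites and darts\<close>

definition phi :: real where
  "phi = (1 + sqrt 5) / 2"

datatype shape = Kite | Dart

text \<open>\<open>Far\<close> is the corner where the two short edges meet: the tail of the kite and the
  reflex vertex of the dart.\<close>

datatype corner = Tip | Wing1 | Wing2 | Far

datatype label = H | T

fun corner_label :: "shape \<Rightarrow> corner \<Rightarrow> label" where
  "corner_label Kite Wing1 = H"
| "corner_label Kite Wing2 = H"
| "corner_label Kite Tip = T"
| "corner_label Kite Far = T"
| "corner_label Dart Tip = H"
| "corner_label Dart Far = H"
| "corner_label Dart Wing1 = T"
| "corner_label Dart Wing2 = T"

text \<open>Both prototiles have their tip at the origin and the first axis as their axis of symmetry;
  the angle of 72 degrees at the tip and the length \<open>phi\<close> of the long edges give the wings. The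
  two points of the axis at distance 1 from the wings are then \<open>(phi, 0)\<close>, giving the convex
  quadrilateral, and \<open>(1, 0)\<close>, giving the non-convex one.\<close>

fun corner_pos :: "shape \<Rightarrow> corner \<Rightarrow> real ^ 2" where
  "corner_pos s Tip = 0"
| "corner_pos s Wing1 = vector [phi * cos (pi / 5), phi * sin (pi / 5)]"
| "corner_pos s Wing2 = vector [phi * cos (pi / 5), - (phi * sin (pi / 5))]"
| "corner_pos Kite Far = vector [phi, 0]"
| "corner_pos Dart Far = vector [1, 0]"

definition sides :: "(corner \<times> corner) set" where
  "sides = {(Tip, Wing1), (Wing1, Far), (Far, Wing2), (Wing2, Tip)}"

text \<open>The dart is cut along its axis into two triangles.\<close>

fun prototile :: "shape \<Rightarrow> (real ^ 2) set" where
  "prototile Kite = convex hull (range (corner_pos Kite))"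
| "prototile Dart =
     convex hull {corner_pos Dart Tip, corner_pos Dart Wing1, corner_pos Dart Far}
   \<union> convex hull {corner_pos Dart Tip, corner_pos Dart Wing2, corner_pos Dart Far}"

section \<open>Penrose tilings\<close>

text \<open>A tile is a prototile together with an isometry of the plane placing it. The two placements
  of a prototile with the same image overlap, so a tiling contains at most one of them.\<close>

type_synonym tile = "shape \<times> (real ^ 2 \<Rightarrow> real ^ 2)"

definition plane_isometry :: "(real ^ 2 \<Rightarrow> real ^ 2) \<Rightarrow> bool" where
  "plane_isometry f \<longleftrightarrow> (\<forall>x y. dist (f x) (f y) = dist x y)"

definition region :: "tile \<Rightarrow> (real ^ 2) set" where
  "region t = snd t ` prototile (fst t)"

definition corner_of :: "tile \<Rightarrow> corner \<Rightarrow> real ^ 2" where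
  "corner_of t c = snd t (corner_pos (fst t) c)"

definition edges :: "tile \<Rightarrow> (real ^ 2) set set" where
  "edges t = (\<lambda>(a, b). closed_segment (corner_of t a) (corner_of t b)) ` sides"

definition tiling :: "tile set \<Rightarrow> bool" where
  "tiling \<T> \<longleftrightarrow>
     (\<forall>t\<in>\<T>. plane_isometry (snd t)) \<and>
     (\<Union>t\<in>\<T>. region t) = UNIV \<and>
     (\<forall>t\<in>\<T>. \<forall>t'\<in>\<T>. t \<noteq> t' \<longrightarrow> interior (region t) \<inter> interior (region t') = {})"

text \<open>Edges of different tiles either coincide or meet at most in common corners of both tiles.\<close>

definition edge_to_edge :: "tile set \<Rightarrow> bool" where
  "edge_to_edge \<T> \<longleftrightarrow>
     (\<forall>t\<in>\<T>. \<forall>t'\<in>\<T>. t \<noteq> t' \<longrightarrow>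
        (\<forall>e\<in>edges t. \<forall>e'\<in>edges t'.
           e = e' \<or> e \<inter> e' \<subseteq> range (corner_of t) \<inter> range (corner_of t')))"

definition labels_match :: "tile set \<Rightarrow> bool" where
  "labels_match \<T> \<longleftrightarrow>
     (\<forall>t\<in>\<T>. \<forall>t'\<in>\<T>. \<forall>c c'. corner_of t c = corner_of t' c' \<longrightarrow>
        corner_label (fst t) c = corner_label (fst t') c')"

definition penrose_tiling :: "tile set \<Rightarrow> bool" where
  "penrose_tiling \<T> \<longleftrightarrow> tiling \<T> \<and> edge_to_edge \<T> \<and> labels_match \<T>"

section \<open>Separated nets\<close>

definition separated_net :: "(real ^ 2) set \<Rightarrow> bool" where
  "separated_net Y \<longleftrightarrow>
     (\<exists>c>0. \<forall>x\<in>Y. \<forall>y\<in>Y. x \<noteq> y \<longrightarrow> c \<le> dist x y) \<and>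
     (\<exists>c>0. \<forall>x. \<exists>y\<in>Y. dist x y \<le> c)"

definition net_created_by :: "tile set \<Rightarrow> (real ^ 2) set \<Rightarrow> bool" where
  "net_created_by \<T> Y \<longleftrightarrow>
     (\<exists>p. (\<forall>t\<in>\<T>. p t \<in> region t) \<and> Y = p ` \<T> \<and>
          (\<exists>c>0. \<forall>t\<in>\<T>. \<forall>t'\<in>\<T>. t \<noteq> t' \<longrightarrow> c \<le> dist (p t) (p t')))"

section \<open>Discrepancy\<close>

definition square :: "nat \<Rightarrow> nat \<Rightarrow> real \<Rightarrow> (real ^ 2) set" where
  "square j k l = cbox (vector [real j, real k]) (vector [real j + l, real k + l])"

text \<open>The value is \<open>\<infinity>\<close> when \<open>U\<close> contains no point of \<open>Y\<close>.\<close>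

definition discrepancy :: "real \<Rightarrow> (real ^ 2) set \<Rightarrow> (real ^ 2) set \<Rightarrow> ennreal" where
  "discrepancy \<rho> Y U =
     max (ennreal (\<rho> * measure lebesgue U) / of_nat (card (U \<inter> Y)))
         (of_nat (card (U \<inter> Y)) / ennreal (\<rho> * measure lebesgue U))"

text \<open>The quotient \<open>\<rho> |U| / card (U \<inter> Y)\<close> is undefined for a square containing no point of
  \<open>Y\<close>, and such squares are left out of the supremum. For a net created by a tiling with kites
  and darts there are none of side 4 or more (see \<open>max_discrepancy_eq_SUP\<close> below), but squares
  of side 2 may be empty: a square of side 2 whose centre is the centre of a decagon formed by
  five kites meets only these kites and covers none of them.\<close>

definition max_discrepancy :: "real \<Rightarrow> (real ^ 2) set \<Rightarrow> real \<Rightarrow> ennreal" where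
  "max_discrepancy \<rho> Y l =
     (SUP (j, k) \<in> {(j, k). square j k l \<inter> Y \<noteq> {}}. discrepancy \<rho> Y (square j k l))"

section \<open>Elementary facts\<close>

lemma phi_eq_cos: "phi = 2 * cos (pi / 5)"
proof -
  define c where "c = cos (pi / 5)"
  have "cos (2 * (pi / 5)) = - cos (3 * (pi / 5))"
    using cos_pi_minus[of "3 * (pi / 5)"] by (simp add: field_simps)
  then have "2 * c ^ 2 - 1 = - (4 * c ^ 3 - 3 * c)"
    by (simp only: cos_double_cos cos_treble_cos c_def)
  then have "(c + 1) * (4 * c ^ 2 - 2 * c - 1) = 0"
    by (simp add: algebra_simps power2_eq_square power3_eq_cube)
  moreover have c0: "c > 0"
    unfolding c_def by (rule cos_gt_zero) auto
  ultimately have "4 * c ^ 2 - 2 * c - 1 = 0" by simp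
  then have "(4 * c - 1) ^ 2 = (sqrt 5) ^ 2"
    by (simp add: algebra_simps power2_eq_square)
  then have "4 * c - 1 = sqrt 5 \<or> 4 * c - 1 = - sqrt 5"
    by (simp only: power2_eq_iff)
  moreover have "(1 :: real) < sqrt 5" by simp
  ultimately have "4 * c = 1 + sqrt 5"
    using c0 by auto
  then show ?thesis
    unfolding phi_def c_def[symmetric] by simp
qed

lemma phi_square: "phi ^ 2 = phi + 1"
  by (simp add: phi_def power2_eq_square field_simps)

lemma wing_pos:
  "phi * cos (pi / 5) = (phi + 1) / 2" "(phi * sin (pi / 5)) ^ 2 = (3 + 2 * phi - phi ^ 2) / 4"
proof -
  show "phi * cos (pi / 5) = (phi + 1) / 2"
    using phi_eq_cos phi_square by (simp add: power2_eq_square field_simps)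
  then have "(phi * sin (pi / 5)) ^ 2 = phi ^ 2 - ((phi + 1) / 2) ^ 2"
    by (metis power_mult_distrib sin_squared_eq right_diff_distrib mult.right_neutral)
  then show "(phi * sin (pi / 5)) ^ 2 = (3 + 2 * phi - phi ^ 2) / 4"
    using phi_square by (simp add: power2_eq_square field_simps)
qed

lemma norm_2: "norm (x :: real ^ 2) = sqrt ((x $ 1) ^ 2 + (x $ 2) ^ 2)"
  by (simp add: norm_vec_def L2_set_def sum_2)

lemma edge_lengths:
  "dist (corner_pos s Tip) (corner_pos s Wing1) = phi"
  "dist (corner_pos s Wing1) (corner_pos s Far) = 1"
  "dist (corner_pos s Far) (corner_pos s Wing2) = 1"
  "dist (corner_pos s Wing2) (corner_pos s Tip) = phi"
proof -
  have p: "phi \<ge> 0" by (simp add: phi_def)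
  have 1: "sqrt (((phi + 1) / 2) ^ 2 + (3 + 2 * phi - phi ^ 2) / 4) = phi"
    using p phi_square by (intro real_sqrt_unique) (auto simp: power2_eq_square field_simps)
  have 2: "sqrt (((phi + 1) / 2 - a) ^ 2 + (3 + 2 * phi - phi ^ 2) / 4) = 1"
    if "a = phi \<or> a = 1" for a
    using that phi_square by (intro real_sqrt_unique) (auto simp: power2_eq_square field_simps)
  show "dist (corner_pos s Tip) (corner_pos s Wing1) = phi"
    "dist (corner_pos s Wing2) (corner_pos s Tip) = phi"
    using 1 by (simp_all add: dist_norm norm_2 wing_pos)
  have 3: "sqrt ((a - (phi + 1) / 2) ^ 2 + (3 + 2 * phi - phi ^ 2) / 4) = 1"
    if "a = phi \<or> a = 1" for a
    using 2[OF that] by (simp add: power2_commute)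
  show "dist (corner_pos s Wing1) (corner_pos s Far) = 1"
    by (cases s) (use 2[of phi] 2[of 1] in \<open>simp_all add: dist_norm norm_2 wing_pos\<close>)
  show "dist (corner_pos s Far) (corner_pos s Wing2) = 1"
    by (cases s) (use 3[of phi] 3[of 1] in \<open>simp_all add: dist_norm norm_2 wing_pos\<close>)
qed

lemma corner_dist_le: "dist (corner_pos s a) (corner_pos s b) \<le> 2"
proof -
  have phi2: "phi \<le> 2" "phi \<ge> 0" by (simp_all add: phi_def real_sqrt_le_iff[of 5 9, simplified])
  have "2 * (phi * sin (pi / 5)) = 2 * sin (2 * (pi / 5))"
    by (simp only: sin_double phi_eq_cos mult_ac)
  also have "\<dots> \<le> 2" by simp
  finally have w: "2 * (phi * sin (pi / 5)) \<le> 2" .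
  have "sin (pi / 5) \<ge> 0" by (rule sin_ge_zero) auto
  then have "phi * sin (pi / 5) \<ge> 0" using phi2 by simp
  then have W: "dist (corner_pos s Wing1) (corner_pos s Wing2) \<le> 2"
    using w by (simp add: dist_norm norm_2 real_sqrt_mult)
  have F: "dist (corner_pos s Tip) (corner_pos s Far) \<le> 2"
    using phi2 by (cases s) (simp_all add: dist_norm norm_2)
  note E = edge_lengths[of s]
  show ?thesis
    using W F E phi2
    by (cases a; cases b) (simp_all add: dist_commute del: corner_pos.simps)
qed

lemma prototile_dist_le:
  assumes "x \<in> prototile s" "y \<in> prototile s"
  shows "dist x y \<le> 2"
proof -
  let ?K = "range (corner_pos s)"
  have sub: "prototile s \<subseteq> convex hull ?K"
    by (cases s) (simp_all del: corner_pos.simps add: hull_mono)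
  have 1: "convex hull ?K \<subseteq> cball v 2" if "v \<in> ?K" for v
    by (rule hull_minimal) (use that in \<open>auto simp: corner_dist_le\<close>)
  have "convex hull ?K \<subseteq> cball x 2"
    by (rule hull_minimal) (use 1 sub assms(1) in \<open>auto simp: dist_commute subset_iff\<close>)
  then show ?thesis using sub assms(2) by auto
qed

lemma net_point_near:
  assumes "tiling \<T>" "net_created_by \<T> Y"
  shows "\<exists>y\<in>Y. dist x y \<le> 2"
proof -
  from assms(2) obtain p where p: "\<forall>t\<in>\<T>. p t \<in> region t" "Y = p ` \<T>"
    unfolding net_created_by_def by (elim exE conjE)
  have "x \<in> (\<Union>t\<in>\<T>. region t)" using assms(1) by (simp add: tiling_def)
  then obtain t where t: "t \<in> \<T>" "x \<in> region t" by auto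
  then have iso: "plane_isometry (snd t)" using assms(1) by (simp add: tiling_def)
  have "p t \<in> region t" using p(1) t(1) by simp
  then have "dist x (p t) \<le> 2"
    using t(2) iso prototile_dist_le unfolding region_def plane_isometry_def by auto
  then show ?thesis using p(2) t(1) by auto
qed

lemma net_created_by_separated:
  assumes "tiling \<T>" "net_created_by \<T> Y"
  shows "separated_net Y"
proof -
  from assms(2) obtain p c where "Y = p ` \<T>" "c > 0"
    "\<forall>t\<in>\<T>. \<forall>t'\<in>\<T>. t \<noteq> t' \<longrightarrow> c \<le> dist (p t) (p t')"
    unfolding net_created_by_def by (elim exE conjE)
  then have "\<exists>c>0. \<forall>x\<in>Y. \<forall>y\<in>Y. x \<noteq> y \<longrightarrow> c \<le> dist x y"
    by (intro exI[of _ c]) auto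
  moreover have "\<exists>c>0. \<forall>x. \<exists>y\<in>Y. dist x y \<le> c"
    using net_point_near[OF assms] by (intro exI[of _ 2]) auto
  ultimately show ?thesis unfolding separated_net_def by blast
qed

lemma max_discrepancy_eq_SUP:
  assumes "tiling \<T>" "net_created_by \<T> Y" "l \<ge> 4"
  shows "max_discrepancy \<rho> Y l = (SUP (j, k) \<in> UNIV. discrepancy \<rho> Y (square j k l))"
proof -
  have "square j k l \<inter> Y \<noteq> {}" for j k
  proof -
    let ?m = "vector [real j + 2, real k + 2] :: real ^ 2"
    obtain y where y: "y \<in> Y" "dist ?m y \<le> 2" using net_point_near[OF assms(1,2)] by blast
    have "\<bar>(?m - y) $ i\<bar> \<le> 2" for i
      using component_le_norm_cart[of "?m - y" i] y(2) by (simp add: dist_norm)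
    from this[of 1] this[of 2] have "y \<in> square j k l"
      using assms(3) by (auto simp: square_def mem_box_cart forall_2)
    then show ?thesis using y by blast
  qed
  then show ?thesis unfolding max_discrepancy_def by simp
qed

end

theory Submission
  imports Defs "HOL-Computational_Algebra.Primes"
begin

text \<open>
  All corners of the tiling lie in the ring generated by \<open>\<zeta> = exp (\<i> \<pi> / 5)\<close>, which carries the
  Galois conjugation \<open>\<zeta> \<mapsto> \<zeta> ^ 3\<close>; it maps \<open>phi\<close> to \<open>- 1 / phi\<close>. The matching rules allow the tiles to
  be composed into a Penrose tiling that is larger by the factor \<open>phi\<close>, and hence smaller by the same
  factor in the conjugate plane. A walk from tile to tile does not get longer under composition, so
  iterating the composition shows that the conjugates of all corners lie in a disc.

  The conjugate areas of kites and darts are proportional to \<open>- 1 / phi\<close> and \<open>1\<close>. By the shoelace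
  formula, the sum of the conjugate areas of the tiles meeting a square is a sum over the boundary
  edges of the patch, with bounded terms. Together with the sum of the real areas this determines
  the number of tiles meeting the square up to an error proportional to its perimeter, which makes
  \<open>E \<rho> (2 ^ i)\<close> equal to \<open>1 + O(2 ^ - i)\<close>.
\<close>

section \<open>Half tiles\<close>

abbreviation Phi :: complex ("\<Phi>") where
  "\<Phi> \<equiv> complex_of_real phi"

definition zeta :: complex ("\<zeta>") where
  "\<zeta> = cis (pi / 5)"

definition wing_dirs :: "complex set" where
  "wing_dirs = {\<zeta>, cnj \<zeta>}"

lemma Phi_square: "\<Phi>\<^sup>2 = \<Phi> + 1"
  using phi_square by (metis of_real_1 of_real_add of_real_power)

lemma phi_bounds: "3 / 2 < phi" "phi < 2"
proof -
  have "2 < sqrt 5" by (rule real_less_rsqrt) simp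
  moreover have "sqrt 5 < 3" by (rule real_less_lsqrt) simp_all
  ultimately show "3 / 2 < phi" "phi < 2" by (auto simp: phi_def)
qed

lemma phi_nonzero [simp]: "phi \<noteq> 0"
  using phi_bounds by simp

lemma wing_dirs_cnj: "z \<in> wing_dirs \<Longrightarrow> cnj z \<in> wing_dirs"
  by (auto simp: wing_dirs_def)

lemma wing_dirs_rel:
  assumes "z \<in> wing_dirs"
  shows "z * cnj z = 1" "z + cnj z = \<Phi>" "cnj z \<noteq> z" "z \<noteq> 0"
proof -
  have s: "sin (pi / 5) > 0" by (rule sin_gt_zero) auto
  show "z * cnj z = 1"
    using assms by (auto simp: wing_dirs_def zeta_def cis_cnj cis_mult)
  show "z + cnj z = \<Phi>"
    using assms by (auto simp: wing_dirs_def zeta_def complex_eq_iff phi_eq_cos)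
  show "cnj z \<noteq> z" "z \<noteq> 0"
    using assms s by (auto simp: wing_dirs_def zeta_def complex_eq_iff)
qed

text \<open>A half tile \<open>(s, p, u, z)\<close> has its tip at \<open>p\<close>, its other corner on the axis at \<open>p + \<Phi> u\<close>
  (kite) or \<open>p + u\<close> (dart), and its wing at \<open>p + \<Phi> z u\<close>.\<close>

type_synonym half = "shape \<times> complex \<times> complex \<times> complex"

fun other :: "shape \<Rightarrow> shape" where
  "other Kite = Dart"
| "other Dart = Kite"

inductive long_nb :: "half \<Rightarrow> half \<Rightarrow> bool" where
  long_same: "long_nb (s, p, u, z) (s, p, z\<^sup>2 * u, cnj z)"
| long_swap: "long_nb (s, p, u, z) (other s, p + \<Phi> * z * u, - u, z)"

inductive short_nb :: "half \<Rightarrow> half \<Rightarrow> bool" where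
  short_KK: "short_nb (Kite, p, u, z) (Kite, p + \<Phi> * (1 + z) * u, - (z * u), cnj z)"
| short_KD: "short_nb (Kite, p, u, z) (Dart, p + \<Phi>\<^sup>2 * z * u, - (z * u), z)"
| short_DK: "short_nb (Dart, p, u, z) (Kite, p + \<Phi>\<^sup>2 * u, - (cnj z * u), z)"

fun twin :: "half \<Rightarrow> half" where
  "twin (s, p, u, z) = (s, p, u, cnj z)"

definition half_adj :: "half \<Rightarrow> half \<Rightarrow> bool" where
  "half_adj h k \<longleftrightarrow> k = twin h \<or> long_nb h k \<or> short_nb h k"

text \<open>\<open>sector h x m\<close>: at its corner \<open>x\<close> the half tile \<open>h\<close> contains the sector of 36 degrees between
  two directions with sum \<open>m\<close>.\<close>

inductive sector :: "half \<Rightarrow> complex \<Rightarrow> complex \<Rightarrow> bool" where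
  sec_tip: "sector (s, p, u, z) p ((1 + z) * u)"
| sec_wing: "sector (s, p, u, z) (p + \<Phi> * z * u) (- (z * (1 + z) * u))"
| sec_wing_K: "sector (Kite, p, u, z) (p + \<Phi> * z * u) (- (z\<^sup>2 * (1 + z) * u))"
| sec_far_K3: "sector (Kite, p, u, z) (p + \<Phi> * u) (z ^ 3 * (1 + z) * u)"
| sec_far_K4: "sector (Kite, p, u, z) (p + \<Phi> * u) (z ^ 4 * (1 + z) * u)"
| sec_far_D2: "sector (Dart, p, u, z) (p + u) (z\<^sup>2 * (1 + z) * u)"
| sec_far_D3: "sector (Dart, p, u, z) (p + u) (z ^ 3 * (1 + z) * u)"
| sec_far_D4: "sector (Dart, p, u, z) (p + u) (z ^ 4 * (1 + z) * u)"

locale half_tiling =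
  fixes H :: "half set"
  assumes dirs: "(s, p, u, z) \<in> H \<Longrightarrow> z \<in> wing_dirs"
    and axis_nonzero: "(s, p, u, z) \<in> H \<Longrightarrow> u \<noteq> 0"
    and twin: "(s, p, u, z) \<in> H \<Longrightarrow> (s, p, u, cnj z) \<in> H"
    and long_ex: "h \<in> H \<Longrightarrow> \<exists>k\<in>H. long_nb h k"
    and short_ex: "h \<in> H \<Longrightarrow> \<exists>k\<in>H. short_nb h k"
    and packed: "h \<in> H \<Longrightarrow> k \<in> H \<Longrightarrow> sector h x m \<Longrightarrow> sector k x m \<Longrightarrow> h = k"

text \<open>Composition cuts the darts along their axes and glues all pieces along the short edges. The tip
  of a new kite is the common tip of two darts sharing a long edge, and a new dart consists of a kite
  whose two short edges are glued to halves of darts. The new axis directions are longer by the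
  factor \<open>phi\<close>, so no rescaling is needed.\<close>

inductive_set compose :: "half set \<Rightarrow> half set" for H where
  compose_K: "z \<in> wing_dirs \<Longrightarrow> (Dart, p, z * u, z) \<in> H \<Longrightarrow> (Dart, p, cnj z * u, z) \<in> H \<Longrightarrow>
    (Kite, p, \<Phi> * u, z) \<in> compose H"
| compose_D: "(Kite, p, u, z) \<in> H \<Longrightarrow> (Dart, p + \<Phi>\<^sup>2 * z * u, - (z * u), z) \<in> H \<Longrightarrow>
    (Dart, p + \<Phi>\<^sup>2 * cnj z * u, - (cnj z * u), z) \<in> H \<Longrightarrow> (Dart, p, \<Phi> * u, z) \<in> compose H"

text \<open>\<open>parent h c\<close>: a half tile \<open>h\<close> would be a part of the new half tile \<open>c\<close>.\<close>

inductive parent :: "half \<Rightarrow> half \<Rightarrow> bool" where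
  parent_DK: "parent (Dart, p, u, z) (Kite, p, \<Phi> * (z * u), cnj z)"
| parent_DD: "parent (Dart, p, u, z) (Dart, p + \<Phi>\<^sup>2 * u, \<Phi> * - (cnj z * u), z)"
| parent_KD: "parent (Kite, p, u, z) (Dart, p, \<Phi> * u, z)"
| parent_KK: "parent (Kite, p, u, z) (Kite, p + \<Phi>\<^sup>2 * cnj z * u, \<Phi> * - ((cnj z)\<^sup>2 * u), z)"
| parent_KK': "parent (Kite, p, u, z) (Kite, p + \<Phi>\<^sup>2 * z * u, \<Phi> * - (z\<^sup>2 * u), cnj z)"

lemma long_nb_eq: "long_nb (s, p, u, z) k \<longleftrightarrow>
    k = (s, p, z\<^sup>2 * u, cnj z) \<or> k = (other s, p + \<Phi> * z * u, - u, z)"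
  by (auto simp: long_nb.simps)

lemma short_nb_Kite: "short_nb (Kite, p, u, z) k \<longleftrightarrow>
    k = (Kite, p + \<Phi> * (1 + z) * u, - (z * u), cnj z) \<or>
    k = (Dart, p + \<Phi>\<^sup>2 * z * u, - (z * u), z)"
  by (auto simp: short_nb.simps)

lemma short_nb_Dart: "short_nb (Dart, p, u, z) k \<longleftrightarrow>
    k = (Kite, p + \<Phi>\<^sup>2 * u, - (cnj z * u), z)"
  by (auto simp: short_nb.simps)

lemma long_sameI: "p' = p \<Longrightarrow> u' = z\<^sup>2 * u \<Longrightarrow> z' = cnj z \<Longrightarrow> long_nb (s, p, u, z) (s, p', u', z')"
  by (simp add: long_nb_eq)

lemma long_swapI: "s' = other s \<Longrightarrow> p' = p + \<Phi> * z * u \<Longrightarrow> u' = - u \<Longrightarrow> z' = z \<Longrightarrow>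
    long_nb (s, p, u, z) (s', p', u', z')"
  by (simp add: long_nb_eq)

lemma short_KKI: "p' = p + \<Phi> * (1 + z) * u \<Longrightarrow> u' = - (z * u) \<Longrightarrow> z' = cnj z \<Longrightarrow>
    short_nb (Kite, p, u, z) (Kite, p', u', z')"
  by (simp add: short_nb_Kite)

lemma short_KDI: "p' = p + \<Phi>\<^sup>2 * z * u \<Longrightarrow> u' = - (z * u) \<Longrightarrow> z' = z \<Longrightarrow>
    short_nb (Kite, p, u, z) (Dart, p', u', z')"
  by (simp add: short_nb_Kite)

lemma short_DKI: "p' = p + \<Phi>\<^sup>2 * u \<Longrightarrow> u' = - (cnj z * u) \<Longrightarrow> z' = z \<Longrightarrow>
    short_nb (Dart, p, u, z) (Kite, p', u', z')"
  by (simp add: short_nb_Dart)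

lemma parent_Kite: "parent (Kite, p, u, z) c \<longleftrightarrow>
    c = (Dart, p, \<Phi> * u, z) \<or>
    c = (Kite, p + \<Phi>\<^sup>2 * cnj z * u, \<Phi> * - ((cnj z)\<^sup>2 * u), z) \<or>
    c = (Kite, p + \<Phi>\<^sup>2 * z * u, \<Phi> * - (z\<^sup>2 * u), cnj z)"
  by (auto simp: parent.simps)

lemma parent_Dart: "parent (Dart, p, u, z) c \<longleftrightarrow>
    c = (Kite, p, \<Phi> * (z * u), cnj z) \<or>
    c = (Dart, p + \<Phi>\<^sup>2 * u, \<Phi> * - (cnj z * u), z)"
  by (auto simp: parent.simps)

lemma parent_DKI: "p' = p \<Longrightarrow> u' = \<Phi> * (z * u) \<Longrightarrow> z' = cnj z \<Longrightarrow> parent (Dart, p, u, z) (Kite, p', u', z')"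
  using parent_DK by simp

lemma parent_DDI: "p' = p + \<Phi>\<^sup>2 * u \<Longrightarrow> u' = \<Phi> * - (cnj z * u) \<Longrightarrow> z' = z \<Longrightarrow>
    parent (Dart, p, u, z) (Dart, p', u', z')"
  using parent_DD by simp

lemma parent_KDI: "p' = p \<Longrightarrow> u' = \<Phi> * u \<Longrightarrow> z' = z \<Longrightarrow> parent (Kite, p, u, z) (Dart, p', u', z')"
  using parent_KD by simp

lemma parent_KKI: "p' = p + \<Phi>\<^sup>2 * cnj z * u \<Longrightarrow> u' = \<Phi> * - ((cnj z)\<^sup>2 * u) \<Longrightarrow> z' = z \<Longrightarrow>
    parent (Kite, p, u, z) (Kite, p', u', z')"
  using parent_KK by simp

lemma parent_KK'I: "p' = p + \<Phi>\<^sup>2 * z * u \<Longrightarrow> u' = \<Phi> * - (z\<^sup>2 * u) \<Longrightarrow> z' = cnj z \<Longrightarrow>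
    parent (Kite, p, u, z) (Kite, p', u', z')"
  using parent_KK' by simp

context half_tiling
begin

lemma packedD:
  assumes "h \<in> H" "k \<in> H" "sector h x m" "sector k x' m'" "x = x'" "m = m'"
  shows "h = k"
  using assms packed by blast

lemma mem_eq: "(s, p, u, z) \<in> H \<Longrightarrow> p = p' \<Longrightarrow> u = u' \<Longrightarrow> z = z' \<Longrightarrow> (s, p', u', z') \<in> H"
  by simp

lemma long_unique:
  assumes "h \<in> H" "k \<in> H" "k' \<in> H" "long_nb h k" "long_nb h k'"
  shows "k = k'"
proof -
  have False if "(s, p, u, z) \<in> H" "(s, p, z\<^sup>2 * u, cnj z) \<in> H" "(other s, p + \<Phi> * z * u, - u, z) \<in> H"
    for s p u z
  proof -
    note R = wing_dirs_rel[OF dirs[OF that(1)]] Phi_square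
    have "(s, p, z\<^sup>2 * u, cnj z) = (other s, p + \<Phi> * z * u, - u, z)"
      by (rule packedD[OF that(2,3) sec_tip sec_wing])
        (((unfold complex_cnj_cnj)?, (rule refl | algebra | use R(1,2,5) in algebra))+)
    then show False by (cases s) auto
  qed
  then show ?thesis using assms
    by (cases h) (auto simp: long_nb_eq)
qed

lemma short_unique:
  assumes "h \<in> H" "k \<in> H" "k' \<in> H" "short_nb h k" "short_nb h k'"
  shows "k = k'"
proof -
  have False if "(Kite, p, u, z) \<in> H" "(Kite, p + \<Phi> * (1 + z) * u, - (z * u), cnj z) \<in> H"
    "(Dart, p + \<Phi>\<^sup>2 * z * u, - (z * u), z) \<in> H" for p u z
  proof -
    note R = wing_dirs_rel[OF dirs[OF that(1)]] Phi_square
    have "(Kite, p + \<Phi> * (1 + z) * u, - (z * u), cnj z) = (Dart, p + \<Phi>\<^sup>2 * z * u, - (z * u), z)"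
      by (rule packedD[OF that(2,3) sec_far_K3 sec_wing])
        (((unfold complex_cnj_cnj)?, (rule refl | algebra | use R(1,2,5) in algebra))+)
    then show False by auto
  qed
  moreover obtain s p u z where "h = (s, p, u, z)" by (cases h)
  ultimately show ?thesis using assms
    by (cases s) (auto simp: short_nb_Kite short_nb_Dart)
qed

lemma long_cases:
  assumes "(s, p, u, z) \<in> H"
  obtains "(s, p, z\<^sup>2 * u, cnj z) \<in> H" | "(other s, p + \<Phi> * z * u, - u, z) \<in> H"
  using long_ex[OF assms] by (auto simp: long_nb_eq)

lemma short_Kite_cases:
  assumes "(Kite, p, u, z) \<in> H"
  obtains "(Kite, p + \<Phi> * (1 + z) * u, - (z * u), cnj z) \<in> H"
  | "(Dart, p + \<Phi>\<^sup>2 * z * u, - (z * u), z) \<in> H"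
  using short_ex[OF assms] by (auto simp: short_nb_Kite)

lemma short_Dart:
  assumes "(Dart, p, u, z) \<in> H"
  shows "(Kite, p + \<Phi>\<^sup>2 * u, - (cnj z * u), z) \<in> H"
  using short_ex[OF assms] by (auto simp: short_nb_Dart)

lemma compose_KD:
  assumes "(Kite, p, \<Phi> * u, z) \<in> compose H"
  shows "z \<in> wing_dirs" "(Dart, p, z * u, z) \<in> H" "(Dart, p, cnj z * u, z) \<in> H"
    "(Dart, p, z * u, cnj z) \<in> H" "(Dart, p, cnj z * u, cnj z) \<in> H"
proof -
  have *: "z \<in> wing_dirs" "(Dart, p, z * u, z) \<in> H" "(Dart, p, cnj z * u, z) \<in> H"
    using assms by (auto simp add: compose.simps)
  then show "z \<in> wing_dirs" "(Dart, p, z * u, z) \<in> H" "(Dart, p, cnj z * u, z) \<in> H"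
    "(Dart, p, z * u, cnj z) \<in> H" "(Dart, p, cnj z * u, cnj z) \<in> H"
    using twin[OF *(2)] twin[OF *(3)] by blast+
qed

lemma compose_DD:
  assumes "(Dart, p, \<Phi> * u, z) \<in> compose H"
  shows "z \<in> wing_dirs" "(Kite, p, u, z) \<in> H" "(Kite, p, u, cnj z) \<in> H"
    "(Dart, p + \<Phi>\<^sup>2 * z * u, - (z * u), z) \<in> H" "(Dart, p + \<Phi>\<^sup>2 * z * u, - (z * u), cnj z) \<in> H"
    "(Dart, p + \<Phi>\<^sup>2 * cnj z * u, - (cnj z * u), z) \<in> H"
    "(Dart, p + \<Phi>\<^sup>2 * cnj z * u, - (cnj z * u), cnj z) \<in> H"
proof -
  have *: "(Kite, p, u, z) \<in> H" "(Dart, p + \<Phi>\<^sup>2 * z * u, - (z * u), z) \<in> H"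
    "(Dart, p + \<Phi>\<^sup>2 * cnj z * u, - (cnj z * u), z) \<in> H"
    using assms by (auto simp add: compose.simps)
  show "z \<in> wing_dirs" "(Kite, p, u, z) \<in> H" "(Kite, p, u, cnj z) \<in> H"
    "(Dart, p + \<Phi>\<^sup>2 * z * u, - (z * u), z) \<in> H" "(Dart, p + \<Phi>\<^sup>2 * z * u, - (z * u), cnj z) \<in> H"
    "(Dart, p + \<Phi>\<^sup>2 * cnj z * u, - (cnj z * u), z) \<in> H"
    "(Dart, p + \<Phi>\<^sup>2 * cnj z * u, - (cnj z * u), cnj z) \<in> H"
    using * dirs[OF *(1)] *[THEN twin] by blast+
qed

text \<open>At the common tail of two kites sharing a short edge there is only room for two dart wings.\<close>

lemma kite_pair:
  assumes k: "(Kite, p, u, z) \<in> H" and k1: "(Kite, p + \<Phi> * (1 + z) * u, - (z * u), cnj z) \<in> H"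
  shows "(Kite, p + \<Phi>\<^sup>2 * cnj z * u, \<Phi> * - ((cnj z)\<^sup>2 * u), z) \<in> compose H"
proof -
  have z: "z \<in> wing_dirs" by (rule dirs[OF k])
  note R = wing_dirs_rel[OF z] Phi_square
  have dart: "(Dart, q + \<Phi>\<^sup>2 * cnj s * v, - (cnj s * v), cnj s) \<in> H"
    if a: "(Kite, q, v, s) \<in> H" "(Kite, q + \<Phi> * (1 + s) * v, - (s * v), cnj s) \<in> H" for q v s
  proof -
    note S = wing_dirs_rel[OF dirs[OF a(1)]] Phi_square
    show ?thesis
    proof (cases rule: short_Kite_cases[OF twin[OF a(1)]])
      case 1
      have "(Kite, q + \<Phi> * (1 + s) * v, - (s * v), cnj (cnj s)) =
          (Kite, q + \<Phi> * (1 + cnj s) * v, - (cnj s * v), cnj (cnj (cnj s)))"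
        by (rule packedD[OF twin[OF a(2)] twin[OF 1] sec_far_K4 sec_far_K3])
          (((unfold complex_cnj_cnj)?, (rule refl | algebra | use S(1,2,5) in algebra))+)
      then show ?thesis using S(3) by simp
    next
      case 2 then show ?thesis by simp
    qed
  qed
  have d1: "(Dart, p + \<Phi>\<^sup>2 * cnj z * u, - (cnj z * u), cnj z) \<in> H"
    by (rule dart[OF k k1])
  have "(Kite, (p + \<Phi> * (1 + z) * u) + \<Phi> * (1 + cnj z) * (- (z * u)), - (cnj z * (- (z * u))), cnj (cnj z)) \<in> H"
    by (rule mem_eq[OF k])
      (((unfold complex_cnj_cnj)?, (rule refl | algebra | use R(1,2,5) in algebra))+)
  from dart[OF k1 this]
  have d2: "(Dart, p + \<Phi>\<^sup>2 * cnj z * u, z\<^sup>2 * u, z) \<in> H"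
    by (rule mem_eq) (((unfold complex_cnj_cnj)?, (rule refl | algebra | use R(1,2,5) in algebra))+)
  show ?thesis
    by (rule compose_K[OF z mem_eq[OF twin[OF d1]] mem_eq[OF d2]])
      (((unfold complex_cnj_cnj)?, (rule refl | algebra | use R(1,2,5) in algebra))+)
qed

lemma half_dart_parent:
  assumes d: "(Dart, q, v, z) \<in> H" and k3: "(Kite, q + \<Phi> * z * v, - v, z) \<in> H"
  shows "(Dart, q + \<Phi>\<^sup>2 * v, \<Phi> * - (cnj z * v), z) \<in> compose H"
proof -
  have z: "z \<in> wing_dirs" by (rule dirs[OF d])
  note R = wing_dirs_rel[OF z] Phi_square
  note k2 = short_Dart[OF d]
  show ?thesis
  proof (cases rule: short_Kite_cases[OF twin[OF k2]])
    case 1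
    have "(Kite, q + \<Phi>\<^sup>2 * v + \<Phi> * (1 + cnj z) * (- (cnj z * v)), - (cnj z * (- (cnj z * v))), cnj (cnj (cnj z)))
        = (Kite, q + \<Phi> * z * v, - v, cnj z)"
      by (rule packedD[OF twin[OF 1] twin[OF k3] sec_far_K3 sec_tip])
        (((unfold complex_cnj_cnj)?, (rule refl | algebra | use R(1,2,5) in algebra))+)
    then have "cnj z * (cnj z * v) = - v" by simp
    then have "\<Phi> * (cnj z * v) = 0" using R(1,2,5) by algebra
    then show ?thesis using axis_nonzero[OF d] R(4) by simp
  next
    case 2
    show ?thesis
      by (rule compose_D[OF k2 mem_eq[OF d] mem_eq[OF twin[OF 2]]])
        (((unfold complex_cnj_cnj)?, (rule refl | algebra | use R(1,2,5) in algebra))+)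
  qed
qed

lemma Dart_parent_cases:
  assumes d: "(Dart, q, v, z) \<in> H"
  obtains "(Kite, q, \<Phi> * (z * v), cnj z) \<in> compose H"
  | "(Dart, q + \<Phi>\<^sup>2 * v, \<Phi> * - (cnj z * v), z) \<in> compose H"
proof (cases rule: long_cases[OF d])
  case 1
  have z: "z \<in> wing_dirs" by (rule dirs[OF d])
  note R = wing_dirs_rel[OF z] Phi_square
  have "(Kite, q, \<Phi> * (z * v), cnj z) \<in> compose H"
    by (rule compose_K[OF wing_dirs_cnj[OF z] mem_eq[OF twin[OF d]] mem_eq[OF 1]])
      (((unfold complex_cnj_cnj)?, (rule refl | algebra | use R(1,2,5) in algebra))+)
  then show ?thesis by (rule that(1))
next
  case 2
  then show ?thesis using half_dart_parent[OF d] that(2) by simp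
qed

lemma compose_twin:
  assumes "(s, p, u, z) \<in> compose H"
  shows "(s, p, u, cnj z) \<in> compose H"
  using assms
proof cases
  case (compose_K v)
  have "(Kite, p, \<Phi> * v, cnj z) \<in> compose H"
    by (rule compose.compose_K[OF wing_dirs_cnj])
      (use compose_K compose_KD[of p v z] compose.compose_K[of z p v H] in auto)
  then show ?thesis using compose_K by simp
next
  case (compose_D v)
  have "(Dart, p, \<Phi> * v, cnj z) \<in> compose H"
    by (rule compose.compose_D)
      (use compose_D compose_DD[of p v z] compose.compose_D[of p v z H] in auto)
  then show ?thesis using compose_D by simp
qed

lemma compose_K_long:
  assumes c: "(Kite, p, \<Phi> * u, z) \<in> compose H"
  obtains c' where "c' \<in> compose H" "long_nb (Kite, p, \<Phi> * u, z) c'" "parent (Dart, p, z * u, z) c'"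
    "\<And>k. k \<in> H \<Longrightarrow> long_nb (Kite, p + \<Phi>\<^sup>2 * z * u, - (z\<^sup>2 * u), cnj z) k \<Longrightarrow> parent k c'"
proof -
  note D = compose_KD[OF c]
  note R = wing_dirs_rel[OF D(1)] Phi_square
  have B: "(Kite, p + \<Phi>\<^sup>2 * z * u, - (z\<^sup>2 * u), cnj z) \<in> H"
    by (rule mem_eq[OF short_Dart[OF D(4)]])
      (((unfold complex_cnj_cnj)?, (rule refl | algebra | use R(1,2,5) in algebra))+)
  have N: "(Kite, p + \<Phi>\<^sup>2 * z * u, - u, z) \<in> H"
    by (rule mem_eq[OF short_Dart[OF D(2)]])
      (((unfold complex_cnj_cnj)?, (rule refl | algebra | use R(1,2,5) in algebra))+)
  have BN: "long_nb (Kite, p + \<Phi>\<^sup>2 * z * u, - (z\<^sup>2 * u), cnj z) (Kite, p + \<Phi>\<^sup>2 * z * u, - u, z)"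
    by (rule long_sameI)
      (((unfold complex_cnj_cnj)?, (rule refl | algebra | use R(1,2,5) in algebra))+)
  have "\<exists>c'\<in>compose H. long_nb (Kite, p, \<Phi> * u, z) c' \<and> parent (Dart, p, z * u, z) c' \<and>
      parent (Kite, p + \<Phi>\<^sup>2 * z * u, - u, z) c'"
  proof (cases rule: Dart_parent_cases[OF D(2)])
    case 1
    have 2: "long_nb (Kite, p, \<Phi> * u, z) (Kite, p, \<Phi> * (z * (z * u)), cnj z)"
      by (rule long_sameI)
        (((unfold complex_cnj_cnj)?, (rule refl | algebra | use R(1,2,5) in algebra))+)
    have "parent (Kite, p + \<Phi>\<^sup>2 * z * u, - u, z) (Kite, p, \<Phi> * (z * (z * u)), cnj z)"
      by (rule parent_KK'I)
        (((unfold complex_cnj_cnj)?, (rule refl | algebra | use R(1,2,5) in algebra))+)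
    with 1 2 show ?thesis by (blast intro: parent_DK)
  next
    case 2
    have 3: "long_nb (Kite, p, \<Phi> * u, z) (Dart, p + \<Phi>\<^sup>2 * (z * u), \<Phi> * - (cnj z * (z * u)), z)"
      by (rule long_swapI[OF other.simps(1)[symmetric]])
        (((unfold complex_cnj_cnj)?, (rule refl | algebra | use R(1,2,5) in algebra))+)
    have "parent (Kite, p + \<Phi>\<^sup>2 * z * u, - u, z) (Dart, p + \<Phi>\<^sup>2 * (z * u), \<Phi> * - (cnj z * (z * u)), z)"
      by (rule parent_KDI)
        (((unfold complex_cnj_cnj)?, (rule refl | algebra | use R(1,2,5) in algebra))+)
    with 2 3 show ?thesis by (blast intro: parent_DD)
  qed
  then show ?thesis using that long_unique[OF B _ N _ BN] by blast
qed

lemma compose_D_long: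
  assumes c: "(Dart, p, \<Phi> * u, z) \<in> compose H"
  obtains c' where "c' \<in> compose H" "long_nb (Dart, p, \<Phi> * u, z) c'"
    "parent (Dart, p + \<Phi>\<^sup>2 * z * u, - (z * u), cnj z) c'"
    "\<And>k. k \<in> H \<Longrightarrow> long_nb (Kite, p, u, z) k \<Longrightarrow> parent k c'"
proof -
  note D = compose_DD[OF c]
  note R = wing_dirs_rel[OF D(1)] Phi_square
  have N: "(Kite, p, z\<^sup>2 * u, cnj z) \<in> H"
    by (rule mem_eq[OF short_Dart[OF D(5)]])
      (((unfold complex_cnj_cnj)?, (rule refl | algebra | use R(1,2,5) in algebra))+)
  have "\<exists>c'\<in>compose H. long_nb (Dart, p, \<Phi> * u, z) c' \<and>
      parent (Dart, p + \<Phi>\<^sup>2 * z * u, - (z * u), cnj z) c' \<and> parent (Kite, p, z\<^sup>2 * u, cnj z) c'"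
  proof (cases rule: Dart_parent_cases[OF D(5)])
    case 1
    let ?c = "(Kite, p + \<Phi>\<^sup>2 * z * u, \<Phi> * (cnj z * - (z * u)), cnj (cnj z))"
    have 2: "long_nb (Dart, p, \<Phi> * u, z) ?c"
      by (rule long_swapI[OF other.simps(2)[symmetric]])
        (((unfold complex_cnj_cnj)?, (rule refl | algebra | use R(1,2,5) in algebra))+)
    have "parent (Kite, p, z\<^sup>2 * u, cnj z) ?c"
      by (rule parent_KK'I)
        (((unfold complex_cnj_cnj)?, (rule refl | algebra | use R(1,2,5) in algebra))+)
    with 1 2 show ?thesis by (blast intro: parent_DK)
  next
    case 2
    let ?c = "(Dart, p + \<Phi>\<^sup>2 * z * u + \<Phi>\<^sup>2 * - (z * u), \<Phi> * - (cnj (cnj z) * - (z * u)), cnj z)"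
    have 3: "long_nb (Dart, p, \<Phi> * u, z) ?c"
      by (rule long_sameI)
        (((unfold complex_cnj_cnj)?, (rule refl | algebra | use R(1,2,5) in algebra))+)
    have "parent (Kite, p, z\<^sup>2 * u, cnj z) ?c"
      by (rule parent_KDI)
        (((unfold complex_cnj_cnj)?, (rule refl | algebra | use R(1,2,5) in algebra))+)
    with 2 3 show ?thesis by (blast intro: parent_DD)
  qed
  then show ?thesis using that long_unique[OF D(2) _ N _ long_same] by blast
qed

lemma compose_K_short:
  assumes c: "(Kite, p, \<Phi> * u, z) \<in> compose H"
  obtains c' where "c' \<in> compose H" "short_nb (Kite, p, \<Phi> * u, z) c'"
    "\<And>k. k \<in> H \<Longrightarrow> long_nb (Kite, p + \<Phi>\<^sup>2 * z * u, - (z\<^sup>2 * u), z) k \<Longrightarrow> parent k c'"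
proof -
  note D = compose_KD[OF c]
  note R = wing_dirs_rel[OF D(1)] Phi_square
  have K: "(Kite, p + \<Phi>\<^sup>2 * z * u, - (z\<^sup>2 * u), z) \<in> H"
    by (rule mem_eq[OF twin[OF short_Dart[OF D(4)]]])
      (((unfold complex_cnj_cnj)?, (rule refl | algebra | use R(1,2,5) in algebra))+)
  have "\<exists>c'\<in>compose H. short_nb (Kite, p, \<Phi> * u, z) c' \<and>
    (\<exists>k\<in>H. long_nb (Kite, p + \<Phi>\<^sup>2 * z * u, - (z\<^sup>2 * u), z) k \<and> parent k c')"
  proof (cases rule: long_cases[OF K])
    case 1
    show ?thesis
    proof (cases rule: short_Kite_cases[OF 1])
      case a: 1
      have "short_nb (Kite, p, \<Phi> * u, z) (Kite, p + \<Phi>\<^sup>2 * z * u + \<Phi>\<^sup>2 * cnj (cnj z) * (z\<^sup>2 * - (z\<^sup>2 * u)),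
          \<Phi> * - ((cnj (cnj z))\<^sup>2 * (z\<^sup>2 * - (z\<^sup>2 * u))), cnj z)"
        by (rule short_KKI)
          (((unfold complex_cnj_cnj)?, (rule refl | algebra | use R(1,2,5) in algebra))+)
      then show ?thesis
        using kite_pair[OF 1 a] 1 by (blast intro: parent_KK long_same)
    next
      case a: 2
      have "(Dart, p + \<Phi>\<^sup>2 * z * u + \<Phi>\<^sup>2 * cnj z * (z\<^sup>2 * - (z\<^sup>2 * u)), - (cnj z * (z\<^sup>2 * - (z\<^sup>2 * u))), cnj (cnj z)) =
          (Kite, p + \<Phi>\<^sup>2 * (cnj z * u), - (cnj z * (cnj z * u)), cnj z)"
        by (rule packedD[OF twin[OF a] twin[OF short_Dart[OF D(3)]] sec_far_D2 sec_wing_K])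
          (((unfold complex_cnj_cnj)?, (rule refl | algebra | use R(1,2,5) in algebra))+)
      then show ?thesis by simp
    qed
  next
    case 2
    let ?q = "p + \<Phi>\<^sup>2 * z * u + \<Phi> * z * - (z\<^sup>2 * u)" and ?v = "z\<^sup>2 * u"
    have d: "(Dart, ?q, ?v, z) \<in> H" using 2 by simp
    have "(Kite, ?q + \<Phi> * z * ?v, - ?v, z) \<in> H"
      by (rule mem_eq[OF K])
        (((unfold complex_cnj_cnj)?, (rule refl | algebra | use R(1,2,5) in algebra))+)
    note c' = half_dart_parent[OF d this]
    have "short_nb (Kite, p, \<Phi> * u, z) (Dart, ?q + \<Phi>\<^sup>2 * ?v, \<Phi> * - (cnj z * ?v), z)"
      by (rule short_KDI)
        (((unfold complex_cnj_cnj)?, (rule refl | algebra | use R(1,2,5) in algebra))+)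
    moreover have "long_nb (Kite, p + \<Phi>\<^sup>2 * z * u, - (z\<^sup>2 * u), z) (Dart, ?q, ?v, z)"
      by (rule long_swapI[OF other.simps(1)[symmetric]]) simp_all
    ultimately show ?thesis using c' d parent_DD by blast
  qed
  then show ?thesis using that long_unique[OF K] by blast
qed

lemma compose_D_inner:
  assumes c: "(Dart, p, \<Phi> * u, z) \<in> compose H"
  shows "(Kite, p + \<Phi>\<^sup>2 * z * u + \<Phi> * z * - (z * u), z * u, z) \<in> H"
proof -
  note D = compose_DD[OF c]
  note R = wing_dirs_rel[OF D(1)] Phi_square
  show ?thesis
  proof (cases rule: long_cases[OF D(4)])
    case 1
    have "(Kite, p + \<Phi>\<^sup>2 * z * u + \<Phi>\<^sup>2 * (z\<^sup>2 * - (z * u)), - (cnj (cnj z) * (z\<^sup>2 * - (z * u))), cnj (cnj z)) =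
        (Dart, p + \<Phi>\<^sup>2 * cnj z * u, - (cnj z * u), cnj z)"
      by (rule packedD[OF twin[OF short_Dart[OF 1]] D(7) sec_far_K3 sec_wing])
        (((unfold complex_cnj_cnj)?, (rule refl | algebra | use R(1,2,5) in algebra))+)
    then show ?thesis by simp
  next
    case 2
    then show ?thesis by simp
  qed
qed

lemma compose_D_short:
  assumes c: "(Dart, p, \<Phi> * u, z) \<in> compose H"
  obtains c' where "c' \<in> compose H" "short_nb (Dart, p, \<Phi> * u, z) c'"
    "\<And>k. k \<in> H \<Longrightarrow> long_nb (Dart, p + \<Phi>\<^sup>2 * z * u, - (z * u), z) k \<Longrightarrow> parent k c'"
proof -
  note D = compose_DD[OF c]
  note R = wing_dirs_rel[OF D(1)] Phi_square
  let ?q = "p + \<Phi>\<^sup>2 * z * u + \<Phi> * z * - (z * u)" and ?v = "z * u"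
  have K: "(Kite, ?q, ?v, z) \<in> H" by (rule compose_D_inner[OF c])
  have l: "long_nb (Dart, p + \<Phi>\<^sup>2 * z * u, - (z * u), z) (Kite, ?q, ?v, z)"
    by (rule long_swapI[OF other.simps(2)[symmetric]]) simp_all
  have "\<exists>c'\<in>compose H. short_nb (Dart, p, \<Phi> * u, z) c' \<and> parent (Kite, ?q, ?v, z) c'"
  proof (cases rule: short_Kite_cases[OF K])
    case 1
    have "short_nb (Dart, p, \<Phi> * u, z) (Kite, ?q + \<Phi>\<^sup>2 * cnj z * ?v, \<Phi> * - ((cnj z)\<^sup>2 * ?v), z)"
      by (rule short_DKI)
        (((unfold complex_cnj_cnj)?, (rule refl | algebra | use R(1,2,5) in algebra))+)
    with kite_pair[OF K 1] show ?thesis by (blast intro: parent_KK)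
  next
    case 2
    have "(Kite, ?q + \<Phi>\<^sup>2 * z * ?v + \<Phi>\<^sup>2 * - (z * ?v), - (cnj (cnj z) * - (z * ?v)), cnj z) =
        (Dart, p + \<Phi>\<^sup>2 * z * u, - (z * u), cnj z)"
      by (rule packedD[OF short_Dart[OF twin[OF 2]] D(5) sec_wing_K sec_tip])
        (((unfold complex_cnj_cnj)?, (rule refl | algebra | use R(1,2,5) in algebra))+)
    then show ?thesis by simp
  qed
  then show ?thesis using that long_unique[OF D(4) _ K _ l] by blast
qed

lemma compose_KK:
  assumes k: "(Kite, p, u, z) \<in> H"
    and c: "(Kite, p + \<Phi>\<^sup>2 * cnj z * u, \<Phi> * - ((cnj z)\<^sup>2 * u), z) \<in> compose H"
  shows "(Kite, p + \<Phi> * (1 + z) * u, - (z * u), cnj z) \<in> H"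
    "(Dart, p + \<Phi>\<^sup>2 * cnj z * u, - (cnj z * u), cnj z) \<in> H"
proof -
  note D = compose_KD[OF c]
  note R = wing_dirs_rel[OF D(1)] Phi_square
  show "(Kite, p + \<Phi> * (1 + z) * u, - (z * u), cnj z) \<in> H"
    by (rule mem_eq[OF twin[OF short_Dart[OF D(3)]]])
      (((unfold complex_cnj_cnj)?, (rule refl | algebra | use R(1,2,5) in algebra))+)
  show "(Dart, p + \<Phi>\<^sup>2 * cnj z * u, - (cnj z * u), cnj z) \<in> H"
    by (rule mem_eq[OF D(4)])
      (((unfold complex_cnj_cnj)?, (rule refl | algebra | use R(1,2,5) in algebra))+)
qed

lemma compose_KK':
  assumes k: "(Kite, p, u, z) \<in> H"
    and c: "(Kite, p + \<Phi>\<^sup>2 * z * u, \<Phi> * - (z\<^sup>2 * u), cnj z) \<in> compose H"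
  shows "(Kite, p + \<Phi> * (1 + cnj z) * u, - (cnj z * u), z) \<in> H"
    "(Dart, p + \<Phi>\<^sup>2 * z * u, - (z * u), z) \<in> H"
  using compose_KK[OF twin[OF k]] c by simp_all

lemma parent_unique:
  assumes h: "h \<in> H" and c: "c \<in> compose H" "c' \<in> compose H" and pc: "parent h c" "parent h c'"
  shows "c = c'"
proof -
  have 1: False if "(Dart, p, u, z) \<in> H" "(Kite, p, \<Phi> * (z * u), cnj z) \<in> compose H"
    "(Dart, p + \<Phi>\<^sup>2 * u, \<Phi> * - (cnj z * u), z) \<in> compose H" for p u z
  proof -
    note R = wing_dirs_rel[OF dirs[OF that(1)]] Phi_square
    have K: "(Kite, p + \<Phi> * z * u, - u, z) \<in> H"
      by (rule mem_eq[OF compose_D_inner[OF that(3)]])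
        (((unfold complex_cnj_cnj)?, (rule refl | algebra | use R(1,2,5) in algebra))+)
    have D: "(Dart, p, z\<^sup>2 * u, cnj z) \<in> H"
      by (rule mem_eq[OF compose_KD(3)[OF that(2)]])
        (((unfold complex_cnj_cnj)?, (rule refl | algebra | use R(1,2,5) in algebra))+)
    show False
      using long_unique[OF that(1) K D] by (simp add: long_nb_eq)
  qed
  have 2: False if "(Kite, p + \<Phi> * (1 + z) * u, - (z * u), cnj z) \<in> H"
    "(Kite, p, u, z) \<in> H" "(Dart, p + \<Phi>\<^sup>2 * z * u, - (z * u), z) \<in> H" for p u z
    using short_unique[OF that(2,1,3)] by (simp add: short_nb_Kite)
  have 3: False if "(Kite, p, u, z) \<in> H" "(Dart, p, \<Phi> * u, z) \<in> compose H"
    "(Kite, p + \<Phi>\<^sup>2 * cnj z * u, \<Phi> * - ((cnj z)\<^sup>2 * u), z) \<in> compose H" for p u z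
    using 2[OF compose_KK(1)[OF that(1,3)] that(1) compose_DD(4)[OF that(2)]] .
  have 4: False if "(Kite, p, u, z) \<in> H" "(Dart, p, \<Phi> * u, z) \<in> compose H"
    "(Kite, p + \<Phi>\<^sup>2 * z * u, \<Phi> * - (z\<^sup>2 * u), cnj z) \<in> compose H" for p u z
    using 3[OF twin[OF that(1)] compose_twin[OF that(2)]] that(3) by simp
  have 5: False if "(Kite, p, u, z) \<in> H" 
    "(Kite, p + \<Phi>\<^sup>2 * cnj z * u, \<Phi> * - ((cnj z)\<^sup>2 * u), z) \<in> compose H"
    "(Kite, p + \<Phi>\<^sup>2 * z * u, \<Phi> * - (z\<^sup>2 * u), cnj z) \<in> compose H" for p u z
    using 2[OF compose_KK(1)[OF that(1,2)] that(1) compose_KK'(2)[OF that(1,3)]] .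
  obtain s p u z where hs: "h = (s, p, u, z)" by (cases h)
  show ?thesis
  proof (cases s)
    case Kite
    show ?thesis
      using h c pc 3[of p u z] 4[of p u z] 5[of p u z]
      unfolding hs Kite parent_Kite by blast
  next
    case Dart
    show ?thesis
      using h c pc 1[of p u z] unfolding hs Dart parent_Dart by blast
  qed
qed

lemma sector_compose:
  assumes c: "c \<in> compose H" and sec: "sector c x m"
  shows "\<exists>h\<in>H. parent h c \<and> sector h x (m / \<Phi>)"
proof -
  have goal: ?thesis if "h \<in> H" "parent h c" "sector h x' m'" "x' = x" "\<Phi> * m' = m" for h x' m'
    using that by (intro bexI[of _ h]) auto
  obtain s p u' z where c': "c = (s, p, u', z)" by (cases c)
  define u where "u = u' / \<Phi>"
  have u: "u' = \<Phi> * u" by (simp add: u_def)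
  show ?thesis
  proof (cases s)
    case Kite
    have ceq: "c = (Kite, p, \<Phi> * u, z)" using c' u Kite by simp
    note D = compose_KD[OF c[unfolded ceq]]
    note R = wing_dirs_rel[OF D(1)] Phi_square
    have tip: "parent (Dart, p, z * u, cnj z) c"
      unfolding ceq by (rule parent_DKI)
        (((unfold complex_cnj_cnj)?, (rule refl | algebra | use R(1,2,5) in algebra))+)
    have B: "(Kite, p + \<Phi>\<^sup>2 * z * u, - (z\<^sup>2 * u), z) \<in> H"
      by (rule mem_eq[OF twin[OF short_Dart[OF D(4)]]])
        (((unfold complex_cnj_cnj)?, (rule refl | algebra | use R(1,2,5) in algebra))+)
    have PB: "parent (Kite, p + \<Phi>\<^sup>2 * z * u, - (z\<^sup>2 * u), z) c"
      unfolding ceq by (rule parent_KKI)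
        (((unfold complex_cnj_cnj)?, (rule refl | algebra | use R(1,2,5) in algebra))+)
    have PB': "parent (Kite, p + \<Phi>\<^sup>2 * z * u, - (z\<^sup>2 * u), cnj z) c"
      unfolding ceq by (rule parent_KK'I)
        (((unfold complex_cnj_cnj)?, (rule refl | algebra | use R(1,2,5) in algebra))+)
    show ?thesis
      using sec[unfolded ceq]
    proof cases
      case sec_tip
      show ?thesis
        by (rule goal[OF D(4) tip sector.sec_tip]) (unfold sec_tip,
          (((unfold complex_cnj_cnj)?, (rule refl | algebra | use R(1,2,5) in algebra))+))
    next
      case sec_wing
      show ?thesis
        by (rule goal[OF twin[OF B] PB' sector.sec_tip]) (unfold sec_wing,
          (((unfold complex_cnj_cnj)?, (rule refl | algebra | use R(1,2,5) in algebra))+))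
    next
      case sec_wing_K
      show ?thesis
        by (rule goal[OF B PB sector.sec_tip]) (unfold sec_wing_K,
          (((unfold complex_cnj_cnj)?, (rule refl | algebra | use R(1,2,5) in algebra))+))
    next
      case sec_far_K3
      show ?thesis
        by (rule goal[OF B PB sector.sec_wing]) (unfold sec_far_K3,
          (((unfold complex_cnj_cnj)?, (rule refl | algebra | use R(1,2,5) in algebra))+))
    next
      case sec_far_K4
      show ?thesis
        by (rule goal[OF B PB sector.sec_wing_K]) (unfold sec_far_K4,
          (((unfold complex_cnj_cnj)?, (rule refl | algebra | use R(1,2,5) in algebra))+))
    qed
  next
    case Dart
    have ceq: "c = (Dart, p, \<Phi> * u, z)" using c' u Dart by simp
    note D = compose_DD[OF c[unfolded ceq]]
    note R = wing_dirs_rel[OF D(1)] Phi_square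
    have PK: "parent (Kite, p, u, z) c"
      unfolding ceq by (rule parent_KD)
    have P: "parent (Dart, p + \<Phi>\<^sup>2 * z * u, - (z * u), z) c"
      unfolding ceq by (rule parent_DDI)
        (((unfold complex_cnj_cnj)?, (rule refl | algebra | use R(1,2,5) in algebra))+)
    show ?thesis
      using sec[unfolded ceq]
    proof cases
      case sec_tip
      show ?thesis
        by (rule goal[OF D(2) PK sector.sec_tip]) (unfold sec_tip,
          (((unfold complex_cnj_cnj)?, (rule refl | algebra | use R(1,2,5) in algebra))+))
    next
      case sec_wing
      show ?thesis
        by (rule goal[OF D(4) P sector.sec_tip]) (unfold sec_wing,
          (((unfold complex_cnj_cnj)?, (rule refl | algebra | use R(1,2,5) in algebra))+))
    next
      case sec_far_D2
      show ?thesis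
        by (rule goal[OF D(4) P sector.sec_wing]) (unfold sec_far_D2,
          (((unfold complex_cnj_cnj)?, (rule refl | algebra | use R(1,2,5) in algebra))+))
    next
      case sec_far_D3
      show ?thesis
        by (rule goal[OF D(2) PK sector.sec_far_K3]) (unfold sec_far_D3,
          (((unfold complex_cnj_cnj)?, (rule refl | algebra | use R(1,2,5) in algebra))+))
    next
      case sec_far_D4
      show ?thesis
        by (rule goal[OF D(2) PK sector.sec_far_K4]) (unfold sec_far_D4,
          (((unfold complex_cnj_cnj)?, (rule refl | algebra | use R(1,2,5) in algebra))+))
    qed
  qed
qed

lemma half_tiling_compose: "half_tiling (compose H)"
proof
  fix s p u z assume c: "(s, p, u, z) \<in> compose H"
  then show "z \<in> wing_dirs" "u \<noteq> 0"
    by (cases; use dirs axis_nonzero in \<open>fastforce\<close>)+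
  from c show "(s, p, u, cnj z) \<in> compose H" by (rule compose_twin)
next
  fix c assume c: "c \<in> compose H"
  obtain s p u' z where c': "c = (s, p, u', z)" by (cases c)
  define u where "u = u' / \<Phi>"
  have u: "u' = \<Phi> * u" by (simp add: u_def)
  show "\<exists>k\<in>compose H. long_nb c k" "\<exists>k\<in>compose H. short_nb c k"
    using c unfolding c' u
    by (cases s; auto elim: compose_K_long compose_D_long compose_K_short compose_D_short)+
next
  fix c c' x m
  assume "c \<in> compose H" "c' \<in> compose H" "sector c x m" "sector c' x m"
  then show "c = c'"
    using sector_compose packed parent_unique by metis
qed

lemma parent_ex:
  assumes "h \<in> H"
  shows "\<exists>c\<in>compose H. parent h c"
proof -
  obtain s p u z where h: "h = (s, p, u, z)" by (cases h)
  show ?thesis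
  proof (cases s)
    case Kite
    note k = assms[unfolded h Kite]
    consider "(Kite, p + \<Phi> * (1 + z) * u, - (z * u), cnj z) \<in> H"
      | "(Kite, p + \<Phi> * (1 + cnj z) * u, - (cnj z * u), z) \<in> H"
      | "(Dart, p + \<Phi>\<^sup>2 * z * u, - (z * u), z) \<in> H" "(Dart, p + \<Phi>\<^sup>2 * cnj z * u, - (cnj z * u), z) \<in> H"
      using short_Kite_cases[OF k] short_Kite_cases[OF twin[OF k]] twin by (metis complex_cnj_cnj)
    then show ?thesis
    proof cases
      case 1
      then show ?thesis using kite_pair[OF k] parent_KK unfolding h Kite by blast
    next
      case 2
      then show ?thesis using kite_pair[OF twin[OF k]] parent_KK' unfolding h Kite by fastforce
    next
      case 3
      then show ?thesis using compose_D[OF k] parent_KD unfolding h Kite by blast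
    qed
  next
    case Dart
    show ?thesis
      using assms unfolding h Dart
      by (blast elim: Dart_parent_cases intro: parent_DK parent_DD)
  qed
qed

lemma parent_step:
  assumes h: "h \<in> H" "k \<in> H" "half_adj h k" and c: "c \<in> compose H" "parent h c"
  shows "\<exists>d\<in>compose H. parent k d \<and> (d = c \<or> half_adj c d)"
proof -
  have adj: "k = twin h \<or> long_nb h k \<or> short_nb h k" using h(3) by (simp add: half_adj_def)
  have stay: ?thesis if "parent k c" using that c by blast
  have move: ?thesis if "d \<in> compose H" "parent k d" "half_adj c d" for d using that by blast
  show ?thesis
    using c(2)
  proof cases
    case (parent_DK p u z)
    have hd: "(Dart, p, u, z) \<in> H" using h(1) parent_DK by simp
    have cc: "(Kite, p, \<Phi> * (z * u), cnj z) \<in> compose H" using c(1) parent_DK by simp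
    note D = compose_KD[OF cc]
    note R = wing_dirs_rel[OF dirs[OF hd]] Phi_square
    show ?thesis using adj
    proof (elim disjE)
      assume k: "k = twin h"
      have e: "cnj z * (z * u) = u" using R(1) by algebra
      obtain c' where "c' \<in> compose H" "long_nb c c'" "parent k c'"
        by (rule compose_K_long[OF cc]) (auto simp: k parent_DK e)
      then show ?thesis using move by (auto simp: half_adj_def)
    next
      assume k: "long_nb h k"
      have N: "(Dart, p, z\<^sup>2 * u, cnj z) \<in> H"
        by (rule mem_eq[OF D(3)])
          (((unfold complex_cnj_cnj)?, (rule refl | algebra | use R(1,2,5) in algebra))+)
      have k: "k = (Dart, p, z\<^sup>2 * u, cnj z)"
        using long_unique[OF h(1,2) N k] by (simp add: parent_DK long_same)
      have "parent k (twin c)"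
        unfolding k parent_DK twin.simps by (rule parent_DKI)
          (((unfold complex_cnj_cnj)?, (rule refl | algebra | use R(1,2,5) in algebra))+)
      then show ?thesis using move[of "twin c"] compose_twin[OF cc] parent_DK by (simp add: half_adj_def)
    next
      assume k: "short_nb h k"
      have k: "k = (Kite, p + \<Phi>\<^sup>2 * u, - (cnj z * u), z)"
        using k by (simp add: parent_DK short_nb_Dart)
      show ?thesis
        by (rule stay, unfold k parent_DK, rule parent_KK'I)
          (((unfold complex_cnj_cnj)?, (rule refl | algebra | use R(1,2,5) in algebra))+)
    qed
  next
    case (parent_DD p u z)
    have hd: "(Dart, p, u, z) \<in> H" using h(1) parent_DD by simp
    have cc: "(Dart, p + \<Phi>\<^sup>2 * u, \<Phi> * - (cnj z * u), z) \<in> compose H" using c(1) parent_DD by simp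
    note R = wing_dirs_rel[OF dirs[OF hd]] Phi_square
    have e1: "p + \<Phi>\<^sup>2 * u + \<Phi>\<^sup>2 * z * - (cnj z * u) = p" using R(1) by algebra
    have e2: "- (z * - (cnj z * u)) = u" using R(1) by algebra
    show ?thesis using adj
    proof (elim disjE)
      assume k: "k = twin h"
      obtain c' where "c' \<in> compose H" "long_nb c c'" "parent k c'"
        by (rule compose_D_long[OF cc, unfolded e1 e2]) (use h in \<open>auto simp: k parent_DD\<close>)
      then show ?thesis using move by (auto simp: half_adj_def)
    next
      assume k: "long_nb h k"
      obtain c' where "c' \<in> compose H" "short_nb c c'" "parent k c'"
        by (rule compose_D_short[OF cc, unfolded e1 e2]) (use k h in \<open>auto simp: parent_DD\<close>)
      then show ?thesis using move by (auto simp: half_adj_def)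
    next
      assume k: "short_nb h k"
      have k: "k = (Kite, p + \<Phi>\<^sup>2 * u, - (cnj z * u), z)"
        using k by (simp add: parent_DD short_nb_Dart)
      show ?thesis
        by (rule stay, unfold k parent_DD, rule parent_KDI)
          (((unfold complex_cnj_cnj)?, (rule refl | algebra | use R(1,2,5) in algebra))+)
    qed
  next
    case (parent_KD p u z)
    have hk: "(Kite, p, u, z) \<in> H" using h(1) parent_KD by simp
    have cc: "(Dart, p, \<Phi> * u, z) \<in> compose H" using c(1) parent_KD by simp
    note D = compose_DD[OF cc]
    note R = wing_dirs_rel[OF D(1)] Phi_square
    show ?thesis using adj
    proof (elim disjE)
      assume k: "k = twin h"
      have "parent k (twin c)"
        unfolding k parent_KD twin.simps by (rule parent.parent_KD)
      then show ?thesis using move[of "twin c"] compose_twin[OF cc] parent_KD by (simp add: half_adj_def)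
    next
      assume k: "long_nb h k"
      obtain c' where "c' \<in> compose H" "long_nb c c'" "parent k c'"
        by (rule compose_D_long[OF cc]) (use k h in \<open>auto simp: parent_KD\<close>)
      then show ?thesis using move by (auto simp: half_adj_def)
    next
      assume k: "short_nb h k"
      have k: "k = (Dart, p + \<Phi>\<^sup>2 * z * u, - (z * u), z)"
        using short_unique[OF h(1,2) D(4) k] by (simp add: parent_KD short_KD)
      show ?thesis
        by (rule stay, unfold k parent_KD, rule parent_DDI)
          (((unfold complex_cnj_cnj)?, (rule refl | algebra | use R(1,2,5) in algebra))+)
    qed
  next
    case (parent_KK p u z)
    have hk: "(Kite, p, u, z) \<in> H" using h(1) parent_KK by simp
    have cc: "(Kite, p + \<Phi>\<^sup>2 * cnj z * u, \<Phi> * - ((cnj z)\<^sup>2 * u), z) \<in> compose H"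
      using c(1) parent_KK by simp
    note R = wing_dirs_rel[OF dirs[OF hk]] Phi_square
    have e1: "p + \<Phi>\<^sup>2 * cnj z * u + \<Phi>\<^sup>2 * z * - ((cnj z)\<^sup>2 * u) = p" using R(1) by algebra
    have e2: "- (z\<^sup>2 * - ((cnj z)\<^sup>2 * u)) = u" using R(1) by algebra
    show ?thesis using adj
    proof (elim disjE)
      assume k: "k = twin h"
      show ?thesis
        by (rule stay, unfold k parent_KK twin.simps, rule parent_KK'I)
          (((unfold complex_cnj_cnj)?, (rule refl | algebra | use R(1,2,5) in algebra))+)
    next
      assume k: "long_nb h k"
      obtain c' where "c' \<in> compose H" "short_nb c c'" "parent k c'"
        by (rule compose_K_short[OF cc, unfolded e1 e2]) (use k h in \<open>auto simp: parent_KK\<close>)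
      then show ?thesis using move by (auto simp: half_adj_def)
    next
      assume k: "short_nb h k"
      have k: "k = (Kite, p + \<Phi> * (1 + z) * u, - (z * u), cnj z)"
        using short_unique[OF h(1,2) compose_KK(1)[OF hk cc] k] by (simp add: parent_KK short_KK)
      have "parent k (twin c)"
        unfolding k parent_KK twin.simps by (rule parent_KKI)
          (((unfold complex_cnj_cnj)?, (rule refl | algebra | use R(1,2,5) in algebra))+)
      then show ?thesis using move[of "twin c"] compose_twin[OF cc] parent_KK by (simp add: half_adj_def)
    qed
  next
    case (parent_KK' p u z)
    have hk: "(Kite, p, u, z) \<in> H" using h(1) parent_KK' by simp
    have cc: "(Kite, p + \<Phi>\<^sup>2 * z * u, \<Phi> * - (z\<^sup>2 * u), cnj z) \<in> compose H"
      using c(1) parent_KK' by simp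
    note R = wing_dirs_rel[OF dirs[OF hk]] Phi_square
    have e1: "p + \<Phi>\<^sup>2 * z * u + \<Phi>\<^sup>2 * cnj z * - (z\<^sup>2 * u) = p" using R(1) by algebra
    have e2: "- ((cnj z)\<^sup>2 * - (z\<^sup>2 * u)) = u" using R(1) by algebra
    show ?thesis using adj
    proof (elim disjE)
      assume k: "k = twin h"
      show ?thesis
        by (rule stay, unfold k parent_KK' twin.simps, rule parent_KKI)
          (((unfold complex_cnj_cnj)?, (rule refl | algebra | use R(1,2,5) in algebra))+)
    next
      assume k: "long_nb h k"
      obtain c' where "c' \<in> compose H" "long_nb c c'" "parent k c'"
        by (rule compose_K_long[OF cc, unfolded e1 e2]) (use k h in \<open>auto simp: parent_KK'\<close>)
      then show ?thesis using move by (auto simp: half_adj_def)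
    next
      assume k: "short_nb h k"
      have k: "k = (Dart, p + \<Phi>\<^sup>2 * z * u, - (z * u), z)"
        using short_unique[OF h(1,2) compose_KK'(2)[OF hk cc] k] by (simp add: parent_KK' short_KD)
      show ?thesis
        by (rule stay, unfold k parent_KK', rule parent_DKI)
          (((unfold complex_cnj_cnj)?, (rule refl | algebra | use R(1,2,5) in algebra))+)
    qed
  qed
qed

end

section \<open>The Galois conjugate\<close>

fun lat_eval :: "complex \<Rightarrow> int \<times> int \<times> int \<times> int \<Rightarrow> complex" where
  "lat_eval w (a, b, c, d) = of_int a + of_int b * w + of_int c * w\<^sup>2 + of_int d * w ^ 3"

definition lat :: "complex set" where
  "lat = range (lat_eval \<zeta>)"

definition star :: "complex \<Rightarrow> complex" where
  "star x = lat_eval (\<zeta> ^ 3) (inv (lat_eval \<zeta>) x)"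

lemma zeta_in [simp]: "\<zeta> \<in> wing_dirs" "cnj \<zeta> \<in> wing_dirs"
  by (auto simp: wing_dirs_def)

lemma zeta_power4: "\<zeta> ^ 4 = \<zeta> ^ 3 - \<zeta>\<^sup>2 + \<zeta> - 1"
  using wing_dirs_rel(1,2)[OF zeta_in(1)] Phi_square by algebra

lemma zeta_power4': "(\<zeta> ^ 3) ^ 4 = (\<zeta> ^ 3) ^ 3 - (\<zeta> ^ 3)\<^sup>2 + \<zeta> ^ 3 - 1"
  using zeta_power4 by algebra

lemma sqrt5_irrational: "sqrt 5 \<notin> \<rat>"
proof
  assume "sqrt 5 \<in> \<rat>"
  then obtain m n :: nat where n: "n \<noteq> 0" "\<bar>sqrt 5\<bar> = real m / real n" "coprime m n"
    by (rule Rats_abs_nat_div_natE)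
  have p5: "prime (5 :: nat)" by simp
  have "real m ^ 2 = 5 * real n ^ 2"
    using arg_cong[OF n(2), of "\<lambda>x. x ^ 2"] n(1) by (simp add: power_divide field_simps)
  then have eq: "m ^ 2 = 5 * n ^ 2" by (metis of_nat_eq_iff of_nat_mult of_nat_numeral of_nat_power)
  then have "5 dvd m ^ 2" by simp
  then have m: "5 dvd m" using p5 prime_dvd_power by blast
  then obtain k where "m = 5 * k" ..
  with eq have "n ^ 2 = 5 * k ^ 2" by (simp add: power2_eq_square)
  then have "5 dvd n ^ 2" by simp
  then have "5 dvd n" using p5 prime_dvd_power by blast
  with m n(3) show False by (metis coprime_common_divisor_nat not_prime_1 p5 nat_dvd_1_iff_1 coprime_def)
qed

lemma phi_irrational: "of_int a + of_int b * phi = 0 \<Longrightarrow> a = 0 \<and> b = 0"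
proof -
  assume h: "of_int a + of_int b * phi = 0"
  have b: "b = 0"
  proof (rule ccontr)
    assume b: "b \<noteq> 0"
    have "sqrt 5 = 2 * phi - 1" by (simp add: phi_def field_simps)
    also have "phi = - of_int a / of_int b" using h b by (simp add: field_simps)
    finally have "sqrt 5 \<in> \<rat>" by simp
    then show False using sqrt5_irrational by simp
  qed
  with h show ?thesis by simp
qed

lemma zeta_eq: "\<zeta> = Complex (phi / 2) (sin (pi / 5))"
  by (simp add: zeta_def complex_eq_iff phi_eq_cos)

lemma sin_pos: "sin (pi / 5) > 0"
  by (rule sin_gt_zero) auto

lemma zeta_squares:
  "\<zeta>\<^sup>2 = \<Phi> * \<zeta> - 1" "\<zeta> ^ 3 = \<Phi> * \<zeta> - \<Phi>"
  using wing_dirs_rel(1,2)[OF zeta_in(1)] Phi_square by algebra+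

lemma inj_lat_eval: "inj (lat_eval \<zeta>)"
proof (rule injI)
  fix q r assume eq: "lat_eval \<zeta> q = lat_eval \<zeta> r"
  obtain a b c d where q: "q = (a, b, c, d)" by (cases q)
  obtain a' b' c' d' where r: "r = (a', b', c', d')" by (cases r)
  define A B C D where "A = a - a'" "B = b - b'" "C = c - c'" "D = d - d'"
  have "of_int A + of_int B * \<zeta> + of_int C * \<zeta>\<^sup>2 + of_int D * \<zeta> ^ 3 = (0 :: complex)"
    using eq by (simp add: q r A_B_C_D_def algebra_simps)
  then have e: "of_int A + of_int B * \<zeta> + of_int C * (\<Phi> * \<zeta> - 1) + of_int D * (\<Phi> * \<zeta> - \<Phi>) = 0"
    by (simp only: zeta_squares)
  have "sin (pi / 5) * (of_int B + of_int (C + D) * phi) = 0"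
    using arg_cong[OF e, of Im] by (simp add: zeta_eq algebra_simps)
  then have BCD: "B = 0" "C + D = 0"
    using sin_pos phi_irrational[of B "C + D"] by auto
  have "of_int (A - C) + of_int (- D) * phi + phi / 2 * (of_int B + of_int (C + D) * phi) = 0"
    using arg_cong[OF e, of Re] by (simp add: zeta_eq algebra_simps)
  then have "of_int (A - C) + of_int (- D) * phi = 0" using BCD by simp
  then have "A - C = 0" "- D = 0" using phi_irrational by blast+
  with BCD show "q = r" by (simp add: q r A_B_C_D_def)
qed

lemma star_eval: "star (lat_eval \<zeta> q) = lat_eval (\<zeta> ^ 3) q"
  by (simp add: star_def inj_lat_eval)

lemma lat_0: "0 \<in> lat" and lat_1: "1 \<in> lat" and star_0: "star 0 = 0" and star_1: "star 1 = 1"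
proof -
  have "lat_eval w (0, 0, 0, 0) = 0" "lat_eval w (1, 0, 0, 0) = 1" for w by auto
  then show "0 \<in> lat" "1 \<in> lat" "star 0 = 0" "star 1 = 1"
    unfolding lat_def using star_eval by (metis rangeI)+
qed

lemma lat_add:
  assumes "x \<in> lat" "y \<in> lat"
  shows "x + y \<in> lat" "star (x + y) = star x + star y"
proof -
  obtain q r where xy: "x = lat_eval \<zeta> q" "y = lat_eval \<zeta> r" using assms by (auto simp: lat_def)
  obtain t where t: "lat_eval w t = lat_eval w q + lat_eval w r" for w
  proof (cases q, cases r)
    fix a b c d a' b' c' d' assume "q = (a, b, c, d)" "r = (a', b', c', d')"
    then show ?thesis
      by (intro that[of "(a + a', b + b', c + c', d + d')"]) (simp add: algebra_simps)
  qed
  show "x + y \<in> lat" "star (x + y) = star x + star y"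
    using t by (simp_all add: xy lat_def star_eval flip: t)
qed

lemma lat_minus:
  assumes "x \<in> lat"
  shows "- x \<in> lat" "star (- x) = - star x"
proof -
  obtain q where x: "x = lat_eval \<zeta> q" using assms by (auto simp: lat_def)
  obtain t where t: "lat_eval w t = - lat_eval w q" for w
  proof (cases q)
    fix a b c d assume "q = (a, b, c, d)"
    then show ?thesis
      by (intro that[of "(- a, - b, - c, - d)"]) (simp add: algebra_simps)
  qed
  show "- x \<in> lat" "star (- x) = - star x"
    using t by (simp_all add: x lat_def star_eval flip: t)
qed

lemma lat_zeta:
  assumes "x \<in> lat"
  shows "\<zeta> * x \<in> lat" "star (\<zeta> * x) = \<zeta> ^ 3 * star x"
proof -
  obtain q where x: "x = lat_eval \<zeta> q" using assms by (auto simp: lat_def)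
  obtain t where t: "w ^ 4 = w ^ 3 - w\<^sup>2 + w - 1 \<Longrightarrow> lat_eval w t = w * lat_eval w q" for w
  proof (cases q)
    fix a b c d assume q: "q = (a, b, c, d)"
    have "lat_eval w (- d, a + d, b - d, c + d) = w * lat_eval w q"
      if "w ^ 4 = w ^ 3 - w\<^sup>2 + w - 1" for w
      using that unfolding q lat_eval.simps of_int_add of_int_diff of_int_minus by algebra
    then show ?thesis by (rule that)
  qed
  show "\<zeta> * x \<in> lat" "star (\<zeta> * x) = \<zeta> ^ 3 * star x"
    by (simp_all add: x lat_def star_eval flip: t[OF zeta_power4] t[OF zeta_power4'])
qed

lemma lat_dirs:
  assumes x: "x \<in> lat" and z: "z \<in> wing_dirs"
  shows "z * x \<in> lat" "star (z * x) = z ^ 3 * star x"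
proof -
  have R: "\<zeta> * cnj \<zeta> = 1" "\<zeta> + cnj \<zeta> = \<Phi>" using wing_dirs_rel[OF zeta_in(1)] by auto
  have e: "cnj \<zeta> * x = x + - (\<zeta> * x) + \<zeta> * (\<zeta> * x) + - (\<zeta> * (\<zeta> * (\<zeta> * x)))"
    using R Phi_square by algebra
  have in_lat: "cnj \<zeta> * x \<in> lat"
    unfolding e by (intro lat_add lat_minus lat_zeta x)
  have "star x = star (\<zeta> * (cnj \<zeta> * x))" using R by (simp flip: mult.assoc)
  also have "\<dots> = \<zeta> ^ 3 * star (cnj \<zeta> * x)" by (rule lat_zeta[OF in_lat])
  finally have "star (cnj \<zeta> * x) = (cnj \<zeta>) ^ 3 * star x"
    using R(1) by algebra
  then show "z * x \<in> lat" "star (z * x) = z ^ 3 * star x"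
    using z in_lat lat_zeta[OF x] by (auto simp: wing_dirs_def)
qed

lemma lat_Phi:
  assumes x: "x \<in> lat"
  shows "\<Phi> * x \<in> lat" "star (\<Phi> * x) = (1 - \<Phi>) * star x"
proof -
  have R: "\<zeta> * cnj \<zeta> = 1" "\<zeta> + cnj \<zeta> = \<Phi>" using wing_dirs_rel[OF zeta_in(1)] by auto
  have e: "\<Phi> * x = \<zeta> * x + cnj \<zeta> * x" by (simp flip: R(2) add: distrib_right)
  note D = lat_dirs[OF x zeta_in(1)] lat_dirs[OF x zeta_in(2)]
  show "\<Phi> * x \<in> lat" unfolding e by (intro lat_add D)
  have "star (\<Phi> * x) = \<zeta> ^ 3 * star x + (cnj \<zeta>) ^ 3 * star x"
    unfolding e by (simp add: lat_add D)
  then show "star (\<Phi> * x) = (1 - \<Phi>) * star x"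
    using R Phi_square by algebra
qed

lemma norm_dirs: "z \<in> wing_dirs \<Longrightarrow> norm z = 1"
  by (auto simp: wing_dirs_def zeta_def)

lemma norm_Phi': "norm (1 - \<Phi>) = phi - 1"
proof -
  have "norm (1 - \<Phi>) = norm (of_real (1 - phi) :: complex)" by simp
  also have "\<dots> = phi - 1" using phi_bounds by (simp only: norm_of_real)
  finally show ?thesis .
qed

section \<open>Walks\<close>

inductive walk :: "half set \<Rightarrow> nat \<Rightarrow> half \<Rightarrow> half \<Rightarrow> bool" for H where
  walk_0: "h \<in> H \<Longrightarrow> walk H 0 h h"
| walk_Suc: "walk H n h k \<Longrightarrow> half_adj k l \<Longrightarrow> l \<in> H \<Longrightarrow> walk H (Suc n) h l"

lemma walk_mem: "walk X n h k \<Longrightarrow> h \<in> X \<and> k \<in> X"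
  by (induction rule: walk.induct) auto

lemma (in half_tiling) walk_compose:
  assumes "walk H n h k" "c \<in> compose H" "parent h c"
  shows "\<exists>m\<le>n. \<exists>d. parent k d \<and> walk (compose H) m c d"
  using assms
proof (induction rule: walk.induct)
  case (walk_0 h)
  then have "walk (compose H) 0 c c" by (intro walk.walk_0)
  then show ?case using walk_0 by blast
next
  case (walk_Suc n h k l)
  then obtain m d where m: "m \<le> n" "parent k d" "walk (compose H) m c d" by blast
  have "k \<in> H" "d \<in> compose H" using walk_Suc.hyps(1) m(3) walk_mem by blast+
  with parent_step[OF _ walk_Suc.hyps(3,2)] m
  obtain e where e: "e \<in> compose H" "parent l e" "e = d \<or> half_adj d e" by blast
  then show ?case using m walk.walk_Suc[OF m(3)] by (metis Suc_le_mono le_SucI)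
qed

definition graded :: "half set \<Rightarrow> real \<Rightarrow> bool" where
  "graded X \<mu> \<longleftrightarrow> (\<forall>(s, p, u, z)\<in>X. p \<in> lat \<and> u \<in> lat \<and> norm (star u) = \<mu>)"

fun tip :: "half \<Rightarrow> complex" where "tip (s, p, u, z) = p"
fun wing :: "half \<Rightarrow> complex" where "wing (s, p, u, z) = p + \<Phi> * z * u"
fun far :: "half \<Rightarrow> complex" where
  "far (Kite, p, u, z) = p + \<Phi> * u"
| "far (Dart, p, u, z) = p + u"

lemma gradedD:
  assumes "graded X \<mu>" "(s, p, u, z) \<in> X"
  shows "p \<in> lat" "u \<in> lat" "norm (star u) = \<mu>"
  using assms by (auto simp: graded_def)

lemma norm_star_steps:
  assumes u: "u \<in> lat" and z: "z \<in> wing_dirs"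
  shows "\<Phi> * u \<in> lat" "norm (star (\<Phi> * u)) = (phi - 1) * norm (star u)"
    "z * u \<in> lat" "norm (star (z * u)) = norm (star u)"
  using lat_Phi[OF u] lat_dirs[OF u z]
  by (simp_all add: norm_mult norm_Phi' norm_power norm_dirs[OF z])

lemma (in half_tiling) graded_compose:
  assumes g: "graded H \<mu>"
  shows "graded (compose H) (\<mu> * (phi - 1))"
  unfolding graded_def
proof (clarify)
  fix s p u' z assume c: "(s, p, u', z) \<in> compose H"
  have 1: "p \<in> lat \<and> u \<in> lat \<and> norm (star u) = \<mu>" if "u' = \<Phi> * u" for u
  proof (cases s)
    case Kite
    with c that have "(Dart, p, z * u, z) \<in> H" and z: "z \<in> wing_dirs"
      using compose_KD by blast+
    note G = gradedD[OF g this(1)]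
    have "u = cnj z * (z * u)" using wing_dirs_rel(1)[OF z] by algebra
    then show ?thesis
      using G norm_star_steps[OF G(2) wing_dirs_cnj[OF z]] by metis
  next
    case Dart
    with c that have "(Kite, p, u, z) \<in> H" using compose_DD by blast
    then show ?thesis using gradedD[OF g] by blast
  qed
  have "u' = \<Phi> * (u' / \<Phi>)" by simp
  with 1 norm_star_steps[of "u' / \<Phi>", OF _ zeta_in(1)]
  show "p \<in> lat \<and> u' \<in> lat \<and> norm (star u') = \<mu> * (phi - 1)" by (metis mult.commute)
qed

lemma step_bound:
  assumes X: "half_tiling X" and g: "graded X \<mu>"
    and h: "h \<in> X" and "half_adj h k \<or> parent h k"
  shows "norm (star (tip k) - star (tip h)) \<le> 2 * \<mu>"
proof -
  obtain s p u z where hs: "h = (s, p, u, z)" by (cases h)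
  note G = gradedD[OF g h[unfolded hs]]
  note z = half_tiling.dirs[OF X h[unfolded hs]]
  note z' = wing_dirs_cnj[OF z]
  note N = norm_star_steps[OF _ z] norm_star_steps[OF _ z']
  have p1: "0 \<le> phi - 1" "phi - 1 \<le> 1" using phi_bounds by auto
  have \<mu>: "\<mu> \<ge> 0" using G(3) by auto
  have m1: "x \<le> \<mu> \<Longrightarrow> 0 \<le> x \<Longrightarrow> (phi - 1) * x \<le> \<mu>" for x
    using mult_mono[of "phi - 1" 1 x \<mu>] p1 by simp
  have shift: "norm (star (p + v) - star p) = norm (star v)" if "v \<in> lat" for v
    using lat_add[OF G(1) that] by simp
  define a where "a = \<Phi> * (z * u)"
  define b where "b = \<Phi> * (cnj z * u)"
  define c where "c = \<Phi> * u"
  have a: "a \<in> lat" "norm (star a) \<le> \<mu>"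
    using N[OF G(2)] N[of "z * u"] G m1[of \<mu>] \<mu> by (auto simp: a_def)
  have b: "b \<in> lat" "norm (star b) \<le> \<mu>"
    using N[OF G(2)] N[of "cnj z * u"] G m1[of \<mu>] \<mu> by (auto simp: b_def)
  have c: "c \<in> lat" "norm (star c) \<le> \<mu>"
    using N[OF G(2)] G m1[of \<mu>] \<mu> by (auto simp: c_def)
  have sq: "\<Phi> * x \<in> lat \<and> norm (star (\<Phi> * x)) \<le> \<mu>" if "x \<in> lat" "norm (star x) \<le> \<mu>" for x
    using N[OF that(1)] m1[OF that(2)] by auto
  have ca: "c + a \<in> lat" "norm (star (c + a)) \<le> 2 * \<mu>"
    using lat_add[OF c(1) a(1)] norm_triangle_ineq[of "star c" "star a"] a c by auto
  have "\<exists>v. v \<in> lat \<and> norm (star v) \<le> 2 * \<mu> \<and> tip k = p + v"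
  proof -
    have w: "\<exists>v. v \<in> lat \<and> norm (star v) \<le> 2 * \<mu> \<and> tip k = p + v"
      if "tip k \<in> {p, p + a, p + (c + a), p + \<Phi> * a, p + \<Phi> * b, p + \<Phi> * c}"
      using that a ca sq[OF a] sq[OF b] sq[OF c] lat_0 star_0 \<mu>
      by (elim insertE emptyE) (force intro: exI[of _ "0::complex"])+
    show ?thesis
      by (rule w, use assms(4) in \<open>cases s\<close>)
        (auto simp: hs half_adj_def long_nb_eq short_nb_Kite short_nb_Dart parent_Kite parent_Dart
          a_def b_def c_def power2_eq_square algebra_simps)
  qed
  then show ?thesis using shift by (auto simp: hs)
qed

lemma walk_bound_N:
  assumes "half_tiling X" "graded X \<mu>" "walk X n h k"
  shows "norm (star (tip k) - star (tip h)) \<le> 2 * \<mu> * n"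
  using assms(3)
proof (induction rule: walk.induct)
  case (walk_Suc n h k l)
  have "norm (star (tip l) - star (tip k)) \<le> 2 * \<mu>"
    using step_bound[OF assms(1,2)] walk_mem[OF walk_Suc.hyps(1)] walk_Suc.hyps(2)
    by blast
  then show ?case
    using walk_Suc.IH norm_triangle_ineq[of "star (tip l) - star (tip k)" "star (tip k) - star (tip h)"]
    by (simp add: algebra_simps)
qed simp

text \<open>Following the walk through \<open>i\<close> successive compositions shrinks the conjugate step length by
  \<open>(phi - 1) ^ i\<close> without increasing the number of steps.\<close>

lemma walk_bound_i:
  assumes "half_tiling X" "graded X \<mu>" "walk X n h k"
  shows "norm (star (tip k) - star (tip h)) \<le> \<mu> * (4 / (2 - phi) + 2 * real n * (phi - 1) ^ i)"
  using assms
proof (induction i arbitrary: X \<mu> n h k)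
  case 0
  have "\<mu> \<ge> 0" using walk_mem[OF 0(3)] gradedD(3)[OF 0(2)] by (metis norm_ge_zero prod_cases4)
  then have "0 \<le> \<mu> * (4 / (2 - phi))" using phi_bounds by simp
  moreover have "norm (star (tip k) - star (tip h)) \<le> 2 * \<mu> * n"
    using 0 by (rule walk_bound_N)
  ultimately show ?case by (simp add: algebra_simps)
next
  case (Suc i)
  interpret half_tiling X by fact
  have hk: "h \<in> X" "k \<in> X" using walk_mem[OF Suc.prems(3)] by auto
  have \<mu>: "\<mu> \<ge> 0" using hk gradedD(3)[OF Suc.prems(2)] by (metis norm_ge_zero prod_cases4)
  obtain c where c: "c \<in> compose X" "parent h c" using parent_ex[OF hk(1)] by blast
  obtain m d where d: "m \<le> n" "parent k d" "walk (compose X) m c d"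
    using walk_compose[OF Suc.prems(3) c] by blast
  have 1: "norm (star (tip d) - star (tip c)) \<le>
      \<mu> * (phi - 1) * (4 / (2 - phi) + 2 * real m * (phi - 1) ^ i)"

    by (rule Suc.IH[OF half_tiling_compose graded_compose[OF Suc.prems(2)] d(3)])
  have "real m * (phi - 1) ^ i \<le> n * (phi - 1) ^ i"
    using d(1) phi_bounds by (intro mult_right_mono) auto
  then have 2: "\<mu> * (phi - 1) * (4 / (2 - phi) + 2 * real m * (phi - 1) ^ i) \<le>
      \<mu> * (phi - 1) * (4 / (2 - phi) + 2 * real n * (phi - 1) ^ i)"
    using \<mu> phi_bounds by (intro mult_left_mono) auto
  have 3: "norm (star (tip c) - star (tip h)) \<le> 2 * \<mu>" "norm (star (tip d) - star (tip k)) \<le> 2 * \<mu>"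
    using step_bound[OF Suc.prems(1,2)] hk c(2) d(2) by blast+
  have "norm (star (tip k) - star (tip h)) \<le>
      norm (star (tip d) - star (tip c)) + norm (star (tip c) - star (tip h)) + norm (star (tip d) - star (tip k))"
    using norm_triangle_ineq[of "star (tip d) - star (tip c)" "star (tip c) - star (tip h)"]
      norm_triangle_ineq4[of "star (tip d) - star (tip h)" "star (tip d) - star (tip k)"]
    by (simp add: algebra_simps)
  also have "\<dots> \<le> \<mu> * ((phi - 1) * (4 / (2 - phi) + 2 * real n * (phi - 1) ^ i) + 4)"
    using 1 2 3 by (simp add: algebra_simps)
  also have "(phi - 1) * (4 / (2 - phi) + 2 * real n * (phi - 1) ^ i) + 4 =
      4 / (2 - phi) + 2 * real n * (phi - 1) ^ Suc i"
    using phi_bounds by (simp add: field_simps)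
  finally show ?case .
qed

lemma walk_bound:
  assumes "half_tiling X" "graded X \<mu>" "walk X n h k"
  shows "norm (star (tip k) - star (tip h)) \<le> \<mu> * (4 / (2 - phi))"
proof (rule LIMSEQ_le_const)
  have "(\<lambda>i. (phi - 1) ^ i) \<longlonglongrightarrow> 0"
    using phi_bounds by (intro LIMSEQ_realpow_zero) auto
  then show "(\<lambda>i. \<mu> * (4 / (2 - phi) + 2 * real n * (phi - 1) ^ i)) \<longlonglongrightarrow> \<mu> * (4 / (2 - phi))"
    using phi_bounds by (auto intro!: tendsto_eq_intros)
qed (use walk_bound_i[OF assms] in blast)

section \<open>The conjugate area of a patch\<close>

fun shape_of :: "half \<Rightarrow> shape" where "shape_of (s, p, u, z) = s"
fun dir_of :: "half \<Rightarrow> complex" where "dir_of (s, p, u, z) = z"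

definition cross :: "complex \<Rightarrow> complex \<Rightarrow> real" where
  "cross a b = Re a * Im b - Im a * Re b"

definition orient :: "complex \<Rightarrow> real" where
  "orient z = (if z = \<zeta> then 1 else - 1)"

definition long_flux :: "complex \<Rightarrow> half \<Rightarrow> real" where
  "long_flux c h = orient (dir_of h) * cross (star (wing h) - c) (star (tip h) - c)"

definition short_flux :: "complex \<Rightarrow> half \<Rightarrow> real" where
  "short_flux c h = orient (dir_of h) * cross (star (far h) - c) (star (wing h) - c)"

fun conj_weight :: "shape \<Rightarrow> real" where
  "conj_weight Kite = 1 - phi"
| "conj_weight Dart = 1"

lemma abs_cross_le: "\<bar>cross a b\<bar> \<le> norm a * norm b"
proof -
  have "cross a b = Im (cnj a * b)" by (simp add: cross_def)
  then show ?thesis using abs_Im_le_cmod[of "cnj a * b"] by (simp add: norm_mult)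
qed

lemma orient_cnj: "z \<in> wing_dirs \<Longrightarrow> orient (cnj z) = - orient z"
  using wing_dirs_rel(3)[OF zeta_in(1)] by (auto simp: wing_dirs_def orient_def)

lemma long_nb_ends:
  assumes "z \<in> wing_dirs" "long_nb (s, p, u, z) k"
  shows "long_nb k (s, p, u, z)" "long_flux c k = - long_flux c (s, p, u, z)"
proof -
  note R = wing_dirs_rel(1,2)[OF assms(1)] Phi_square
  have 1: "(cnj z)\<^sup>2 * (z\<^sup>2 * u) = u" using R(1) by algebra
  have 2: "other (other s) = s" by (cases s) auto
  show "long_nb k (s, p, u, z)"
    using assms(2) 1 2 by (auto simp: long_nb_eq)
  consider "k = (s, p, z\<^sup>2 * u, cnj z)" | "k = (other s, p + \<Phi> * z * u, - u, z)"
    using assms(2) long_nb_eq by blast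
  then show "long_flux c k = - long_flux c (s, p, u, z)"
  proof cases
    case 1
    have "wing k = wing (s, p, u, z)"
      unfolding 1 wing.simps using R by algebra
    moreover have "dir_of k = cnj z" "tip k = p" by (simp_all add: 1)
    ultimately show ?thesis using orient_cnj[OF assms(1)] by (simp add: long_flux_def)
  next
    case 2
    then show ?thesis by (simp add: long_flux_def cross_def algebra_simps)
  qed
qed

lemma short_nb_ends:
  assumes "z \<in> wing_dirs" "short_nb (s, p, u, z) k"
  shows "short_nb k (s, p, u, z)" "short_flux c k = - short_flux c (s, p, u, z)"
proof -
  note R = wing_dirs_rel(1,2)[OF assms(1)] Phi_square
  note o = orient_cnj[OF assms(1)]
  show "short_nb k (s, p, u, z)"
  proof (cases s)
    case Kite
    consider "k = (Kite, p + \<Phi> * (1 + z) * u, - (z * u), cnj z)"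
      | "k = (Dart, p + \<Phi>\<^sup>2 * z * u, - (z * u), z)"
      using assms(2) Kite short_nb_Kite by blast
    then show ?thesis
    proof cases
      case 1
      show ?thesis unfolding 1 Kite by (rule short_KKI)
        (((unfold complex_cnj_cnj)?, (rule refl | algebra | use R in algebra))+)
    next
      case 2
      show ?thesis unfolding 2 Kite by (rule short_DKI)
        (((unfold complex_cnj_cnj)?, (rule refl | algebra | use R in algebra))+)
    qed
  next
    case Dart
    then have k: "k = (Kite, p + \<Phi>\<^sup>2 * u, - (cnj z * u), z)" using assms(2) short_nb_Dart by blast
    show ?thesis unfolding k Dart by (rule short_KDI)
      (((unfold complex_cnj_cnj)?, (rule refl | algebra | use R in algebra))+)
  qed
  have KD: "short_flux c (Dart, q, v, z) = - short_flux c (Kite, q', v', z)"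
    if "q' = q + \<Phi>\<^sup>2 * v" "v' = - (cnj z * v)" for q v q' v'
  proof -
    have "far (Kite, q', v', z) = wing (Dart, q, v, z)" "wing (Kite, q', v', z) = far (Dart, q, v, z)"
      unfolding far.simps wing.simps that by (algebra | use R in algebra)+
    then show ?thesis by (simp only: short_flux_def dir_of.simps) (simp add: cross_def algebra_simps)
  qed
  show "short_flux c k = - short_flux c (s, p, u, z)"
  proof (cases s)
    case Kite
    consider "k = (Kite, p + \<Phi> * (1 + z) * u, - (z * u), cnj z)"
      | "k = (Dart, p + \<Phi>\<^sup>2 * z * u, - (z * u), z)"
      using assms(2) Kite short_nb_Kite by blast
    then show ?thesis
    proof cases
      case 1
      have "far k = far (Kite, p, u, z)" "wing k = wing (Kite, p, u, z)"
        unfolding 1 far.simps wing.simps by (algebra | use R in algebra)+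
      moreover have "dir_of k = cnj z" by (simp add: 1)
      ultimately show ?thesis using o by (simp add: short_flux_def Kite)
    next
      case 2
      show ?thesis unfolding 2 Kite by (rule KD)
        (((unfold complex_cnj_cnj)?, (rule refl | algebra | use R in algebra))+)
    qed
  next
    case Dart
    then have k: "k = (Kite, p + \<Phi>\<^sup>2 * u, - (cnj z * u), z)" using assms(2) short_nb_Dart by blast
    show ?thesis using KD[of "p + \<Phi>\<^sup>2 * u" p u] by (simp add: k Dart)
  qed
qed

lemma sum_antisymmetric_bound:
  fixes f :: "'a \<Rightarrow> real"
  assumes P: "finite P" and N: "\<And>h. h \<in> P \<Longrightarrow> N h \<in> P \<Longrightarrow> N (N h) = h"
    and f: "\<And>h. h \<in> P \<Longrightarrow> f (N h) = - f h" and B: "\<And>h. h \<in> P \<Longrightarrow> \<bar>f h\<bar> \<le> B"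
  shows "\<bar>sum f P\<bar> \<le> B * card {h \<in> P. N h \<notin> P}"
proof -
  let ?Q = "{h \<in> P. N h \<in> P}" and ?R = "{h \<in> P. N h \<notin> P}"
  have "sum f ?Q = sum (\<lambda>h. - f h) ?Q"
    by (rule sum.reindex_bij_witness[of _ N N]) (use N f in auto)
  then have "sum f ?Q = 0" by (simp add: sum_negf)
  moreover have "sum f P = sum f ?Q + sum f ?R"
    by (subst sum.union_disjoint[symmetric]) (use P in \<open>auto intro: sum.cong\<close>)
  ultimately have "\<bar>sum f P\<bar> \<le> (\<Sum>h\<in>?R. \<bar>f h\<bar>)" by simp
  also have "\<dots> \<le> B * card ?R"
    using sum_bounded_above[of ?R "\<lambda>h. \<bar>f h\<bar>" B] B by (simp add: mult.commute)
  finally show ?thesis .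
qed

lemma flux_twin:
  assumes z: "z \<in> wing_dirs" and pu: "p \<in> lat" "u \<in> lat" "norm (star u) = 1"
  shows "long_flux c (s, p, u, z) + short_flux c (s, p, u, z) +
      (long_flux c (s, p, u, cnj z) + short_flux c (s, p, u, cnj z)) =
    2 * ((1 - phi) * Im (\<zeta> ^ 3)) * conj_weight s"
proof -
  define f where "f z = long_flux c (s, p, u, z) + short_flux c (s, p, u, z)" for z
  define P U w where "P = star p - c" "U = star u" "w = \<zeta> ^ 3"
  have wing: "star (wing (s, p, u, z)) - c = P + of_real (1 - phi) * (z ^ 3 * U)" if "z \<in> wing_dirs" for z
    using lat_add(2)[OF pu(1) lat_Phi(1)[OF lat_dirs(1)[OF pu(2) that]]] lat_Phi(2)[OF lat_dirs(1)[OF pu(2) that]]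
      lat_dirs(2)[OF pu(2) that] by (simp add: P_U_w_def mult.assoc)
  have far: "star (far (s, p, u, z)) - c = P + of_real (conj_weight s) * U" for z
    using lat_add(2)[OF pu(1) lat_Phi(1)[OF pu(2)]] lat_Phi(2)[OF pu(2)] lat_add(2)[OF pu(1,2)]
    by (cases s) (simp_all add: P_U_w_def)
  have n: "(Re U)\<^sup>2 + (Im U)\<^sup>2 = 1" using pu(3) by (simp add: P_U_w_def flip: cmod_power2)
  have o: "orient (cnj \<zeta>) = - 1" "orient \<zeta> = 1" using orient_cnj[of \<zeta>] by (simp_all add: orient_def)
  have c3: "(cnj \<zeta>) ^ 3 = cnj w" by (simp add: P_U_w_def)
  have "f \<zeta> + f (cnj \<zeta>) = 2 * ((1 - phi) * Im w) * conj_weight s * ((Re U)\<^sup>2 + (Im U)\<^sup>2)"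
    unfolding f_def long_flux_def short_flux_def dir_of.simps o wing[OF zeta_in(1)] wing[OF zeta_in(2)] far c3
      tip.simps P_U_w_def(3)[symmetric] P_U_w_def(1)[symmetric]
    by (simp add: cross_def power2_eq_square algebra_simps)
  then have "f \<zeta> + f (cnj \<zeta>) = 2 * ((1 - phi) * Im (\<zeta> ^ 3)) * conj_weight s"
    unfolding n by (simp add: P_U_w_def)
  moreover have "f z + f (cnj z) = f \<zeta> + f (cnj \<zeta>)"
    using z by (auto simp: wing_dirs_def)
  ultimately show ?thesis by (simp add: f_def)
qed

context half_tiling
begin

definition long_of :: "half \<Rightarrow> half" where
  "long_of h = (THE k. k \<in> H \<and> long_nb h k)"

definition short_of :: "half \<Rightarrow> half" where
  "short_of h = (THE k. k \<in> H \<and> short_nb h k)"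

lemma long_of: "h \<in> H \<Longrightarrow> k \<in> H \<Longrightarrow> long_nb h k \<Longrightarrow> long_of h = k"
  unfolding long_of_def using long_unique by blast

lemma short_of: "h \<in> H \<Longrightarrow> k \<in> H \<Longrightarrow> short_nb h k \<Longrightarrow> short_of h = k"
  unfolding short_of_def using short_unique by blast

lemma long_of_props:
  assumes h: "h \<in> H"
  shows "long_of h \<in> H" "long_nb h (long_of h)" "long_of (long_of h) = h"
    "long_flux c (long_of h) = - long_flux c h"
proof -
  obtain k where k: "k \<in> H" "long_nb h k" using long_ex[OF h] by blast
  have e: "long_of h = k" using long_of h k by blast
  obtain s p u z where hs: "h = (s, p, u, z)" by (cases h)
  note z = dirs[OF h[unfolded hs]]
  show "long_of h \<in> H" "long_nb h (long_of h)" using k e by auto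
  show "long_of (long_of h) = h" "long_flux c (long_of h) = - long_flux c h"
    using long_nb_ends[OF z, of s p u k] long_of[OF k(1) h] k e hs by auto
qed

lemma short_of_props:
  assumes h: "h \<in> H"
  shows "short_of h \<in> H" "short_nb h (short_of h)" "short_of (short_of h) = h"
    "short_flux c (short_of h) = - short_flux c h"
proof -
  obtain k where k: "k \<in> H" "short_nb h k" using short_ex[OF h] by blast
  have e: "short_of h = k" using short_of h k by blast
  obtain s p u z where hs: "h = (s, p, u, z)" by (cases h)
  note z = dirs[OF h[unfolded hs]]
  show "short_of h \<in> H" "short_nb h (short_of h)" using k e by auto
  show "short_of (short_of h) = h" "short_flux c (short_of h) = - short_flux c h"
    using short_nb_ends[OF z, of s p u k] short_of[OF k(1) h] k e hs by auto
qed

text \<open>By the shoelace formula in the conjugate plane, where all corners lie in a disc.\<close>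

theorem conj_weight_bound:
  assumes g: "graded H 1" and conn: "\<And>h k. h \<in> H \<Longrightarrow> k \<in> H \<Longrightarrow> \<exists>n. walk H n h k"
  shows "\<exists>C\<ge>0::real. \<forall>P. finite P \<longrightarrow> P \<subseteq> H \<longrightarrow> (\<forall>h\<in>P. twin h \<in> P) \<longrightarrow>
    \<bar>\<Sum>h\<in>P. conj_weight (shape_of h)\<bar> \<le> C * card {h \<in> P. \<exists>k\<in>H. half_adj h k \<and> k \<notin> P}"
proof (cases "H = {}")
  case True
  then show ?thesis by (intro exI[of _ 0]) auto
next
  case False
  then obtain h0 where h0: "h0 \<in> H" by blast
  define c where "c = star (tip h0)"
  define B where "B = 4 / (2 - phi) + 1"
  define \<kappa> where "\<kappa> = (1 - phi) * Im (\<zeta> ^ 3)"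
  have "Im (\<zeta> ^ 3) = phi * sin (pi / 5)"
    by (subst zeta_squares(2)) (simp add: zeta_eq)
  then have \<kappa>: "\<kappa> \<noteq> 0" using sin_pos phi_bounds by (simp add: \<kappa>_def)
  have B0: "B \<ge> 0" using phi_bounds by (simp add: B_def)
  have near: "norm (star x - c) \<le> B" if hx: "h \<in> H" "x \<in> {tip h, wing h, far h}" for h x
  proof -
    obtain n where "walk H n h0 h" using conn h0 \<open>h \<in> H\<close> by blast
    from walk_bound[OF half_tiling_axioms g this]
    have t: "norm (star (tip h) - c) \<le> B - 1" by (simp add: c_def B_def)
    obtain s p u z where hs: "h = (s, p, u, z)" by (cases h)
    have z: "z \<in> wing_dirs" using dirs that(1) hs by blast
    note G = gradedD[OF g that(1)[unfolded hs]]
    note N = norm_star_steps[OF G(2) z]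
    have ph: "phi - 1 \<le> 1" "0 \<le> phi - 1" using phi_bounds by auto
    obtain v where v: "v \<in> lat" "norm (star v) \<le> 1" "x = tip h + v"
    proof -
      have "x = tip h + 0 \<or> x = tip h + \<Phi> * (z * u) \<or> x = tip h + \<Phi> * u \<or> x = tip h + u"
        using hx(2) by (cases s) (auto simp: hs)
      moreover have "\<Phi> * (z * u) \<in> lat" "norm (star (\<Phi> * (z * u))) \<le> 1"
        using norm_star_steps[OF N(3) z] N G ph by auto
      ultimately show ?thesis
        using that[of 0] that[of "\<Phi> * (z * u)"] that[of "\<Phi> * u"] that[of u] lat_0 star_0 N G ph by auto
    qed
    have "star x - c = (star (tip h) - c) + star v"
      using lat_add(2)[OF _ v(1)] G(1) v(3) by (simp add: hs)
    then have "norm (star x - c) \<le> norm (star (tip h) - c) + norm (star v)"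
      by (simp only: norm_triangle_ineq)
    then show ?thesis using t v(2) by linarith
  qed
  have flux: "\<bar>long_flux c h\<bar> \<le> B * B" "\<bar>short_flux c h\<bar> \<le> B * B" if "h \<in> H" for h
  proof -
    have "\<bar>cross (star x - c) (star y - c)\<bar> \<le> B * B" if "x \<in> {tip h, wing h, far h}" "y \<in> {tip h, wing h, far h}" for x y
      using abs_cross_le[of "star x - c" "star y - c"] near[OF \<open>h \<in> H\<close> that(1)] near[OF \<open>h \<in> H\<close> that(2)] B0
        mult_mono[of "norm (star x - c)" B "norm (star y - c)" B] by (meson norm_ge_zero order_trans)
    then show "\<bar>long_flux c h\<bar> \<le> B * B" "\<bar>short_flux c h\<bar> \<le> B * B"
      by (auto simp: long_flux_def short_flux_def orient_def)
  qed
  have bound: "\<bar>\<Sum>h\<in>P. conj_weight (shape_of h)\<bar> \<le>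
      2 * (B * B) / \<bar>\<kappa>\<bar> * card {h \<in> P. \<exists>k\<in>H. half_adj h k \<and> k \<notin> P}" (is "_ \<le> _ * real (card ?bd)")
    if P: "finite P" "P \<subseteq> H" "\<forall>h\<in>P. twin h \<in> P" for P
  proof -
    define f where "f h = long_flux c h + short_flux c h" for h
    have tw: "f h + f (twin h) = 2 * \<kappa> * conj_weight (shape_of h)" "twin (twin h) = h" if "h \<in> P" for h
    proof -
      obtain s p u z where hs: "h = (s, p, u, z)" by (cases h)
      have "(s, p, u, z) \<in> H" using that P(2) hs by auto
      with flux_twin[OF dirs gradedD[OF g]] show "f h + f (twin h) = 2 * \<kappa> * conj_weight (shape_of h)"
        by (auto simp: hs f_def \<kappa>_def)
      show "twin (twin h) = h" by (simp add: hs)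
    qed
    have "(\<Sum>h\<in>P. f (twin h)) = sum f P"
      by (rule sum.reindex_bij_witness[of _ twin twin]) (use P tw in auto)
    then have "2 * sum f P = (\<Sum>h\<in>P. f h + f (twin h))" by (simp add: sum.distrib)
    also have "\<dots> = 2 * \<kappa> * (\<Sum>h\<in>P. conj_weight (shape_of h))"
      by (simp add: tw sum_distrib_left)
    finally have eq: "sum f P = \<kappa> * (\<Sum>h\<in>P. conj_weight (shape_of h))" by simp
    have "\<bar>sum f P\<bar> \<le> \<bar>sum (long_flux c) P\<bar> + \<bar>sum (short_flux c) P\<bar>"
      unfolding f_def sum.distrib by (rule abs_triangle_ineq)
    also have "\<bar>sum (long_flux c) P\<bar> \<le> B * B * card {h \<in> P. long_of h \<notin> P}"
      by (rule sum_antisymmetric_bound[OF P(1)]) (use P long_of_props flux in auto)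
    also have "\<bar>sum (short_flux c) P\<bar> \<le> B * B * card {h \<in> P. short_of h \<notin> P}"
      by (rule sum_antisymmetric_bound[OF P(1)]) (use P short_of_props flux in auto)
    also have "real (card {h \<in> P. long_of h \<notin> P}) \<le> card ?bd"
      unfolding of_nat_le_iff by (rule card_mono) (use P(1) in simp, use P(2) long_of_props(1,2) in \<open>unfold half_adj_def, blast\<close>)
    also have "real (card {h \<in> P. short_of h \<notin> P}) \<le> card ?bd"
      unfolding of_nat_le_iff by (rule card_mono) (use P(1) in simp, use P(2) short_of_props(1,2) in \<open>unfold half_adj_def, blast\<close>)
    finally have "\<bar>sum f P\<bar> \<le> 2 * (B * B) * card ?bd" using B0 by (simp add: mult_left_mono)
    then show ?thesis using \<kappa> unfolding eq by (simp add: abs_mult field_simps)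
  qed
  show ?thesis
    by (rule exI[of _ "2 * (B * B) / \<bar>\<kappa>\<bar>"]) (use bound in auto)
qed

end

section \<open>Tilings of the complex plane\<close>

type_synonym ctile = "shape \<times> complex \<times> complex"

fun axis_len :: "shape \<Rightarrow> real" where
  "axis_len Kite = phi"
| "axis_len Dart = 1"

text \<open>Coordinates of \<open>w\<close> with respect to \<open>1\<close> and the one of \<open>\<zeta>\<close>, \<open>cnj \<zeta>\<close> on the same side of the
  real axis as \<open>w\<close>.\<close>

definition coef_b :: "complex \<Rightarrow> real" where
  "coef_b w = \<bar>Im w\<bar> / sin (pi / 5)"

definition coef_a :: "complex \<Rightarrow> real" where
  "coef_a w = Re w - phi / 2 * coef_b w"

fun region_c :: "ctile \<Rightarrow> complex set" where
  "region_c (s, p, u) = {q. 0 \<le> coef_a ((q - p) / u) \<and>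
     coef_a ((q - p) / u) / axis_len s + coef_b ((q - p) / u) / phi \<le> 1}"

fun core_c :: "ctile \<Rightarrow> complex set" where
  "core_c (s, p, u) = {q. 0 < coef_a ((q - p) / u) \<and>
     coef_a ((q - p) / u) / axis_len s + coef_b ((q - p) / u) / phi < 1}"

fun half_of :: "ctile \<Rightarrow> complex \<Rightarrow> half" where
  "half_of (s, p, u) z = (s, p, u, z)"

definition long_edge :: "half \<Rightarrow> complex set" where
  "long_edge h = closed_segment (tip h) (wing h)"

definition short_edge :: "half \<Rightarrow> complex set" where
  "short_edge h = closed_segment (wing h) (far h)"

definition edges_c :: "ctile \<Rightarrow> complex set set" where
  "edges_c c = (\<Union>z\<in>wing_dirs. {long_edge (half_of c z), short_edge (half_of c z)})"

definition corners_c :: "ctile \<Rightarrow> complex set" where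
  "corners_c c = (\<Union>z\<in>wing_dirs. {tip (half_of c z), wing (half_of c z), far (half_of c z)})"

definition labels_c :: "ctile \<Rightarrow> (complex \<times> label) set" where
  "labels_c c = (\<Union>z\<in>wing_dirs. {(tip (half_of c z), corner_label (fst c) Tip),
     (wing (half_of c z), corner_label (fst c) Wing1), (far (half_of c z), corner_label (fst c) Far)})"

lemma axis_len_pos: "axis_len s > 0"
  using phi_bounds by (cases s) auto

lemma far_eq: "far (s, p, u, z) = p + of_real (axis_len s) * u"
  by (cases s) auto

lemma dirs_Re_Im: "z \<in> wing_dirs \<Longrightarrow> Re z = phi / 2 \<and> \<bar>Im z\<bar> = sin (pi / 5)"
  using sin_pos by (auto simp: wing_dirs_def zeta_eq)

lemma coefs:
  assumes "z \<in> wing_dirs" "\<beta> \<ge> 0"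
  shows "coef_b (of_real \<alpha> + of_real \<beta> * z) = \<beta>" "coef_a (of_real \<alpha> + of_real \<beta> * z) = \<alpha>"
proof -
  show 1: "coef_b (of_real \<alpha> + of_real \<beta> * z) = \<beta>"
    using dirs_Re_Im[OF assms(1)] assms(2) sin_pos by (simp add: coef_b_def abs_mult)
  show "coef_a (of_real \<alpha> + of_real \<beta> * z) = \<alpha>"
    using dirs_Re_Im[OF assms(1)] by (simp add: coef_a_def 1)
qed

lemma coef_b_nonneg: "coef_b w \<ge> 0"
  using sin_pos by (simp add: coef_b_def)

lemma coefs_ex: "\<exists>z\<in>wing_dirs. w = of_real (coef_a w) + of_real (coef_b w) * z"
proof (cases "Im w \<ge> 0")
  case True
  then show ?thesis using sin_pos
    by (intro bexI[of _ \<zeta>] zeta_in) (simp_all add: complex_eq_iff coef_a_def coef_b_def zeta_eq)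
next
  case False
  then show ?thesis using sin_pos
    by (intro bexI[of _ "cnj \<zeta>"] zeta_in) (simp_all add: complex_eq_iff coef_a_def coef_b_def zeta_eq)
qed

lemma coef_shift: "coef_b (w + of_real r) = coef_b w" "coef_a (w + of_real r) = coef_a w + r"
  by (simp_all add: coef_a_def coef_b_def)

lemma continuous_coefs:
  "continuous_on UNIV (\<lambda>q. coef_b ((q - p) / u))" "continuous_on UNIV (\<lambda>q. coef_a ((q - p) / u))"
  unfolding coef_a_def coef_b_def divide_inverse by (intro continuous_intros)+

lemma open_core: "open (core_c c)"
  by (cases c) (auto intro!: open_Collect_conj open_Collect_less continuous_intros continuous_coefs
      simp: divide_inverse[of _ "axis_len _"] divide_inverse[of _ phi])

lemma closed_region: "closed (region_c c)"
  by (cases c) (auto intro!: closed_Collect_conj closed_Collect_le continuous_intros continuous_coefs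
      simp: divide_inverse[of _ "axis_len _"] divide_inverse[of _ phi])

lemma core_subset: "core_c c \<subseteq> region_c c"
  by (cases c) auto

lemma core_interior: "core_c c \<subseteq> interior (region_c c)"
  using core_subset open_core by (rule interior_maximal)

lemma corner_coords:
  assumes "u \<noteq> 0"
  shows "(tip (s, p, u, z) - p) / u = of_real 0 + of_real 0 * z"
    "(wing (s, p, u, z) - p) / u = of_real 0 + of_real phi * z"
    "(far (s, p, u, z) - p) / u = of_real (axis_len s) + of_real 0 * z"
  using assms by (simp_all add: far_eq)

lemma edge_coords:
  assumes q: "q \<in> long_edge (s, p, u, z) \<or> q \<in> short_edge (s, p, u, z)"
    and u: "u \<noteq> 0" and z: "z \<in> wing_dirs"
  shows "coef_a ((q - p) / u) = 0 \<and> coef_b ((q - p) / u) \<le> phi \<or>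
    0 \<le> coef_a ((q - p) / u) \<and> coef_a ((q - p) / u) / axis_len s + coef_b ((q - p) / u) / phi = 1"
  using q
proof
  have phi: "phi > 0" using phi_bounds by simp
  assume "q \<in> long_edge (s, p, u, z)"
  then obtain t where t: "0 \<le> t" "t \<le> 1" "q = (1 - t) *\<^sub>R p + t *\<^sub>R (p + \<Phi> * z * u)"
    by (auto simp: long_edge_def in_segment)
  have "(q - p) / u = of_real 0 + of_real (t * phi) * z"
    using u unfolding t(3) by (simp add: scaleR_conv_of_real field_simps)
  then show ?thesis using coefs[OF z, of "t * phi" 0] t phi mult_right_mono[of t 1 phi] by simp
next
  have phi: "phi > 0" using phi_bounds by simp
  note a = axis_len_pos[of s]
  assume "q \<in> short_edge (s, p, u, z)"
  then obtain t where t: "0 \<le> t" "t \<le> 1" "q = (1 - t) *\<^sub>R (p + \<Phi> * z * u) + t *\<^sub>R (p + of_real (axis_len s) * u)"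
    by (auto simp: short_edge_def in_segment far_eq)
  have "(q - p) / u = of_real (t * axis_len s) + of_real ((1 - t) * phi) * z"
    using u unfolding t(3) by (simp add: scaleR_conv_of_real field_simps)
  then show ?thesis using coefs[OF z, of "(1 - t) * phi" "t * axis_len s"] t phi a by simp
qed

lemma edge_subset:
  assumes "e \<in> edges_c c" "snd (snd c) \<noteq> 0"
  shows "e \<subseteq> region_c c"
proof
  fix q assume q: "q \<in> e"
  obtain s p u where c: "c = (s, p, u)" by (cases c)
  from assms obtain z where z: "z \<in> wing_dirs" "e = long_edge (s, p, u, z) \<or> e = short_edge (s, p, u, z)"
    by (auto simp: c edges_c_def)
  have phi: "phi > 0" using phi_bounds by simp
  show "q \<in> region_c c"
    using edge_coords[OF _ _ z(1), of q s p u] q z(2) assms(2) phi by (auto simp: c)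
qed

lemma edge_limit:
  assumes "e \<in> edges_c c" "snd (snd c) \<noteq> 0" "q \<in> e" "r > 0"
  shows "\<exists>x. dist q x < r \<and> x \<notin> region_c c"
proof -
  obtain s p u where c: "c = (s, p, u)" by (cases c)
  from assms obtain z where z: "z \<in> wing_dirs" "e = long_edge (s, p, u, z) \<or> e = short_edge (s, p, u, z)"
    by (auto simp: c edges_c_def)
  have u: "u \<noteq> 0" using assms(2) c by simp
  define d where "d = r / (2 * norm u)"
  have d: "d > 0" using assms u by (simp add: d_def)
  have dist: "dist q (q + of_real e * u) < r" if "\<bar>e\<bar> = d" for e
    using that u assms(4) by (simp add: dist_norm norm_mult d_def)
  have sh: "(q + of_real e * u - p) / u = (q - p) / u + of_real e" for e
    using u by (simp add: field_simps)
  from edge_coords[OF _ u z(1), of q s p] z(2) assms(3)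
  consider "coef_a ((q - p) / u) = 0" | "coef_a ((q - p) / u) / axis_len s + coef_b ((q - p) / u) / phi = 1"
    by auto
  then show ?thesis
  proof cases
    case 1
    have "q + of_real (- d) * u \<notin> region_c c"
      unfolding c region_c.simps mem_Collect_eq sh coef_shift 1 using d by simp
    moreover have "\<bar>- d\<bar> = d" using d by simp
    ultimately show ?thesis using dist by blast
  next
    case 2
    have "(coef_a ((q - p) / u) + d) / axis_len s + coef_b ((q - p) / u) / phi > 1"
      using 2 divide_pos_pos[OF d axis_len_pos[of s]] unfolding add_divide_distrib by linarith
    then have "q + of_real d * u \<notin> region_c c"
      unfolding c region_c.simps mem_Collect_eq sh coef_shift by simp
    moreover have "\<bar>d\<bar> = d" using d by simp
    ultimately show ?thesis using dist by blast
  qed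
qed

lemma region_cases:
  assumes q: "q \<in> region_c c" and u: "snd (snd c) \<noteq> 0"
  shows "q \<in> core_c c \<or> (\<exists>e\<in>edges_c c. q \<in> e)"
proof -
  obtain s p u where c: "c = (s, p, u)" by (cases c)
  have u: "u \<noteq> 0" using u c by simp
  define w where "w = (q - p) / u"
  have qw: "q = p + w * u" using u by (simp add: w_def)
  obtain z where z: "z \<in> wing_dirs" "w = of_real (coef_a w) + of_real (coef_b w) * z"
    using coefs_ex by blast
  have phi: "phi > 0" using phi_bounds by simp
  note a = axis_len_pos[of s]
  have R: "0 \<le> coef_a w" "coef_a w / axis_len s + coef_b w / phi \<le> 1"
    using q by (auto simp: c w_def)
  show ?thesis
  proof (cases "q \<in> core_c c")
    case False
    then consider "coef_a w = 0" | "coef_a w / axis_len s + coef_b w / phi = 1"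
      using R by (fastforce simp: c w_def)
    then have "q \<in> long_edge (s, p, u, z) \<or> q \<in> short_edge (s, p, u, z)"
    proof cases
      case 1
      define t where "t = coef_b w / phi"
      have t: "0 \<le> t" "t \<le> 1" "coef_b w = t * phi"
        using R 1 coef_b_nonneg[of w] phi by (simp_all add: t_def)
      have "q = (1 - t) *\<^sub>R p + t *\<^sub>R (p + \<Phi> * z * u)"
        unfolding qw by (subst z(2)) (simp add: 1 t(3) scaleR_conv_of_real algebra_simps)
      then show ?thesis using t by (auto simp: long_edge_def in_segment)
    next
      case 2
      define t where "t = coef_a w / axis_len s"
      have t: "0 \<le> t" "coef_a w = t * axis_len s" "coef_b w = (1 - t) * phi"
        using R 2 phi a by (simp_all add: t_def field_simps)
        have "coef_b w / phi \<ge> 0" using coef_b_nonneg[of w] phi by simp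
      then have t1: "t \<le> 1" using 2 unfolding t_def by linarith
      have "q = (1 - t) *\<^sub>R (p + \<Phi> * z * u) + t *\<^sub>R (p + of_real (axis_len s) * u)"
        unfolding qw by (subst z(2)) (simp add: t scaleR_conv_of_real algebra_simps)
      then show ?thesis using t t1 by (auto simp: short_edge_def in_segment far_eq)
    qed
    then show ?thesis using z(1) by (auto simp: edges_c_def c)
  qed simp
qed

lemma region_closure:
  assumes "snd (snd c) \<noteq> 0"
  shows "region_c c \<subseteq> closure (interior (region_c c))"
proof
  fix q assume q: "q \<in> region_c c"
  obtain s p u where c: "c = (s, p, u)" by (cases c)
  have u: "u \<noteq> 0" using assms c by simp
  define w where "w = (q - p) / u"
  have qw: "q = p + w * u" using u by (simp add: w_def)
  note a = axis_len_pos[of s]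
  have R: "0 \<le> coef_a w" "coef_a w / axis_len s + coef_b w / phi \<le> 1"
    using q by (auto simp: c w_def)
  define f where "f t = p + (of_real (1 - t) * w + of_real (t * axis_len s / 2)) * u" for t
  have core: "f t \<in> core_c c" if t: "0 < t" "t < 1" for t
  proof -
    have e: "(f t - p) / u = of_real (1 - t) * w + of_real (t * axis_len s / 2)"
      using u by (simp add: f_def)
    have cb: "coef_b (of_real (1 - t) * w) = (1 - t) * coef_b w"
      using t by (simp add: coef_b_def abs_mult)
    have ca: "coef_a (of_real (1 - t) * w) = (1 - t) * coef_a w"
      by (simp only: coef_a_def cb) (simp add: field_simps)
    have "(1 - t) * (coef_a w / axis_len s + coef_b w / phi) \<le> 1 - t"
      using mult_left_mono[OF R(2), of "1 - t"] t by simp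
    moreover have "((1 - t) * coef_a w + t * axis_len s / 2) / axis_len s + (1 - t) * coef_b w / phi =
        (1 - t) * (coef_a w / axis_len s + coef_b w / phi) + t / 2"
      using a by (simp add: field_simps)
    ultimately have "((1 - t) * coef_a w + t * axis_len s / 2) / axis_len s + (1 - t) * coef_b w / phi < 1"
      using t by linarith
    moreover have "(1 - t) * coef_a w + t * axis_len s / 2 > 0"
      using R t a by (intro add_nonneg_pos) auto
    ultimately show ?thesis
      unfolding c core_c.simps mem_Collect_eq e coef_shift ca cb by blast
  qed
  have "isCont f 0"
    unfolding f_def by (intro continuous_intros) auto
  then have "(\<lambda>n. f (1 / real (Suc (Suc n)))) \<longlonglongrightarrow> f 0"
    by (rule isCont_tendsto_compose) (intro LIMSEQ_Suc lim_1_over_n)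
  moreover have "f 0 = q" by (simp add: f_def qw)
  moreover have "f (1 / real (Suc (Suc n))) \<in> interior (region_c c)" for n
    by (rule subsetD[OF core_interior core]) simp_all
  ultimately show "q \<in> closure (interior (region_c c))"
    by (metis closure_sequential)
qed

lemma corners_subset:
  assumes "snd (snd c) \<noteq> 0"
  shows "corners_c c \<subseteq> region_c c"
proof -
  obtain s p u where c: "c = (s, p, u)" by (cases c)
  have ends: "tip h \<in> long_edge h" "wing h \<in> long_edge h" "far h \<in> short_edge h" for h
    by (simp_all add: long_edge_def short_edge_def)
  show ?thesis
  proof
    fix x assume "x \<in> corners_c c"
    then obtain z where z: "z \<in> wing_dirs"
      "x = tip (half_of c z) \<or> x = wing (half_of c z) \<or> x = far (half_of c z)"
      unfolding corners_c_def by blast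
    have "long_edge (half_of c z) \<in> edges_c c" "short_edge (half_of c z) \<in> edges_c c"
      using z(1) unfolding edges_c_def by blast+
    then show "x \<in> region_c c"
      using edge_subset[OF _ assms] ends[of "half_of c z"] z(2) by blast
  qed
qed

lemma sector_core:
  assumes sec: "sector (s, p, u, z) x m" and z: "z \<in> wing_dirs" and u: "u \<noteq> 0"
  shows "\<exists>\<alpha> \<beta>. 0 < \<alpha> \<and> 0 < \<beta> \<and> \<alpha> / axis_len s + \<beta> / phi < 1 \<and>
    (x + of_real (1 / 10) * m - p) / u = of_real \<alpha> + of_real \<beta> * z"
proof -
  note R = wing_dirs_rel(1,2)[OF z] Phi_square
  have ph: "phi * phi = phi + 1" "3 / 2 < phi" "phi < 2" using phi_square phi_bounds by (auto simp: power2_eq_square)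
  have "1 / phi = phi - 1" using ph by (simp add: field_simps)
  then have inv: "r / phi = r * (phi - 1)" for r :: real by (metis times_divide_eq_right mult.right_neutral)
  have sq: "phi * (phi * r) = phi * r + r" for r :: real using ph(1) by (metis distrib_right mult.assoc mult_1)
  have main: ?thesis
    if m: "m = (of_real m1 + of_real m2 * z) * u" and x: "x = p + (of_real x1 + of_real x2 * z) * u"
      and "0 < x1 + m1 / 10" "0 < x2 + m2 / 10" "(x1 + m1 / 10) / axis_len s + (x2 + m2 / 10) * (phi - 1) < 1"
    for m1 m2 x1 x2
  proof (intro exI conjI)
    show "(x + of_real (1 / 10) * m - p) / u = of_real (x1 + m1 / 10) + of_real (x2 + m2 / 10) * z"
      using u unfolding m x by (simp add: field_simps)
  qed (use that inv in auto)
  from sec show ?thesis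
  proof cases
    case sec_tip
    show ?thesis
      by (rule main[of 1 1 0 0]; cases s; use ph sq[of 4] in \<open>simp add: inv sec_tip; (simp add: field_simps)?\<close>)
  next
    case sec_wing
    have m: "m = (of_real 1 + of_real (- 1 - phi) * z) * u"
      unfolding sec_wing of_real_diff of_real_minus of_real_1 using R by algebra
    show ?thesis
      by (rule main[of _ _ 0 phi, OF m]; cases s; use ph sq[of 4] in \<open>simp add: inv sec_wing; (simp add: field_simps)?\<close>)
  next
    case sec_wing_K
    have m: "m = (of_real (1 + phi) + of_real (- 2 * phi) * z) * u"
      unfolding sec_wing_K of_real_add of_real_1 of_real_mult of_real_numeral of_real_minus using R by algebra
    show ?thesis
      by (rule main[of _ _ 0 phi, OF m]; use ph sq[of 4] in \<open>simp add: inv sec_wing_K; (simp add: field_simps)?\<close>)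
  next
    case sec_far_K3
    have m: "m = (of_real (- 2 * phi) + of_real (1 + phi) * z) * u"
      unfolding sec_far_K3 of_real_add of_real_1 of_real_mult of_real_numeral of_real_minus using R by algebra
    show ?thesis
      by (rule main[of _ _ phi 0, OF m]; use ph sq[of 4] in \<open>simp add: inv sec_far_K3; (simp add: field_simps)?\<close>)
  next
    case sec_far_K4
    have m: "m = (of_real (- 1 - phi) + of_real 1 * z) * u"
      unfolding sec_far_K4 of_real_diff of_real_1 of_real_minus using R by algebra
    show ?thesis
      by (rule main[of _ _ phi 0, OF m]; use ph sq[of 4] in \<open>simp add: inv sec_far_K4; (simp add: field_simps)?\<close>)
  next
    case sec_far_D2
    have m: "m = (of_real (- 1 - phi) + of_real (2 * phi) * z) * u"
      unfolding sec_far_D2 of_real_diff of_real_1 of_real_minus of_real_mult of_real_numeral using R by algebra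
    show ?thesis
      by (rule main[of _ _ 1 0, OF m]; use ph sq[of 4] in \<open>simp add: inv sec_far_D2; (simp add: field_simps)?\<close>)
  next
    case sec_far_D3
    have m: "m = (of_real (- 2 * phi) + of_real (1 + phi) * z) * u"
      unfolding sec_far_D3 of_real_add of_real_1 of_real_mult of_real_numeral of_real_minus using R by algebra
    show ?thesis
      by (rule main[of _ _ 1 0, OF m]; use ph sq[of 4] in \<open>simp add: inv sec_far_D3; (simp add: field_simps)?\<close>)
  next
    case sec_far_D4
    have m: "m = (of_real (- 1 - phi) + of_real 1 * z) * u"
      unfolding sec_far_D4 of_real_diff of_real_1 of_real_minus using R by algebra
    show ?thesis
      by (rule main[of _ _ 1 0, OF m]; use ph sq[of 4] in \<open>simp add: inv sec_far_D4; (simp add: field_simps)?\<close>)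
  qed
qed

locale complex_tiling =
  fixes C :: "ctile set"
  assumes unit: "(s, p, u) \<in> C \<Longrightarrow> norm u = 1"
    and cover: "(\<Union>c\<in>C. region_c c) = UNIV"
    and disjoint: "c \<in> C \<Longrightarrow> c' \<in> C \<Longrightarrow> c \<noteq> c' \<Longrightarrow>
      interior (region_c c) \<inter> interior (region_c c') = {}"
    and edge_to_edge: "c \<in> C \<Longrightarrow> c' \<in> C \<Longrightarrow> c \<noteq> c' \<Longrightarrow> e \<in> edges_c c \<Longrightarrow> e' \<in> edges_c c' \<Longrightarrow>
      e = e' \<or> e \<inter> e' \<subseteq> corners_c c"
    and labels: "c \<in> C \<Longrightarrow> c' \<in> C \<Longrightarrow> (x, l) \<in> labels_c c \<Longrightarrow> (x, l') \<in> labels_c c' \<Longrightarrow> l = l'"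
    and locally_finite: "finite {c \<in> C. region_c c \<inter> cball x r \<noteq> {}}"
begin

definition halves :: "half set" where
  "halves = {(s, p, u, z) |s p u z. (s, p, u) \<in> C \<and> z \<in> wing_dirs}"

lemma in_halves: "(s, p, u, z) \<in> halves \<longleftrightarrow> (s, p, u) \<in> C \<and> z \<in> wing_dirs"
  by (simp add: halves_def)

lemma nz: "(s, p, u) \<in> C \<Longrightarrow> u \<noteq> 0"
  using unit by fastforce

lemma nz': "c \<in> C \<Longrightarrow> snd (snd c) \<noteq> 0"
  using nz by (cases c) auto

lemma core_disjoint:
  assumes "c \<in> C" "c' \<in> C" "c \<noteq> c'" "x \<in> core_c c"
  shows "x \<notin> region_c c'"
proof
  assume "x \<in> region_c c'"
  then have "x \<in> closure (interior (region_c c'))"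
    using region_closure[OF nz'[OF assms(2)]] by blast
  moreover have "x \<in> interior (region_c c)" using core_interior assms(4) by blast
  ultimately have "interior (region_c c) \<inter> interior (region_c c') \<noteq> {}"
    by (metis IntI emptyE open_Int_closure_eq_empty open_interior)
  then show False using disjoint assms by blast
qed

lemma shared_edge:
  assumes "c \<in> C" "c' \<in> C" "c \<noteq> c'" "x \<in> region_c c" "x \<in> region_c c'" "x \<notin> corners_c c"
  shows "\<exists>e. e \<in> edges_c c \<and> e \<in> edges_c c' \<and> x \<in> e"
proof -
  have "x \<notin> core_c c" "x \<notin> core_c c'" using core_disjoint assms by metis+
  then obtain e e' where "e \<in> edges_c c" "x \<in> e" "e' \<in> edges_c c'" "x \<in> e'"
    using region_cases[OF assms(4) nz'[OF assms(1)]] region_cases[OF assms(5) nz'[OF assms(2)]] by blast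
  then show ?thesis using edge_to_edge[OF assms(1-3), of e e'] assms(6) by blast
qed

lemma closed_Union_regions:
  assumes "D \<subseteq> C"
  shows "closed (\<Union>c\<in>D. region_c c)"
proof -
  have "\<exists>r>0. ball x r \<inter> (\<Union>c\<in>D. region_c c) = {}" if x: "x \<notin> (\<Union>c\<in>D. region_c c)" for x
  proof -
    define F where "F = {c \<in> D. region_c c \<inter> cball x 1 \<noteq> {}}"
    have "finite F" by (rule finite_subset[OF _ locally_finite[of x 1]]) (use assms in \<open>auto simp: F_def\<close>)
    then have "closed (\<Union>c\<in>F. region_c c)" using closed_region by (intro closed_UN) auto
    moreover have "x \<notin> (\<Union>c\<in>F. region_c c)" using x by (auto simp: F_def)
    ultimately obtain r where r: "r > 0" "ball x r \<subseteq> - (\<Union>c\<in>F. region_c c)"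
      by (meson ComplI open_Compl open_contains_ball)
    have "ball x (min r 1) \<inter> (\<Union>c\<in>D. region_c c) = {}"
    proof (rule ccontr)
      assume "ball x (min r 1) \<inter> (\<Union>c\<in>D. region_c c) \<noteq> {}"
      then obtain y c where "y \<in> ball x (min r 1)" "c \<in> D" "y \<in> region_c c" by blast
      then have "c \<in> F" "y \<in> ball x r" by (auto simp: F_def)
      with r(2) \<open>y \<in> region_c c\<close> show False by blast
    qed
    then show ?thesis using r(1) by (intro exI[of _ "min r 1"]) auto
  qed
  then have "open (- (\<Union>c\<in>D. region_c c))"
    unfolding open_contains_ball by (metis ComplD disjoint_eq_subset_Compl)
  then show ?thesis by (simp add: closed_open)
qed

lemma edge_other_tile:
  assumes c: "c \<in> C" and e: "e \<in> edges_c c" "x \<in> e"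
  shows "\<exists>c'\<in>C. c' \<noteq> c \<and> x \<in> region_c c'"
proof (rule ccontr)
  assume "\<not> ?thesis"
  then have "x \<in> - (\<Union>c'\<in>C - {c}. region_c c')" by auto
  moreover have "open (- (\<Union>c'\<in>C - {c}. region_c c'))"
    by (intro open_Compl closed_Union_regions) auto
  ultimately obtain r where r: "r > 0" "ball x r \<subseteq> - (\<Union>c'\<in>C - {c}. region_c c')"
    by (meson open_contains_ball)
  obtain y where "dist x y < r" "y \<notin> region_c c"
    using edge_limit[OF e(1) nz'[OF c] e(2) r(1)] by blast
  moreover have "y \<in> (\<Union>c\<in>C. region_c c)" using cover by simp
  ultimately obtain c' where "c' \<in> C - {c}" "y \<in> region_c c'" by blast
  moreover have "y \<in> ball x r" using \<open>dist x y < r\<close> by simp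
  ultimately show False using r(2) by blast
qed

lemma midpoint_not_corner:
  assumes c: "c \<in> C" and e: "e \<in> edges_c c"
  shows "\<exists>x\<in>e. x \<notin> corners_c c"
proof -
  obtain s p u where cs: "c = (s, p, u)" by (cases c)
  have u: "u \<noteq> 0" using c nz cs by blast
  obtain z where z: "z \<in> wing_dirs" "e = long_edge (s, p, u, z) \<or> e = short_edge (s, p, u, z)"
    using e by (auto simp: cs edges_c_def)
  have ph: "phi > 0" using phi_bounds by simp
  note a = axis_len_pos[of s]
  define K where "K x = (coef_a ((x - p) / u), coef_b ((x - p) / u))" for x
  have corners: "K x \<in> {(0, 0), (0, phi), (axis_len s, 0)}" if "x \<in> corners_c c" for x
  proof -
    obtain y where y: "y \<in> wing_dirs" "x \<in> {tip (s, p, u, y), wing (s, p, u, y), far (s, p, u, y)}"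
      using \<open>x \<in> corners_c c\<close> unfolding corners_c_def cs half_of.simps by blast
    show ?thesis
      using y(2) coefs[OF y(1), of 0 0] coefs[OF y(1), of phi 0] coefs[OF y(1), of 0 "axis_len s"] ph
        corner_coords[OF u, of s p y]
      by (elim insertE emptyE) (simp_all only: K_def, simp_all)
  qed
  have K: "K (p + (of_real \<alpha> + of_real \<beta> * z) * u) = (\<alpha>, \<beta>)" if "\<beta> \<ge> 0" for \<alpha> \<beta>
    using coefs[OF z(1) that] u by (simp add: K_def)
  have mid: "midpoint a b \<in> closed_segment a b" for a b :: complex by simp
  have mp: "midpoint a b = (a + b) / 2" for a b :: complex
    by (simp add: midpoint_def scaleR_conv_of_real)
  consider "e = long_edge (s, p, u, z)" | "e = short_edge (s, p, u, z)" using z(2) by blast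
  then show ?thesis
  proof cases
    case 1
    let ?x = "midpoint (tip (s, p, u, z)) (wing (s, p, u, z))"
    have "?x = p + (of_real 0 + of_real (phi / 2) * z) * u" by (simp add: mp field_simps)
    then have "K ?x = (0, phi / 2)" using K[of "phi / 2" 0] ph by simp
    then have "?x \<notin> corners_c c" using corners[of ?x] ph a by auto
    moreover have "?x \<in> e" unfolding 1 long_edge_def by (rule mid)
    ultimately show ?thesis by blast
  next
    case 2
    let ?x = "midpoint (wing (s, p, u, z)) (far (s, p, u, z))"
    have "?x = p + (of_real (axis_len s / 2) + of_real (phi / 2) * z) * u" by (simp add: mp far_eq field_simps)
    then have "K ?x = (axis_len s / 2, phi / 2)" using K[of "phi / 2" "axis_len s / 2"] ph by simp
    then have "?x \<notin> corners_c c" using corners[of ?x] ph a by auto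
    moreover have "?x \<in> e" unfolding 2 short_edge_def by (rule mid)
    ultimately show ?thesis by blast
  qed
qed

lemma edge_shared:
  assumes c: "c \<in> C" and e: "e \<in> edges_c c"
  shows "\<exists>c'\<in>C. c' \<noteq> c \<and> e \<in> edges_c c'"
proof -
  obtain x where x: "x \<in> e" "x \<notin> corners_c c" using midpoint_not_corner[OF assms] by blast
  obtain c' where c': "c' \<in> C" "c' \<noteq> c" "x \<in> region_c c'" using edge_other_tile[OF assms x(1)] by blast
  have "x \<notin> core_c c'"
    using core_disjoint[OF c'(1) c c'(2)] edge_subset[OF e nz'[OF c]] x(1) by blast
  then obtain e' where e': "e' \<in> edges_c c'" "x \<in> e'" using region_cases[OF c'(3) nz'[OF c'(1)]] by blast
  have "e = e'" using edge_to_edge[OF c c'(1) c'(2)[symmetric] e e'(1)] x e'(2) by blast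
  then show ?thesis using c' e' by blast
qed

lemma packed_halves:
  assumes "h \<in> halves" "k \<in> halves" "sector h x m" "sector k x m"
  shows "h = k"
proof -
  obtain s p u z where h: "h = (s, p, u, z)" by (cases h)
  obtain s' p' u' z' where k: "k = (s', p', u', z')" by (cases k)
  have H: "(s, p, u) \<in> C" "z \<in> wing_dirs" "(s', p', u') \<in> C" "z' \<in> wing_dirs"
    using assms(1,2) by (auto simp: h k in_halves)
  define y where "y = x + of_real (1 / 10) * m"
  obtain \<alpha> \<beta> where ab: "0 < \<alpha>" "0 < \<beta>" "\<alpha> / axis_len s + \<beta> / phi < 1" "(y - p) / u = of_real \<alpha> + of_real \<beta> * z"
    using sector_core[OF assms(3)[unfolded h] H(2) nz[OF H(1)]] unfolding y_def by blast
  obtain \<alpha>' \<beta>' where ab': "0 < \<alpha>'" "0 < \<beta>'" "\<alpha>' / axis_len s' + \<beta>' / phi < 1" "(y - p') / u' = of_real \<alpha>' + of_real \<beta>' * z'"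
    using sector_core[OF assms(4)[unfolded k] H(4) nz[OF H(3)]] unfolding y_def by blast
  have y1: "y \<in> core_c (s, p, u)" using ab coefs[OF H(2), of \<beta> \<alpha>] by simp
  have y2: "y \<in> core_c (s', p', u')" using ab' coefs[OF H(4), of \<beta>' \<alpha>'] by simp
  have eq: "(s, p, u) = (s', p', u')"
    using core_disjoint[OF H(1,3) _ y1] core_subset y2 by blast
  have "of_real \<alpha> + of_real \<beta> * z = of_real \<alpha>' + of_real \<beta>' * z'"
    using ab(4) ab'(4) eq by simp
  then have "\<beta> * Im z = \<beta>' * Im z'"
    by (drule_tac arg_cong[of _ _ Im]) simp
  then have "Im z > 0 \<longleftrightarrow> Im z' > 0" using ab(2) ab'(2) by (metis mult_pos_pos zero_less_mult_pos)
  moreover have "Im \<zeta> > 0" using sin_pos by (simp add: zeta_eq)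
  ultimately have "z = z'" using H(2,4) by (auto simp: wing_dirs_def)
  then show ?thesis using eq h k by simp
qed

lemma packed_halvesD:
  assumes "h \<in> halves" "k \<in> halves" "sector h x m" "sector k x' m'" "x = x'" "m = m'"
  shows "h = k"
  using assms packed_halves by blast

lemma far_wing:
  assumes z: "z \<in> wing_dirs"
  shows "far (Kite, p, u, z) = wing (Kite, p, u, z) - z ^ 3 * u"
    "far (Dart, p, u, z) = wing (Dart, p, u, z) - z\<^sup>2 * u"
  unfolding far.simps wing.simps using wing_dirs_rel(1,2)[OF z] Phi_square by algebra+

lemma edge_lengths_c:
  assumes "(s, p, u) \<in> C" "z \<in> wing_dirs"
  shows "dist (tip (s, p, u, z)) (wing (s, p, u, z)) = phi"
    "dist (wing (s, p, u, z)) (far (s, p, u, z)) = 1"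
proof -
  show "dist (tip (s, p, u, z)) (wing (s, p, u, z)) = phi"
    using unit[OF assms(1)] norm_dirs[OF assms(2)] phi_bounds by (simp add: dist_norm norm_mult)
  show "dist (wing (s, p, u, z)) (far (s, p, u, z)) = 1"
    using unit[OF assms(1)] norm_dirs[OF assms(2)]
    by (cases s) (simp_all only: far_wing[OF assms(2)], simp_all add: dist_norm norm_mult norm_power)
qed

lemma labels_mem:
  assumes "z \<in> wing_dirs"
  shows "(tip (s, p, u, z), corner_label s Tip) \<in> labels_c (s, p, u)"
    "(wing (s, p, u, z), corner_label s Wing1) \<in> labels_c (s, p, u)"
    "(far (s, p, u, z), corner_label s Far) \<in> labels_c (s, p, u)"
  using assms by (auto simp: labels_c_def)

lemma long_match:
  assumes c: "(s, p, u) \<in> C" "(s', p', u') \<in> C" "(s, p, u) \<noteq> (s', p', u')"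
    and z: "z \<in> wing_dirs" "z' \<in> wing_dirs"
    and e: "long_edge (s, p, u, z) = long_edge (s', p', u', z')"
  shows "long_nb (s, p, u, z) (s', p', u', z')"
proof -
  note R = wing_dirs_rel[OF z(1)] Phi_square
  note lab = labels[OF c(1,2)]
  note L = labels_mem[OF z(1), of s p u] and L' = labels_mem[OF z(2), of s' p' u']
  have z': "z' = z \<or> z' = cnj z" using z by (auto simp: wing_dirs_def)
  have "{p, p + \<Phi> * z * u} = {p', p' + \<Phi> * z' * u'}"
    using e unfolding long_edge_def closed_segment_eq tip.simps wing.simps .
  then consider (same) "p' = p" "p' + \<Phi> * z' * u' = p + \<Phi> * z * u"
    | (swap) "p' = p + \<Phi> * z * u" "p' + \<Phi> * z' * u' = p"
    unfolding doubleton_eq_iff by metis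
  then show ?thesis
  proof cases
    case same
    have s: "s' = s" using lab[OF L(1)] L'(1) same(1) by (cases s; cases s') auto
    have eq: "z' * u' = z * u" using same by simp
    have "z' \<noteq> z" using eq same(1) s c(3) R(4) by auto
    then have z': "z' = cnj z" using z' by blast
    have "u' = z\<^sup>2 * u" using eq[unfolded z'] R(1) by algebra
    then show ?thesis using same(1) s z' long_same by simp
  next
    case swap
    have s: "s' = other s" using lab[OF L(1), of "corner_label s' Wing1"] L'(2) swap(2) by (cases s; cases s') auto
    have "\<Phi> * (z' * u' + z * u) = 0" using swap by (simp add: algebra_simps)
    then have eq: "z' * u' = - (z * u)" by (simp add: add_eq_0_iff2)
    have "z' \<noteq> cnj z"
    proof
      assume z': "z' = cnj z"
      have u': "u' = - (z\<^sup>2 * u)" using eq[unfolded z'] R(1) by algebra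
      have m: "(1 + z) * u = - (z' * (1 + z') * u')" unfolding u' z' using R(1) by algebra
      have "(s, p, u, z) = (s', p', u', z')"
        by (rule packed_halvesD[OF _ _ sec_tip sec_wing swap(2)[symmetric] m])
          (use c z in \<open>simp_all add: in_halves\<close>)
      then show False using c(3) by simp
    qed
    then have z': "z' = z" using z' by blast
    have "z * (u' + u) = 0" using eq[unfolded z'] by (simp add: algebra_simps)
    then have "u' = - u" using R(4) by (simp add: add_eq_0_iff2)
    then show ?thesis using swap(1) s z' long_swap by simp
  qed
qed

lemma diff_cancel: "w' = w \<Longrightarrow> w' - a = w - b \<Longrightarrow> a = (b :: complex)"
  by simp

lemma diff_swap: "w' = w - b \<Longrightarrow> w' - a = w \<Longrightarrow> a = - (b :: complex)"
  by algebra

lemma short_match: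
  assumes c: "(s, p, u) \<in> C" "(s', p', u') \<in> C" "(s, p, u) \<noteq> (s', p', u')"
    and z: "z \<in> wing_dirs" "z' \<in> wing_dirs"
    and e: "short_edge (s, p, u, z) = short_edge (s', p', u', z')"
  shows "short_nb (s, p, u, z) (s', p', u', z')"
proof -
  note R = wing_dirs_rel[OF z(1)] Phi_square
  note lab = labels[OF c(1,2)]
  note L = labels_mem[OF z(1), of s p u] and L' = labels_mem[OF z(2), of s' p' u']
  have z': "z' = z \<or> z' = cnj z" using z by (auto simp: wing_dirs_def)
  have H: "(s, p, u, y) \<in> halves" "(s', p', u', y) \<in> halves" if "y \<in> wing_dirs" for y
    using c that by (simp_all add: in_halves)
  note zc = wing_dirs_cnj[OF z(1)]
  have no: False if "x \<in> wing_dirs" "y \<in> wing_dirs" "(s, p, u, x) = (s', p', u', y)" for x y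
    using that c(3) by simp
  have "{wing (s, p, u, z), far (s, p, u, z)} = {wing (s', p', u', z'), far (s', p', u', z')}"
    using e unfolding short_edge_def closed_segment_eq .
  then consider (same) "wing (s', p', u', z') = wing (s, p, u, z)" "far (s', p', u', z') = far (s, p, u, z)"
    | (swap) "wing (s', p', u', z') = far (s, p, u, z)" "far (s', p', u', z') = wing (s, p, u, z)"
    unfolding doubleton_eq_iff by metis
  then show ?thesis
  proof cases
    case same
    have s: "s' = s" using lab[OF L(2)] L'(2) same(1) by (cases s; cases s') auto
    have diff: "z' \<noteq> z"
    proof
      assume zz: "z' = z"
      have "u' = u"
      proof (cases s)
        case Kite
        have "z ^ 3 * u' = z ^ 3 * u"
          by (rule diff_cancel[OF same[unfolded s zz Kite far_wing[OF z(1)]]])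
        then show ?thesis using R(4) by simp
      next
        case Dart
        have "z\<^sup>2 * u' = z\<^sup>2 * u"
          by (rule diff_cancel[OF same[unfolded s zz Dart far_wing[OF z(1)]]])
        then show ?thesis using R(4) by simp
      qed
      then show False using same(1) c(3) s zz by simp
    qed
    then have zz: "z' = cnj z" using z' by blast
    show ?thesis
    proof (cases s)
      case Kite
      have "(cnj z) ^ 3 * u' = z ^ 3 * u"
        by (rule diff_cancel[OF same[unfolded s zz Kite far_wing[OF z(1)] far_wing[OF zc]]])
      then have u': "u' = - (z * u)" using R(1,2,5) by algebra
      have "p' + \<Phi> * u' = p + \<Phi> * u" using same(2) unfolding s Kite far.simps .
      then have "p' = p + \<Phi> * (1 + z) * u" unfolding u' by algebra
      then show ?thesis unfolding s Kite zz u' by (simp add: short_KKI)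
    next
      case Dart
      have "(cnj z)\<^sup>2 * u' = z\<^sup>2 * u"
        by (rule diff_cancel[OF same[unfolded s zz Dart far_wing[OF z(1)] far_wing[OF zc]]])
      then have u': "u' = z ^ 4 * u" using R(1,2,5) by algebra
      have f: "p + u = p' + u'" using same(2) unfolding s Dart far.simps by simp
      have "(s, p, u, cnj z) = (s', p', u', z)"
        unfolding s Dart
        by (rule packed_halvesD[OF H(1)[OF zc, unfolded Dart] H(2)[OF z(1), unfolded s Dart] sec_far_D2 sec_far_D3 f])
          (unfold u', use R(1,2,5) in algebra)
      then show ?thesis using no[OF zc z(1)] by blast
    qed
  next
    case swap
    have s: "s' = other s" using lab[OF L(2), of "corner_label s' Far"] L'(3) swap(2) by (cases s; cases s') auto
    show ?thesis
    proof (cases s)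
      case Kite
      have s': "s' = Dart" using s Kite by simp
      have w: "p' + \<Phi> * z' * u' = p + \<Phi> * u" using swap(1) unfolding s' Kite far.simps wing.simps .
      have f: "p' + u' = p + \<Phi> * z * u" using swap(2) unfolding s' Kite far.simps wing.simps .
      have eq: "z'\<^sup>2 * u' = - (z ^ 3 * u)"
        by (rule diff_swap[OF swap[unfolded s' Kite far_wing[OF z(1)] far_wing[OF z(2)]]])
      have "z' \<noteq> cnj z"
      proof
        assume zz: "z' = cnj z"
        have u': "u' = u" using eq[unfolded zz] R(1,2,5) by algebra
        have m: "z ^ 3 * (1 + z) * u = - (z' * (1 + z') * u')" unfolding u' zz using R(1,2,5) by algebra
        have "(s, p, u, z) = (s', p', u', z')"
          unfolding s' Kite
          by (rule packed_halvesD[OF H(1)[OF z(1), unfolded Kite] H(2)[OF z(2), unfolded s'] sec_far_K3 sec_wing w[symmetric] m])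
        then show False using s' Kite by simp
      qed
      then have zz: "z' = z" using z' by blast
      have u': "u' = - (z * u)" using eq[unfolded zz] R(1,2,5) by algebra
      have "p' = p + \<Phi>\<^sup>2 * z * u" using f unfolding u' using R(1,2,5) by algebra
      then show ?thesis unfolding s' Kite zz u' by (simp add: short_KDI)
    next
      case Dart
      have s': "s' = Kite" using s Dart by simp
      have w: "p' + \<Phi> * z' * u' = p + u" using swap(1) unfolding s' Dart far.simps wing.simps .
      have f: "p' + \<Phi> * u' = p + \<Phi> * z * u" using swap(2) unfolding s' Dart far.simps wing.simps .
      have eq: "z' ^ 3 * u' = - (z\<^sup>2 * u)"
        by (rule diff_swap[OF swap[unfolded s' Dart far_wing[OF z(1)] far_wing[OF z(2)]]])
      have "z' \<noteq> cnj z"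
      proof
        assume zz: "z' = cnj z"
        have u': "u' = u" using eq[unfolded zz] R(1,2,5) by algebra
        have m: "- (z * (1 + z) * u) = z' ^ 3 * (1 + z') * u'" unfolding u' zz using R(1,2,5) by algebra
        have "(s, p, u, z) = (s', p', u', z')"
          unfolding s' Dart
          by (rule packed_halvesD[OF H(1)[OF z(1), unfolded Dart] H(2)[OF z(2), unfolded s'] sec_wing sec_far_K3 f[symmetric] m])
        then show False using s' Dart by simp
      qed
      then have zz: "z' = z" using z' by blast
      have u': "u' = - (cnj z * u)" using eq[unfolded zz] R(1,2,5) by algebra
      have "p' = p + \<Phi>\<^sup>2 * u" using w unfolding u' zz using R(1,2,5) by algebra
      then show ?thesis unfolding s' Dart zz u' by (simp add: short_DKI)
    qed
  qed
qed

lemma long_short_distinct: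
  assumes "(s, p, u) \<in> C" "(s', p', u') \<in> C" "z \<in> wing_dirs" "z' \<in> wing_dirs"
  shows "long_edge (s, p, u, z) \<noteq> short_edge (s', p', u', z')"
proof
  assume "long_edge (s, p, u, z) = short_edge (s', p', u', z')"
  then have "{tip (s, p, u, z), wing (s, p, u, z)} = {wing (s', p', u', z'), far (s', p', u', z')}"
    unfolding long_edge_def short_edge_def closed_segment_eq .
  then have "dist (tip (s, p, u, z)) (wing (s, p, u, z)) = dist (wing (s', p', u', z')) (far (s', p', u', z'))"
    unfolding doubleton_eq_iff by (metis dist_commute)
  then show False
    using edge_lengths_c(1)[OF assms(1,3)] edge_lengths_c(2)[OF assms(2,4)] phi_bounds by simp
qed

lemma half_tiling_halves: "half_tiling halves"
proof
  fix s p u z assume h: "(s, p, u, z) \<in> halves"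
  then show "z \<in> wing_dirs" "u \<noteq> 0" "(s, p, u, cnj z) \<in> halves"
    using nz wing_dirs_cnj by (auto simp: in_halves)
next
  fix h assume "h \<in> halves"
  then obtain s p u z where h: "h = (s, p, u, z)" "(s, p, u) \<in> C" "z \<in> wing_dirs"
    by (auto simp: halves_def)
  have e: "long_edge h \<in> edges_c (s, p, u)" "short_edge h \<in> edges_c (s, p, u)"
    using h by (auto simp: edges_c_def)
  obtain s' p' u' where c': "(s', p', u') \<in> C" "(s', p', u') \<noteq> (s, p, u)" "long_edge h \<in> edges_c (s', p', u')"
    using edge_shared[OF h(2) e(1)] by auto
  from c'(3) obtain z' where "z' \<in> wing_dirs" "long_edge h = long_edge (s', p', u', z')"
    using long_short_distinct[OF h(2) c'(1) h(3)] unfolding h(1) edges_c_def half_of.simps by blast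
  with long_match[OF h(2) c'(1) _ h(3)] c' show "\<exists>k\<in>halves. long_nb h k"
    unfolding h(1) by (metis in_halves)
  obtain s' p' u' where c': "(s', p', u') \<in> C" "(s', p', u') \<noteq> (s, p, u)" "short_edge h \<in> edges_c (s', p', u')"
    using edge_shared[OF h(2) e(2)] by auto
  from c'(3) obtain z' where "z' \<in> wing_dirs" "short_edge h = short_edge (s', p', u', z')"
    using long_short_distinct[OF c'(1) h(2) _ h(3)] unfolding h(1) edges_c_def half_of.simps by blast
  with short_match[OF h(2) c'(1) _ h(3)] c' show "\<exists>k\<in>halves. short_nb h k"
    unfolding h(1) by (metis in_halves)
qed (rule packed_halves)

lemma shared_edge_adj:
  assumes "(s, p, u) \<in> C" "(s', p', u') \<in> C" "(s, p, u) \<noteq> (s', p', u')"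
    "e \<in> edges_c (s, p, u)" "e \<in> edges_c (s', p', u')"
  shows "\<exists>z\<in>wing_dirs. \<exists>z'\<in>wing_dirs. half_adj (s, p, u, z) (s', p', u', z')"
proof -
  have nb: ?thesis if "z \<in> wing_dirs" "z' \<in> wing_dirs"
    "long_nb (s, p, u, z) (s', p', u', z') \<or> short_nb (s, p, u, z) (s', p', u', z')" for z z'
    using that unfolding half_adj_def by blast
  obtain z where z: "z \<in> wing_dirs" "e = long_edge (s, p, u, z) \<or> e = short_edge (s, p, u, z)"
    using assms(4) unfolding edges_c_def half_of.simps by blast
  obtain z' where z': "z' \<in> wing_dirs" "e = long_edge (s', p', u', z') \<or> e = short_edge (s', p', u', z')"
    using assms(5) unfolding edges_c_def half_of.simps by blast
  from z(2) z'(2) show ?thesis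
    using nb[OF z(1) z'(1)] long_match[OF assms(1-3) z(1) z'(1)] short_match[OF assms(1-3) z(1) z'(1)]
      long_short_distinct[OF assms(1,2) z(1) z'(1)] long_short_distinct[OF assms(2,1) z'(1) z(1)]
    by (elim disjE) simp_all
qed

lemma countable_C: "countable C"
proof -
  have "C \<subseteq> (\<Union>n::nat. {c \<in> C. region_c c \<inter> cball 0 (real n) \<noteq> {}})"
  proof
    fix c assume c: "c \<in> C"
    obtain s p u where cs: "c = (s, p, u)" by (cases c)
    have "p \<in> corners_c c" by (auto simp: corners_c_def cs wing_dirs_def)
    then have "p \<in> region_c c" using corners_subset[OF nz'[OF c]] by blast
    moreover obtain n :: nat where "norm p \<le> real n" using real_arch_simple by blast
    ultimately have "p \<in> region_c c \<inter> cball 0 (real n)" by simp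
    with c show "c \<in> (\<Union>n::nat. {c \<in> C. region_c c \<inter> cball 0 (real n) \<noteq> {}})" by blast
  qed
  moreover have "countable (\<Union>n::nat. {c \<in> C. region_c c \<inter> cball 0 (real n) \<noteq> {}})"
    by (intro countable_UN countable_finite[OF locally_finite]) simp
  ultimately show ?thesis by (rule countable_subset)
qed

lemma core_nonempty:
  assumes "c \<in> C"
  shows "core_c c \<noteq> {}"
proof -
  obtain s p u where cs: "c = (s, p, u)" by (cases c)
  have u: "u \<noteq> 0" using assms nz cs by blast
  have "p + (of_real (axis_len s / 2) + of_real 0 * \<zeta>) * u \<in> core_c c"
    using coefs[OF zeta_in(1), of 0 "axis_len s / 2"] u axis_len_pos[of s] by (simp add: cs)
  then show ?thesis by blast
qed

theorem connected_halves:
  assumes h: "h \<in> halves" and k: "k \<in> halves"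
  shows "\<exists>n. walk halves n h k"
proof -
  interpret half_tiling halves by (rule half_tiling_halves)
  define D where "D = {c \<in> C. \<exists>z\<in>wing_dirs. \<exists>n. walk halves n h (half_of c z)}"
  have any: "\<exists>n. walk halves n h (half_of c z')" if "c \<in> D" "z' \<in> wing_dirs" for c z'
  proof -
    obtain s p u where cs: "c = (s, p, u)" by (cases c)
    obtain z n where w: "z \<in> wing_dirs" "walk halves n h (s, p, u, z)" using \<open>c \<in> D\<close> by (auto simp: D_def cs)
    have "walk halves (Suc n) h (s, p, u, cnj z)"
      by (rule walk_Suc[OF w(2)]) (use twin walk_mem[OF w(2)] in \<open>auto simp: half_adj_def\<close>)
    then show ?thesis using w that(2) by (auto simp: cs wing_dirs_def)
  qed
  obtain s p u z where hs: "h = (s, p, u, z)" "(s, p, u) \<in> C" "z \<in> wing_dirs"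
    using h by (auto simp: halves_def)
  have c0: "(s, p, u) \<in> D" using hs h walk_0[OF h] by (auto simp: D_def)
  have "D = C"
  proof (rule ccontr)
    assume "D \<noteq> C"
    moreover have "D \<subseteq> C" by (auto simp: D_def)
    ultimately obtain c1 where c1: "c1 \<in> C - D" by blast
    define V where "V = (\<Union>c\<in>C. corners_c c)"
    have "countable V" unfolding V_def corners_c_def wing_dirs_def
      using countable_C by (intro countable_UN) auto
    then have conn: "connected (- V)"
      by (intro path_connected_imp_connected path_connected_complement_countable) simp_all
    have ne: "region_c c \<inter> - V \<noteq> {}" if c: "c \<in> C" for c
    proof
      assume "region_c c \<inter> - V = {}"
      then have "core_c c \<subseteq> V" using core_subset[of c] by blast
      moreover obtain x where x: "x \<in> core_c c" using core_nonempty[OF c] by blast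
      moreover obtain r where "r > 0" "ball x r \<subseteq> core_c c" using open_core[of c] x open_contains_ball by blast
      ultimately have "countable (ball x r)" using \<open>countable V\<close> countable_subset by (meson order_trans)
      then show False using uncountable_ball[OF \<open>r > 0\<close>] by blast
    qed
    have sub: "D \<subseteq> C" "C - D \<subseteq> C" by (auto simp: D_def)
    let ?A = "\<Union>c\<in>D. region_c c" and ?B = "\<Union>c\<in>C - D. region_c c"
    have 1: "?A \<inter> ?B \<inter> - V = {}"
    proof (rule ccontr)
      assume "?A \<inter> ?B \<inter> - V \<noteq> {}"
      then obtain x c c' where x: "c \<in> D" "x \<in> region_c c" "c' \<in> C - D" "x \<in> region_c c'" "x \<notin> V" by blast
      have cc: "c \<in> C" "c' \<in> C" "c \<noteq> c'" using x sub by blast+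
      have "x \<notin> corners_c c" using x(5) cc(1) by (auto simp: V_def)
      then obtain e where "e \<in> edges_c c" "e \<in> edges_c c'" using shared_edge[OF cc x(2,4)] by blast
      moreover obtain s p u where cs: "c = (s, p, u)" by (cases c)
      moreover obtain s' p' u' where cs': "c' = (s', p', u')" by (cases c')
      ultimately obtain z z' where z: "z \<in> wing_dirs" "z' \<in> wing_dirs" "half_adj (s, p, u, z) (s', p', u', z')"
        using shared_edge_adj[of s p u s' p' u' e] cc by blast
      obtain n where "walk halves n h (s, p, u, z)" using any[OF x(1) z(1)] cs by auto
      then have "walk halves (Suc n) h (s', p', u', z')"
        by (rule walk_Suc) (use z cc cs' in \<open>auto simp: in_halves\<close>)
      then have "c' \<in> D" using cc(2) z(2) by (auto simp: D_def cs')
      with x(3) show False by blast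
    qed
    have 2: "- V \<subseteq> ?A \<union> ?B" using cover by blast
    have 3: "?A \<inter> - V \<noteq> {}" using ne[OF hs(2)] c0 by blast
    have 4: "?B \<inter> - V \<noteq> {}"
    proof -
      have "c1 \<in> C" using c1 by blast
      from ne[OF this] show ?thesis using c1 by blast
    qed
    note closed_Union_regions[OF sub(1)] closed_Union_regions[OF sub(2)] 2 1 3 4
    then have "\<exists>A B. closed A \<and> closed B \<and> - V \<subseteq> A \<union> B \<and> A \<inter> B \<inter> - V = {} \<and> A \<inter> - V \<noteq> {} \<and> B \<inter> - V \<noteq> {}"
      by (intro exI[of _ ?A] exI[of _ ?B] conjI)
    with conn show False unfolding connected_closed by (rule notE)
  qed
  obtain s' p' u' z' where ks: "k = (s', p', u', z')" "(s', p', u') \<in> C" "z' \<in> wing_dirs"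
    using k by (auto simp: halves_def)
  then show ?thesis using any[of "(s', p', u')" z'] \<open>D = C\<close> by auto
qed

end

section \<open>Tiles in complex coordinates\<close>

definition cx :: "real ^ 2 \<Rightarrow> complex" where
  "cx v = Complex (v $ 1) (v $ 2)"

definition unit_region :: "shape \<Rightarrow> complex set" where
  "unit_region s = {w. 0 \<le> coef_a w \<and> coef_a w / axis_len s + coef_b w / phi \<le> 1}"

lemma linear_cx: "linear cx"
  by (rule linearI) (simp_all add: cx_def complex_eq_iff)

lemma bij_cx: "bij cx"
proof (rule bijI)
  show "inj cx" by (rule injI) (simp add: cx_def vec_eq_iff forall_2)
  show "surj cx"
  proof (rule surjI)
    show "cx (vector [Re w, Im w]) = w" for w by (simp add: cx_def complex_eq_iff)
  qed
qed

lemma dist_cx: "dist (cx v) (cx w) = dist v w"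
  by (simp add: dist_norm norm_2 cx_def cmod_def)

lemma cx_corners:
  "cx (corner_pos s Tip) = 0" "cx (corner_pos s Wing1) = \<Phi> * \<zeta>"
  "cx (corner_pos s Wing2) = \<Phi> * cnj \<zeta>" "cx (corner_pos s Far) = of_real (axis_len s)"
  by (cases s; simp add: cx_def complex_eq_iff zeta_def)+

lemma coefs_side:
  assumes "z \<in> wing_dirs" "Im w * Im z \<ge> 0"
  shows "w = of_real (coef_a w) + of_real (coef_b w) * z"
proof -
  have "z = \<zeta> \<or> z = cnj \<zeta>" using assms(1) by (simp add: wing_dirs_def)
  then show ?thesis
  proof
    assume z: "z = \<zeta>"
    have "Im w \<ge> 0" using assms(2) sin_pos by (simp add: z zeta_eq zero_le_mult_iff)
    then show ?thesis using sin_pos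
      unfolding z by (simp_all add: complex_eq_iff coef_a_def coef_b_def zeta_eq)
  next
    assume z: "z = cnj \<zeta>"
    have "Im w \<le> 0" using assms(2) sin_pos by (simp add: z zeta_eq mult_le_0_iff)
    then show ?thesis using sin_pos
      unfolding z by (simp_all add: complex_eq_iff coef_a_def coef_b_def zeta_eq)
  qed
qed

lemma half_hull:
  assumes z: "z \<in> wing_dirs"
  shows "convex hull {0, \<Phi> * z, of_real (axis_len s)} = {w \<in> unit_region s. Im w * Im z \<ge> 0}"
proof -
  have ph: "phi > 0" using phi_bounds by simp
  note a = axis_len_pos[of s]
  show ?thesis
  proof (intro equalityI subsetI)
    fix w assume "w \<in> convex hull {0, \<Phi> * z, of_real (axis_len s)}"
    then obtain x y t where t: "0 \<le> x" "0 \<le> y" "0 \<le> t" "x + y + t = 1"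
      "w = x *\<^sub>R 0 + y *\<^sub>R (\<Phi> * z) + t *\<^sub>R of_real (axis_len s)"
      unfolding convex_hull_3 by blast
    have w: "w = of_real (t * axis_len s) + of_real (y * phi) * z"
      unfolding t(5) by (simp add: scaleR_conv_of_real)
    have "Im w * Im z = y * phi * (Im z)\<^sup>2" unfolding w by (simp add: power2_eq_square)
    then have i: "Im w * Im z \<ge> 0" using t(2) ph by simp
    have "coef_b w = y * phi" "coef_a w = t * axis_len s"
      unfolding w using coefs[OF z, of "y * phi" "t * axis_len s"] t ph by simp_all
    with i show "w \<in> {w \<in> unit_region s. Im w * Im z \<ge> 0}"
      using t ph a by (simp add: unit_region_def)
  next
    fix w assume w: "w \<in> {w \<in> unit_region s. Im w * Im z \<ge> 0}"
    then have r: "0 \<le> coef_a w" "coef_a w / axis_len s + coef_b w / phi \<le> 1" "Im w * Im z \<ge> 0"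
      by (auto simp: unit_region_def)
    define y t where "y = coef_b w / phi" and "t = coef_a w / axis_len s"
    have "(1 - y - t) *\<^sub>R 0 + y *\<^sub>R (\<Phi> * z) + t *\<^sub>R of_real (axis_len s) =
        of_real (coef_a w) + of_real (coef_b w) * z"
      using ph a by (simp add: y_def t_def scaleR_conv_of_real)
    then have "w = (1 - y - t) *\<^sub>R 0 + y *\<^sub>R (\<Phi> * z) + t *\<^sub>R of_real (axis_len s)"
      using coefs_side[OF z r(3)] by simp
    moreover have "0 \<le> y" "0 \<le> t" "0 \<le> 1 - y - t" "(1 - y - t) + y + t = 1"
      using r ph a coef_b_nonneg[of w] by (simp_all add: y_def t_def)
    ultimately show "w \<in> convex hull {0, \<Phi> * z, of_real (axis_len s)}"
      unfolding convex_hull_3 by blast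
  qed
qed

lemma half_hull_cx:
  "cx ` (convex hull {corner_pos s Tip, corner_pos s Wing1, corner_pos s Far}) = {w \<in> unit_region s. Im w \<ge> 0}"
  "cx ` (convex hull {corner_pos s Tip, corner_pos s Wing2, corner_pos s Far}) = {w \<in> unit_region s. Im w \<le> 0}"
proof -
  have i: "Im \<zeta> > 0" using sin_pos by (simp add: zeta_eq)
  show "cx ` (convex hull {corner_pos s Tip, corner_pos s Wing1, corner_pos s Far}) = {w \<in> unit_region s. Im w \<ge> 0}"
    using half_hull[OF zeta_in(1), of s] i
    unfolding convex_hull_linear_image[OF linear_cx] image_insert image_empty cx_corners
    by (simp add: zero_le_mult_iff)
  show "cx ` (convex hull {corner_pos s Tip, corner_pos s Wing2, corner_pos s Far}) = {w \<in> unit_region s. Im w \<le> 0}"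
    using half_hull[OF zeta_in(2), of s] i
    unfolding convex_hull_linear_image[OF linear_cx] image_insert image_empty cx_corners
    by (simp add: zero_le_mult_iff mult_le_0_iff)
qed

lemma convex_unit_region_Kite: "convex (unit_region Kite)"
proof (rule convexI)
  fix x y :: complex and u v :: real
  assume xy: "x \<in> unit_region Kite" "y \<in> unit_region Kite" and uv: "0 \<le> u" "0 \<le> v" "u + v = 1"
  have ph: "phi > 0" "phi < 2" using phi_bounds by auto
  have mem: "w \<in> unit_region Kite \<longleftrightarrow>
      phi / 2 * coef_b w \<le> Re w \<and> Re w + (1 - phi / 2) * coef_b w \<le> phi" for w
    using ph by (auto simp: unit_region_def coef_a_def field_simps)
  define w where "w = u *\<^sub>R x + v *\<^sub>R y"
  have "\<bar>Im w\<bar> \<le> u * \<bar>Im x\<bar> + v * \<bar>Im y\<bar>"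
    using abs_triangle_ineq[of "u * Im x" "v * Im y"] uv by (simp add: w_def abs_mult)
  then have b: "coef_b w \<le> u * coef_b x + v * coef_b y"
    using sin_pos by (simp add: coef_b_def field_simps)
  have r: "Re w = u * Re x + v * Re y" by (simp add: w_def)
  have "phi / 2 * coef_b w \<le> u * (phi / 2 * coef_b x) + v * (phi / 2 * coef_b y)"
    using mult_left_mono[OF b, of "phi / 2"] ph by (simp add: algebra_simps)
  also have "\<dots> \<le> u * Re x + v * Re y"
    using xy uv unfolding mem by (intro add_mono mult_left_mono) auto
  finally have 1: "phi / 2 * coef_b w \<le> Re w" using r by simp
  have "(1 - phi / 2) * coef_b w \<le> (1 - phi / 2) * (u * coef_b x + v * coef_b y)"
    using mult_left_mono[OF b, of "1 - phi / 2"] ph by simp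
  then have "Re w + (1 - phi / 2) * coef_b w \<le>
      u * (Re x + (1 - phi / 2) * coef_b x) + v * (Re y + (1 - phi / 2) * coef_b y)"
    unfolding r by (simp add: algebra_simps)
  also have "\<dots> \<le> u * phi + v * phi"
    using xy uv unfolding mem by (intro add_mono mult_left_mono) auto
  also have "\<dots> = phi" using uv(3) by (metis distrib_right mult_1)
  finally have "Re w + (1 - phi / 2) * coef_b w \<le> phi" .
  with 1 show "u *\<^sub>R x + v *\<^sub>R y \<in> unit_region Kite" unfolding mem w_def by blast
qed

lemma prototile_Un: "prototile s =
    convex hull {corner_pos s Tip, corner_pos s Wing1, corner_pos s Far} \<union>
    convex hull {corner_pos s Tip, corner_pos s Wing2, corner_pos s Far}" (is "_ = ?A s \<union> ?B s")
proof (cases s)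
  case Kite
  have all: "range (corner_pos s) = {corner_pos s Tip, corner_pos s Wing1, corner_pos s Wing2, corner_pos s Far}"
  proof -
    have "(UNIV :: corner set) = {Tip, Wing1, Wing2, Far}"
    proof (rule UNIV_eq_I)
      show "x \<in> {Tip, Wing1, Wing2, Far}" for x by (cases x) simp_all
    qed
    from arg_cong[OF this, of "\<lambda>A. corner_pos s ` A"] show ?thesis
      unfolding image_insert image_empty .
  qed
  have AB: "cx ` (?A s \<union> ?B s) = unit_region s"
    unfolding image_Un half_hull_cx by auto
  have "cx ` (convex hull range (corner_pos s)) \<subseteq> unit_region s"
    unfolding convex_hull_linear_image[OF linear_cx]
  proof (rule hull_minimal)
    show "convex (unit_region s)" using convex_unit_region_Kite Kite by simp
    have "corner_pos s Tip \<in> ?A s" "corner_pos s Wing1 \<in> ?A s" "corner_pos s Far \<in> ?A s" "corner_pos s Wing2 \<in> ?B s"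
      by (simp_all add: hull_inc del: corner_pos.simps)
    then have "range (corner_pos s) \<subseteq> ?A s \<union> ?B s" unfolding all by blast
    then show "cx ` range (corner_pos s) \<subseteq> unit_region s" using AB by blast
  qed
  then have "convex hull range (corner_pos s) \<subseteq> ?A s \<union> ?B s"
    using AB bij_cx by (metis bij_is_inj inj_image_subset_iff)
  moreover have "?A s \<union> ?B s \<subseteq> convex hull range (corner_pos s)"
    by (intro Un_least hull_mono) (auto simp del: corner_pos.simps)
  ultimately have "convex hull range (corner_pos s) = ?A s \<union> ?B s" by (rule subset_antisym)
  then show ?thesis unfolding Kite prototile.simps .
qed simp

lemma cx_prototile: "cx ` prototile s = unit_region s"
  unfolding prototile_Un image_Un half_hull_cx by auto

lemma unit_region_cnj: "cnj w \<in> unit_region s \<longleftrightarrow> w \<in> unit_region s"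
  by (simp add: unit_region_def coef_a_def coef_b_def)

lemma complex_isometry:
  fixes h :: "complex \<Rightarrow> complex"
  assumes iso: "\<And>x y. dist (h x) (h y) = dist x y"
  shows "\<exists>p u. norm u = 1 \<and> ((\<forall>x. h x = p + u * x) \<or> (\<forall>x. h x = p + u * cnj x))"
proof -
  define p u where "p = h 0" and "u = h 1 - h 0"
  have u1: "norm u = 1" using iso[of 1 0] by (simp add: u_def dist_norm)
  then have u0: "u \<noteq> 0" by auto
  define k where "k x = (h x - p) / u" for x
  have h: "h x = p + u * k x" for x using u0 by (simp add: k_def)
  have kd: "norm (k x - k y) = norm (x - y)" for x y
  proof -
    have "k x - k y = (h x - h y) / u" by (simp add: k_def diff_divide_distrib)
    then show ?thesis using iso[of x y] u1 by (simp add: norm_divide dist_norm)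
  qed
  have k0: "k 0 = 0" and k1: "k 1 = 1" using u0 by (simp_all add: k_def p_def u_def)
  have kn: "norm (k x) = norm x" for x using kd[of x 0] k0 by simp
  have inner: "Re (k x * cnj (k y)) = Re (x * cnj y)" for x y
  proof -
    have e: "(norm (a - b))\<^sup>2 = (norm a)\<^sup>2 + (norm b)\<^sup>2 - 2 * Re (a * cnj b)" for a b :: complex
      by (simp only: cmod_power2) (simp add: power2_eq_square algebra_simps)
    show ?thesis using e[of "k x" "k y"] e[of x y] kd[of x y] kn by simp
  qed
  have re: "Re (k x) = Re x" for x using inner[of x 1] k1 by simp
  have "\<bar>Im (k \<i>)\<bar> = 1" using kn[of \<i>] re[of \<i>] by (simp add: cmod_def)
  then consider "Im (k \<i>) = 1" | "Im (k \<i>) = - 1" by linarith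
  then show ?thesis
  proof cases
    case 1
    have "Im (k x) = Im x" for x using inner[of x \<i>] re[of \<i>] 1 by simp
    then have "k x = x" for x using re by (simp add: complex_eq_iff)
    then show ?thesis using h u1 by metis
  next
    case 2
    have "Im (k x) = - Im x" for x using inner[of x \<i>] re[of \<i>] 2 by simp
    then have "k x = cnj x" for x using re by (simp add: complex_eq_iff)
    then show ?thesis using h u1 by metis
  qed
qed

lemma isometry_form:
  fixes g :: "real ^ 2 \<Rightarrow> complex"
  assumes "\<And>x y. dist (g x) (g y) = dist x y"
  obtains p u where "norm u = 1" "\<And>v. g v = p + u * cx v"
  | p u where "norm u = 1" "\<And>v. g v = p + u * cnj (cx v)"
proof -
  have inv: "inv cx (cx v) = v" "cx (inv cx w) = w" for v w
    using bij_cx by (simp_all add: bij_is_inj bij_is_surj surj_f_inv_f)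
  have "dist (g (inv cx x)) (g (inv cx y)) = dist x y" for x y
    by (metis assms dist_cx inv(2))
  from complex_isometry[OF this] that inv(1) show ?thesis by metis
qed

lemma isometry_segment:
  fixes g :: "real ^ 2 \<Rightarrow> complex"
  assumes "\<And>x y. dist (g x) (g y) = dist x y"
  shows "g ` closed_segment a b = closed_segment (g a) (g b)"
proof -
  have lin: "g ` closed_segment a b = closed_segment (g a) (g b)" if "linear L" "\<And>v. g v = p + L v" for p L
  proof -
    have "g = (+) p \<circ> L" using that(2) by auto
    then have "g ` closed_segment a b = (+) p ` (L ` closed_segment a b)" by (simp add: image_comp)
    then show ?thesis
      using closed_segment_linear_image[OF that(1), of a b] closed_segment_translation[of p "L a" "L b"] that(2) by simp
  qed
  have m: "linear (\<lambda>w. u * w)" for u :: complex by (rule linearI) (simp_all add: algebra_simps)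
  have c: "linear cnj" by (rule linearI) simp_all
  show ?thesis
  proof (rule isometry_form[OF assms])
    fix p u assume "\<And>v. g v = p + u * cx v"
    then show ?thesis using lin[OF linear_compose[OF linear_cx m]] by (simp add: o_def)
  next
    fix p u assume "\<And>v. g v = p + u * cnj (cx v)"
    then show ?thesis using lin[OF linear_compose[OF linear_compose[OF linear_cx c] m]] by (simp add: o_def)
  qed
qed

lemma isometry_bij:
  fixes g :: "real ^ 2 \<Rightarrow> complex"
  assumes "\<And>x y. dist (g x) (g y) = dist x y"
  shows "bij g"
proof (rule bijI)
  show "inj g" by (rule injI) (metis assms dist_eq_0_iff)
  have s: "\<exists>v. cx v = w" for w using bij_cx by (metis bij_pointE)
  show "surj g"
  proof (rule isometry_form[OF assms])
    fix p u assume u: "norm u = 1" "\<And>v. g v = p + u * cx v"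
    then have "u \<noteq> 0" by auto
    have "\<exists>v. g v = w" for w
    proof -
      obtain v where "cx v = (w - p) / u" using s by blast
      then have "g v = w" using u(2) \<open>u \<noteq> 0\<close> by simp
      then show ?thesis by blast
    qed
    then show "surj g" by (metis surjI)
  next
    fix p u assume u: "norm u = 1" "\<And>v. g v = p + u * cnj (cx v)"
    then have "u \<noteq> 0" by auto
    have "\<exists>v. g v = w" for w
    proof -
      obtain v where "cx v = cnj ((w - p) / u)" using s by blast
      then have "g v = w" using u(2) \<open>u \<noteq> 0\<close> by simp
      then show ?thesis by blast
    qed
    then show "surj g" by (metis surjI)
  qed
qed

lemma isometry_interior:
  fixes g :: "real ^ 2 \<Rightarrow> complex"
  assumes iso: "\<And>x y. dist (g x) (g y) = dist x y"
  shows "interior (g ` S) = g ` interior S"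
proof -
  have b: "bij g" by (rule isometry_bij[OF iso])
  have ball: "g ` ball x r = ball (g x) r" for x r
  proof
    show "g ` ball x r \<subseteq> ball (g x) r" using iso by auto
    show "ball (g x) r \<subseteq> g ` ball x r"
    proof
      fix w assume "w \<in> ball (g x) r"
      moreover obtain v where "w = g v" using b by (metis bij_pointE)
      ultimately show "w \<in> g ` ball x r" using iso by auto
    qed
  qed
  have "g x \<in> interior (g ` S) \<longleftrightarrow> x \<in> interior S" for x
    unfolding mem_interior ball[symmetric] using b by (simp add: inj_image_subset_iff bij_is_inj)
  moreover have "\<exists>x. w = g x" for w using b by (metis bij_pointE)
  ultimately show ?thesis using interior_subset[of S] interior_subset[of "g ` S"] by blast
qed

fun ctile_of :: "(real ^ 2 \<Rightarrow> complex) \<Rightarrow> tile \<Rightarrow> ctile" where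
  "ctile_of g (s, f) = (s, g (corner_of (s, f) Tip),
     (g (corner_of (s, f) Far) - g (corner_of (s, f) Tip)) / of_real (axis_len s))"

lemma ctile_of:
  assumes g: "\<And>x y. dist (g x) (g y) = dist x y" and f: "plane_isometry f"
    and c: "ctile_of g (s, f) = (s, p, u)"
  obtains z where "z \<in> wing_dirs" "norm u = 1"
    "g (corner_of (s, f) Tip) = p" "g (corner_of (s, f) Wing1) = p + \<Phi> * z * u"
    "g (corner_of (s, f) Wing2) = p + \<Phi> * cnj z * u" "g (corner_of (s, f) Far) = p + of_real (axis_len s) * u"
    "g ` region (s, f) = region_c (s, p, u)"
proof -
  have iso: "dist (g (f x)) (g (f y)) = dist x y" for x y
    using g f by (simp add: plane_isometry_def)
  have a: "complex_of_real (axis_len s) \<noteq> 0" using axis_len_pos[of s] by simp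
  have reg: "region_c (s, q, v) = (\<lambda>w. q + v * w) ` unit_region s" if "v \<noteq> 0" for q v
  proof
    show "region_c (s, q, v) \<subseteq> (\<lambda>w. q + v * w) ` unit_region s"
    proof
      fix x assume "x \<in> region_c (s, q, v)"
      then have "(x - q) / v \<in> unit_region s" "x = q + v * ((x - q) / v)"
        using that by (simp_all add: unit_region_def)
      then show "x \<in> (\<lambda>w. q + v * w) ` unit_region s" by blast
    qed
    show "(\<lambda>w. q + v * w) ` unit_region s \<subseteq> region_c (s, q, v)"
      using that by (auto simp: unit_region_def)
  qed
  have region: "g ` region (s, f) = (\<lambda>v. g (f v)) ` prototile s"
    by (auto simp: region_def)
  note corner = corner_of_def fst_conv snd_conv
  show ?thesis
  proof (rule isometry_form[of "\<lambda>v. g (f v)", OF iso])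
    fix q v assume v: "norm v = 1" and eq: "\<And>x. g (f x) = q + v * cx x"
    have pu: "p = q" "u = v"
      using c a by (auto simp: corner eq cx_corners simp del: corner_pos.simps)
    have "v \<noteq> 0" using v by auto
    have "g ` region (s, f) = (\<lambda>w. q + v * w) ` (cx ` prototile s)"
      unfolding region eq image_image ..
    then have "g ` region (s, f) = region_c (s, p, u)"
      unfolding cx_prototile pu reg[OF \<open>v \<noteq> 0\<close>] .
    then show ?thesis
      by (intro that[of \<zeta>]) (simp_all add: corner eq cx_corners pu v mult_ac del: corner_pos.simps region_c.simps)
  next
    fix q v assume v: "norm v = 1" and eq: "\<And>x. g (f x) = q + v * cnj (cx x)"
    have pu: "p = q" "u = v"
      using c a by (auto simp: corner eq cx_corners simp del: corner_pos.simps)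
    have "v \<noteq> 0" using v by auto
    have cnj_region: "cnj ` unit_region s = unit_region s"
    proof
      show "cnj ` unit_region s \<subseteq> unit_region s" using unit_region_cnj by auto
      show "unit_region s \<subseteq> cnj ` unit_region s"
      proof
        fix w assume "w \<in> unit_region s"
        then have "cnj w \<in> unit_region s" using unit_region_cnj by blast
        moreover have "w = cnj (cnj w)" by simp
        ultimately show "w \<in> cnj ` unit_region s" by (rule rev_image_eqI)
      qed
    qed
    have "g ` region (s, f) = (\<lambda>w. q + v * w) ` (cnj ` (cx ` prototile s))"
      unfolding region eq image_image ..
    then have "g ` region (s, f) = region_c (s, p, u)"
      unfolding cx_prototile cnj_region pu reg[OF \<open>v \<noteq> 0\<close>] .
    then show ?thesis
      by (intro that[of "cnj \<zeta>"]) (simp_all add: corner eq cx_corners pu v mult_ac del: corner_pos.simps region_c.simps)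
  qed
qed

section \<open>Areas\<close>

lemma plane_isometry_orthogonal:
  assumes "plane_isometry f"
  obtains a L where "orthogonal_transformation L" "\<And>x. f x = a + L x"
proof (rule that)
  show "orthogonal_transformation (\<lambda>x. f x - f 0)"
    using assms unfolding orthogonal_transformation_isometry plane_isometry_def by (simp add: dist_norm)
  show "f x = f 0 + (f x - f 0)" for x by simp
qed

lemma plane_isometry_measure:
  assumes f: "plane_isometry f" and S: "S \<in> lmeasurable"
  shows "f ` S \<in> lmeasurable" "measure lebesgue (f ` S) = measure lebesgue S"
proof -
  obtain L a where L: "orthogonal_transformation L" "\<And>x. f x = a + L x"
    using plane_isometry_orthogonal[OF f] by blast
  have fS: "f ` S = (+) a ` (L ` S)" by (auto simp: L(2))
  show "f ` S \<in> lmeasurable" unfolding fS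
    using measurable_orthogonal_image[OF L(1) S] by (rule measurable_translation)
  show "measure lebesgue (f ` S) = measure lebesgue S"
    unfolding fS by (simp add: measure_translation measure_orthogonal_image[OF L(1) S])
qed

lemma plane_isometry_convex:
  assumes f: "plane_isometry f" and S: "convex S"
  shows "convex (f ` S)"
proof -
  obtain L a where L: "orthogonal_transformation L" "\<And>x. f x = a + L x"
    using plane_isometry_orthogonal[OF f] by blast
  have fS: "f ` S = (+) a ` (L ` S)" by (auto simp: L(2))
  show ?thesis unfolding fS
    by (intro convex_translation convex_linear_image S orthogonal_transformation_linear L(1))
qed

lemma negligible_frontier_region:
  assumes "plane_isometry f"
  shows "negligible (frontier (f ` prototile s))"
  unfolding prototile_Un image_Un
  by (rule negligible_subset[OF _ frontier_Un_subset])
    (intro negligible_Un negligible_convex_frontier plane_isometry_convex[OF assms] convex_convex_hull)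

lemma prototile_lmeasurable: "prototile s \<in> lmeasurable"
  unfolding prototile_Un
  by (intro lmeasurable_compact compact_Un compact_convex_hull finite_imp_compact) auto

lemma measure_triangle:
  fixes A B C :: "real ^ 2"
  shows "measure lebesgue (convex hull {A, B, C}) =
    \<bar>(C $ 1 - A $ 1) * (B $ 2 - A $ 2) - (B $ 1 - A $ 1) * (C $ 2 - A $ 2)\<bar> / 2"
proof -
  have "compact (convex hull {A, B, C})" by (intro compact_convex_hull finite_imp_compact) auto
  then have "convex hull {A, B, C} \<in> sets lborel" by (simp add: borel_compact)
  then show ?thesis using content_triangle[of A B C] by (simp add: measure_completion)
qed

lemma measure_prototile: "measure lebesgue (prototile s) = axis_len s * (phi * sin (pi / 5))"
proof -
  let ?A = "convex hull {corner_pos s Tip, corner_pos s Wing1, corner_pos s Far}"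
    and ?B = "convex hull {corner_pos s Tip, corner_pos s Wing2, corner_pos s Far}"
  define f where "f b = (if b then ?A else ?B)" for b
  have AB: "?A \<inter> ?B \<subseteq> {x. x $ 2 = 0}"
  proof
    fix x assume "x \<in> ?A \<inter> ?B"
    then have "cx x \<in> cx ` ?A" "cx x \<in> cx ` ?B" by blast+
    then have "Im (cx x) = 0" unfolding half_hull_cx by simp
    then show "x \<in> {x. x $ 2 = 0}" by (simp add: cx_def)
  qed
  have "negligible (?A \<inter> ?B)"
    by (rule negligible_subset[OF negligible_standard_hyperplane_cart AB])
  then have neg: "pairwise (\<lambda>x y. negligible (f x \<inter> f y)) UNIV"
    by (auto simp: pairwise_def f_def Int_commute)
  have meas: "f b \<in> lmeasurable" for b
    unfolding f_def by (cases b) (simp_all only: if_True if_False,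
        (intro lmeasurable_compact compact_convex_hull finite_imp_compact finite.intros)+)
  have "measure lebesgue (\<Union>(f ` UNIV)) = (\<Sum>b\<in>UNIV. measure lebesgue (f b))"
    by (rule measure_negligible_finite_Union_image) (use meas neg in auto)
  moreover have "\<Union>(f ` UNIV) = prototile s" unfolding prototile_Un by (auto simp: f_def UNIV_bool)
  moreover have "measure lebesgue ?A = axis_len s * (phi * sin (pi / 5)) / 2"
    "measure lebesgue ?B = axis_len s * (phi * sin (pi / 5)) / 2"
    using sin_pos phi_bounds unfolding measure_triangle by (cases s; simp add: abs_mult)+
  ultimately show ?thesis by (simp add: UNIV_bool f_def)
qed

section \<open>The complex tiling of a Penrose tiling\<close>

context
  fixes \<tau> :: "tile set"
  assumes tiling: "tiling \<tau>"
begin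

lemma tile_isometry: "t \<in> \<tau> \<Longrightarrow> plane_isometry (snd t)"
  using tiling by (auto simp: tiling_def)

lemma region_measure:
  assumes "t \<in> \<tau>"
  shows "region t \<in> lmeasurable" "measure lebesgue (region t) = axis_len (fst t) * (phi * sin (pi / 5))"
  using plane_isometry_measure[OF tile_isometry[OF assms] prototile_lmeasurable[of "fst t"]] measure_prototile
  by (simp_all add: region_def)

lemma region_dist_le:
  assumes "t \<in> \<tau>" "x \<in> region t" "y \<in> region t"
  shows "dist x y \<le> 2"
  using tile_isometry[OF assms(1)] assms(2,3) prototile_dist_le
  by (auto simp: region_def plane_isometry_def)

lemma measure_Union_regions:
  assumes "finite F" "F \<subseteq> \<tau>"
  shows "measure lebesgue (\<Union>t\<in>F. region t) = (\<Sum>t\<in>F. measure lebesgue (region t))"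
proof (rule measure_negligible_finite_Union_image)
  show "pairwise (\<lambda>t t'. negligible (region t \<inter> region t')) F"
  proof (rule pairwiseI)
    fix t t' assume t: "t \<in> F" "t' \<in> F" "t \<noteq> t'"
    then have "interior (region t) \<inter> interior (region t') = {}"
      using tiling assms(2) unfolding tiling_def by blast
    then have "region t \<inter> region t' \<subseteq> frontier (region t) \<union> frontier (region t')"
      using closure_subset[of "region t"] closure_subset[of "region t'"] unfolding frontier_def by blast
    moreover have fr: "negligible (frontier (region t))" if "t \<in> F" for t
      unfolding region_def
      by (rule negligible_frontier_region[OF tile_isometry]) (use that assms(2) in blast)
    ultimately show "negligible (region t \<inter> region t')"
      by (metis negligible_subset[OF negligible_Un[OF fr[OF t(1)] fr[OF t(2)]]])
  qed
  show "region t \<in> lmeasurable" if "t \<in> F" for t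
    by (rule region_measure(1)) (use that assms(2) in blast)
qed (rule assms(1))

lemma finite_tiles_near: "finite {t \<in> \<tau>. region t \<inter> cball x r \<noteq> {}}"
proof -
  define \<psi> where "\<psi> = phi * sin (pi / 5)"
  have \<psi>: "\<psi> > 0" using phi_bounds sin_pos by (simp add: \<psi>_def)
  have al: "axis_len s \<ge> 1" for s using phi_bounds by (cases s) auto
  define n where "n = nat \<lfloor>measure lebesgue (cball x (r + 2)) / \<psi>\<rfloor>"
  have "card F \<le> n" if F: "F \<subseteq> {t \<in> \<tau>. region t \<inter> cball x r \<noteq> {}}" "finite F" for F
  proof -
    have F\<tau>: "F \<subseteq> \<tau>" using F by auto
    have "real (card F) * \<psi> \<le> (\<Sum>t\<in>F. measure lebesgue (region t))"
    proof -
      have "(\<Sum>t\<in>F. \<psi>) \<le> (\<Sum>t\<in>F. measure lebesgue (region t))"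
      proof (rule sum_mono)
        fix t assume "t \<in> F"
        then show "\<psi> \<le> measure lebesgue (region t)"
          using region_measure(2)[of t] F\<tau> mult_right_mono[OF al[of "fst t"], of \<psi>] \<psi>
          by (auto simp: \<psi>_def)
      qed
      then show ?thesis by simp
    qed
    also have "\<dots> = measure lebesgue (\<Union>t\<in>F. region t)"
      using measure_Union_regions[OF F(2) F\<tau>] by simp
    also have "\<dots> \<le> measure lebesgue (cball x (r + 2))"
    proof (rule measure_mono_fmeasurable)
      show "(\<Union>t\<in>F. region t) \<subseteq> cball x (r + 2)"
      proof
        fix y assume "y \<in> (\<Union>t\<in>F. region t)"
        then obtain t z where t: "t \<in> F" "y \<in> region t" "z \<in> region t" "z \<in> cball x r" using F(1) by blast
        then have "dist z y \<le> 2" using region_dist_le F\<tau> by blast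
        then show "y \<in> cball x (r + 2)" using t(4) dist_triangle[of x y z] by simp
      qed
      show "(\<Union>t\<in>F. region t) \<in> sets lebesgue"
        using F(2) F\<tau> region_measure(1) by (intro fmeasurableD fmeasurable.finite_UN) blast+
    qed simp
    finally have "real (card F) \<le> measure lebesgue (cball x (r + 2)) / \<psi>"
      using \<psi> by (simp add: field_simps)
    then show ?thesis unfolding n_def by (rule le_nat_floor)
  qed
  then show ?thesis using finite_if_finite_subsets_card_bdd by blast
qed

lemma complex_tiling_of:
  assumes ete: "edge_to_edge \<tau>" and lab: "labels_match \<tau>"
    and g: "\<And>x y. dist (g x) (g y) = dist x y"
  shows "complex_tiling (ctile_of g ` \<tau>)" "inj_on (ctile_of g) \<tau>"
    "\<And>t. t \<in> \<tau> \<Longrightarrow> region_c (ctile_of g t) = g ` region t"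
proof -
  have bij: "bij g" by (rule isometry_bij[OF g])
  then have inj: "inj g" and surj: "surj g" by (simp_all add: bij_is_inj bij_is_surj)
  have data: "norm (snd (snd (ctile_of g t))) = 1 \<and> region_c (ctile_of g t) = g ` region t \<and>
      edges_c (ctile_of g t) = (`) g ` edges t \<and> corners_c (ctile_of g t) = g ` range (corner_of t) \<and>
      (\<forall>x l. (x, l) \<in> labels_c (ctile_of g t) \<longrightarrow> (\<exists>k. x = g (corner_of t k) \<and> l = corner_label (fst t) k))"
    if t: "t \<in> \<tau>" for t
  proof -
    obtain s f where tf: "t = (s, f)" by (cases t)
    obtain p u where c: "ctile_of g (s, f) = (s, p, u)" by simp
    have f: "plane_isometry f" using tile_isometry[OF t] tf by simp
    obtain z where z: "z \<in> wing_dirs" "norm u = 1"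
      "g (corner_of (s, f) Tip) = p" "g (corner_of (s, f) Wing1) = p + \<Phi> * z * u"
      "g (corner_of (s, f) Wing2) = p + \<Phi> * cnj z * u" "g (corner_of (s, f) Far) = p + of_real (axis_len s) * u"
      "g ` region (s, f) = region_c (s, p, u)"
      by (rule ctile_of[OF g f c])
    have W: "wing_dirs = {z, cnj z}" using z(1) by (auto simp: wing_dirs_def)
    have U: "(UNIV :: corner set) = {Tip, Wing1, Wing2, Far}"
    proof (rule UNIV_eq_I)
      show "x \<in> {Tip, Wing1, Wing2, Far}" for x by (cases x) simp_all
    qed
    have E: "edges_c (s, p, u) = (`) g ` edges (s, f)"
      unfolding edges_def sides_def image_insert image_empty case_prod_conv isometry_segment[OF g] z
        edges_c_def W half_of.simps long_edge_def short_edge_def tip.simps wing.simps far_eq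
      by (auto simp: closed_segment_commute)
    have K: "corners_c (s, p, u) = g ` range (corner_of (s, f))"
      unfolding corners_c_def W half_of.simps tip.simps wing.simps far_eq U image_insert image_empty z by auto
    have L: "\<exists>k. x = g (corner_of (s, f) k) \<and> l = corner_label s k" if "(x, l) \<in> labels_c (s, p, u)" for x l
    proof -
      have w: "corner_label s Wing1 = corner_label s Wing2" by (cases s) auto
      have "(x, l) \<in> (\<lambda>k. (g (corner_of (s, f) k), corner_label s k)) ` {Tip, Wing1, Wing2, Far}"
        using that unfolding labels_c_def W half_of.simps tip.simps wing.simps far_eq fst_conv image_insert image_empty z
        by (auto simp: w)
      then show ?thesis by auto
    qed
    show ?thesis unfolding tf c using z(2,7) E K L by simp
  qed
  show reg: "\<And>t. t \<in> \<tau> \<Longrightarrow> region_c (ctile_of g t) = g ` region t" using data by blast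
  have int: "interior (region_c (ctile_of g t)) = g ` interior (region t)" if "t \<in> \<tau>" for t
    using reg[OF that] isometry_interior[OF g] by simp
  have disj: "interior (region t) \<inter> interior (region t') = {}" if "t \<in> \<tau>" "t' \<in> \<tau>" "t \<noteq> t'" for t t'
    using tiling that unfolding tiling_def by blast
  show "inj_on (ctile_of g) \<tau>"
  proof (rule inj_onI)
    fix t t' assume t: "t \<in> \<tau>" "t' \<in> \<tau>" "ctile_of g t = ctile_of g t'"
    have "interior (region t) = interior (region t')"
      using int[OF t(1)] int[OF t(2)] t(3) inj by (simp add: inj_image_eq_iff)
    moreover have "interior (region t) \<noteq> {}"
    proof -
      have u: "snd (snd (ctile_of g t)) \<noteq> 0" using data[OF t(1)] by auto
      have "tip (half_of (ctile_of g t) \<zeta>) \<in> corners_c (ctile_of g t)" by (auto simp: corners_c_def)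
      then have "region_c (ctile_of g t) \<noteq> {}" using corners_subset[OF u] by blast
      then have "interior (region_c (ctile_of g t)) \<noteq> {}" using region_closure[OF u] by auto
      then show ?thesis using int[OF t(1)] by auto
    qed
    ultimately show "t = t'" using disj[OF t(1,2)] by auto
  qed
  show "complex_tiling (ctile_of g ` \<tau>)"
  proof
    fix s p u assume "(s, p, u) \<in> ctile_of g ` \<tau>"
    then obtain t where "t \<in> \<tau>" "ctile_of g t = (s, p, u)" by force
    then show "norm u = 1" using data[of t] by simp
  next
    have "(\<Union>c\<in>ctile_of g ` \<tau>. region_c c) = g ` (\<Union>t\<in>\<tau>. region t)"
      using reg by (simp add: image_UN)
    then show "(\<Union>c\<in>ctile_of g ` \<tau>. region_c c) = UNIV"
      using tiling surj by (simp add: tiling_def)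
  next
    fix c c' assume c: "c \<in> ctile_of g ` \<tau>" "c' \<in> ctile_of g ` \<tau>" "c \<noteq> c'"
    then obtain t t' where t: "t \<in> \<tau>" "t' \<in> \<tau>" "c = ctile_of g t" "c' = ctile_of g t'" "t \<noteq> t'" by blast
    show "interior (region_c c) \<inter> interior (region_c c') = {}"
      using disj[OF t(1,2,5)] int t image_Int[OF inj] by (metis image_empty)
    fix e e' assume e: "e \<in> edges_c c" "e' \<in> edges_c c'"
    have Ec: "edges_c c = (`) g ` edges t" "edges_c c' = (`) g ` edges t'" "corners_c c = g ` range (corner_of t)"
      using data[OF t(1)] data[OF t(2)] t(3,4) by simp_all
    obtain e1 e1' where e1: "e1 \<in> edges t" "e = g ` e1" "e1' \<in> edges t'" "e' = g ` e1'"
      using e unfolding Ec by blast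
    have "e1 = e1' \<or> e1 \<inter> e1' \<subseteq> range (corner_of t)"
      using ete t e1 unfolding edge_to_edge_def by blast
    then show "e = e' \<or> e \<inter> e' \<subseteq> corners_c c"
      unfolding Ec e1 image_Int[OF inj, symmetric] by blast
  next
    fix c c' x l l' assume c: "c \<in> ctile_of g ` \<tau>" "c' \<in> ctile_of g ` \<tau>"
      and xl: "(x, l) \<in> labels_c c" "(x, l') \<in> labels_c c'"
    obtain t t' where t: "t \<in> \<tau>" "t' \<in> \<tau>" "c = ctile_of g t" "c' = ctile_of g t'" using c by blast
    obtain k where k: "x = g (corner_of t k)" "l = corner_label (fst t) k"
      using data[OF t(1)] xl(1) t(3) by blast
    obtain k' where k': "x = g (corner_of t' k')" "l' = corner_label (fst t') k'"
      using data[OF t(2)] xl(2) t(4) by blast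
    have "corner_of t k = corner_of t' k'" using k(1) k'(1) inj by (metis injD)
    then show "l = l'" using lab t(1,2) unfolding labels_match_def k(2) k'(2) by blast
  next
    fix x r
    obtain y where y: "x = g y" using surj by (metis surjD)
    have "{c \<in> ctile_of g ` \<tau>. region_c c \<inter> cball x r \<noteq> {}} \<subseteq>
        ctile_of g ` {t \<in> \<tau>. region t \<inter> cball y r \<noteq> {}}"
    proof
      fix c assume "c \<in> {c \<in> ctile_of g ` \<tau>. region_c c \<inter> cball x r \<noteq> {}}"
      then obtain t q where t: "t \<in> \<tau>" "c = ctile_of g t" "q \<in> region_c c" "q \<in> cball x r" by blast
      then obtain v where "v \<in> region t" "q = g v" using reg by auto
      then have "v \<in> region t \<inter> cball y r" using t(4) g by (auto simp: y)
      then show "c \<in> ctile_of g ` {t \<in> \<tau>. region t \<inter> cball y r \<noteq> {}}" using t(1,2) by blast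
    qed
    then show "finite {c \<in> ctile_of g ` \<tau>. region_c c \<inter> cball x r \<noteq> {}}"
      using finite_tiles_near[of y r] finite_subset by blast
  qed
qed

text \<open>Placing one tile in standard position makes all corners elements of the lattice.\<close>

lemma normalized_tiling:
  assumes t0: "t0 \<in> \<tau>"
  obtains g where "\<And>x y. dist (g x) (g y) = dist x y" "ctile_of g t0 = (fst t0, 0, 1)"
proof -
  obtain s f where tf: "t0 = (s, f)" by (cases t0)
  have f: "plane_isometry f" using tile_isometry[OF t0] tf by simp
  have fi: "dist (f x) (f y) = dist x y" for x y using f by (simp add: plane_isometry_def)
  have "bij (\<lambda>v. cx (f v))" by (rule isometry_bij) (simp add: dist_cx fi)
  then have "\<exists>v. cx (f v) = cx y" for y by (metis bij_pointE)
  then have "\<exists>v. f v = y" for y using bij_cx by (metis bij_is_inj injD)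
  moreover have "inj f" by (rule injI) (metis fi dist_eq_0_iff)
  ultimately have "bij f" by (metis bijI surjI)
  then have inv: "f (inv f x) = x" "inv f (f x) = x" for x
    by (simp_all add: bij_is_surj surj_f_inv_f bij_is_inj)
  define g where "g v = cx (inv f v)" for v
  have "dist (g x) (g y) = dist x y" for x y
    unfolding g_def dist_cx by (metis fi inv(1))
  moreover have "ctile_of g t0 = (fst t0, 0, 1)"
    using axis_len_pos[of s]
    by (simp add: tf corner_of_def g_def inv cx_corners del: corner_pos.simps)
  ultimately show ?thesis by (rule that)
qed

end

lemma (in complex_tiling) graded_halves:
  assumes "(s, 0, 1) \<in> C"
  shows "graded halves 1"
proof -
  define Q where "Q h = (case h of (s, p, u, z) \<Rightarrow> p \<in> lat \<and> u \<in> lat \<and> norm (star u) = 1)" for h :: half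
  have step: "Q k" if "Q h" "h \<in> halves" "half_adj h k" for h k
  proof -
    obtain s p u z where h: "h = (s, p, u, z)" by (cases h)
    have z: "z \<in> wing_dirs" "cnj z \<in> wing_dirs" using that(2) wing_dirs_cnj by (auto simp: h in_halves)
    have pu: "p \<in> lat" "u \<in> lat" "norm (star u) = 1" using that(1) by (auto simp: Q_def h)
    note Nu = norm_star_steps[OF pu(2)]
    have zu: "z * u \<in> lat" "norm (star (z * u)) = 1" "cnj z * u \<in> lat" "norm (star (cnj z * u)) = 1"
      using Nu(3,4) z pu(3) by simp_all
    have z2u: "z\<^sup>2 * u \<in> lat" "norm (star (z\<^sup>2 * u)) = 1"
      using norm_star_steps(3,4)[OF zu(1) z(1)] zu(2) by (simp_all add: power2_eq_square mult.assoc)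
    have neg: "- v \<in> lat \<and> norm (star (- v)) = 1" if "v \<in> lat" "norm (star v) = 1" for v
      using lat_minus[OF that(1)] that(2) by simp
    have e: "\<Phi> * z * u = \<Phi> * (z * u)" "\<Phi> * (1 + z) * u = \<Phi> * u + \<Phi> * (z * u)"
      "\<Phi>\<^sup>2 * z * u = \<Phi> * (\<Phi> * (z * u))" "\<Phi>\<^sup>2 * u = \<Phi> * (\<Phi> * u)"
      by (simp_all add: power2_eq_square algebra_simps)
    have P: "p + \<Phi> * (z * u) \<in> lat" "p + (\<Phi> * u + \<Phi> * (z * u)) \<in> lat"
      "p + \<Phi> * (\<Phi> * (z * u)) \<in> lat" "p + \<Phi> * (\<Phi> * u) \<in> lat"
      by (intro lat_add(1) lat_Phi(1) pu zu)+
    show ?thesis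
      using that(3) pu zu z2u neg P
      unfolding h half_adj_def long_nb_eq
      by (cases s) (auto simp: Q_def short_nb_Kite short_nb_Dart e)
  qed
  have h0: "(s, 0, 1, \<zeta>) \<in> halves" using assms by (simp add: in_halves)
  have Q0: "Q (s, 0, 1, \<zeta>)" by (simp add: Q_def lat_0 lat_1 star_1)
  have "Q k" if "walk halves n (s, 0, 1, \<zeta>) k" for n k
    using that Q0
  proof (induction rule: walk.induct)
    case (walk_Suc n h k l)
    then show ?case using step walk_mem by blast
  qed
  then have "Q k" if "k \<in> halves" for k using connected_halves[OF h0 that] by blast
  then show ?thesis unfolding graded_def Q_def by (auto split: prod.splits)
qed

section \<open>Counting tiles in a square\<close>

lemma half_adj_corner:
  assumes z: "z \<in> wing_dirs" and adj: "half_adj (s, p, u, z) k"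
  shows "\<exists>x. x \<in> {tip (s, p, u, z), wing (s, p, u, z), far (s, p, u, z)} \<and> x \<in> {tip k, wing k, far k}"
proof -
  note R = wing_dirs_rel(1,2)[OF z] Phi_square
  have 1: "p + \<Phi>\<^sup>2 * z * u + - (z * u) = p + \<Phi> * z * u" using R(3) by algebra
  have 2: "p + \<Phi>\<^sup>2 * u + \<Phi> * z * - (cnj z * u) = p + u" using R by algebra
  have 3: "p + \<Phi> * (1 + z) * u + \<Phi> * - (z * u) = p + \<Phi> * u" by algebra
  from adj consider "k = twin (s, p, u, z)" | "long_nb (s, p, u, z) k" | "short_nb (s, p, u, z) k"
    unfolding half_adj_def by blast
  then show ?thesis
  proof cases
    case 1
    then show ?thesis by (intro exI[of _ p]) simp
  next
    case 2
    then consider "k = (s, p, z\<^sup>2 * u, cnj z)" | "k = (other s, p + \<Phi> * z * u, - u, z)"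
      using long_nb_eq by blast
    then show ?thesis
    proof cases
      case 1
      then show ?thesis by (intro exI[of _ p]) simp
    next
      case 2
      then show ?thesis by (intro exI[of _ "p + \<Phi> * z * u"]) simp
    qed
  next
    case s: 3
    show ?thesis
    proof (cases s)
      case Kite
      with s consider "k = (Kite, p + \<Phi> * (1 + z) * u, - (z * u), cnj z)"
        | "k = (Dart, p + \<Phi>\<^sup>2 * z * u, - (z * u), z)" using short_nb_Kite by blast
      then show ?thesis
      proof cases
        case 1
        then have "far k = far (s, p, u, z)" using 3 by (simp only: Kite far.simps)
        then show ?thesis by blast
      next
        case 2
        then have "far k = wing (s, p, u, z)" using 1 by (simp only: Kite far.simps wing.simps)
        then show ?thesis by blast
      qed
    next
      case Dart
      with s have "k = (Kite, p + \<Phi>\<^sup>2 * u, - (cnj z * u), z)" using short_nb_Dart by blast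
      then have "wing k = far (s, p, u, z)" using 2 by (simp only: Dart far.simps wing.simps)
      then show ?thesis by blast
    qed
  qed
qed

lemma measure_cbox_2:
  fixes a b c d :: real
  assumes "a \<le> c" "b \<le> d"
  shows "measure lebesgue (cbox (vector [a, b]) (vector [c, d]) :: (real ^ 2) set) = (c - a) * (d - b)"
proof -
  have "cbox (vector [a, b]) (vector [c, d]) \<noteq> ({} :: (real ^ 2) set)"
    using assms by (simp add: interval_ne_empty_cart forall_2)
  from content_cbox_cart[OF this] show ?thesis by (simp add: measure_completion UNIV_2)
qed

lemma measure_square: "l \<ge> 0 \<Longrightarrow> measure lebesgue (square j k l) = l\<^sup>2"
  unfolding square_def by (subst measure_cbox_2) (simp_all add: power2_eq_square)

lemma tile_count_identity:
  "1 = phi / (2 * phi - 1) * axis_len s + (phi - 1) / (2 * phi - 1) * conj_weight s"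
proof -
  have "2 * phi - 1 \<noteq> 0" using phi_bounds by simp
  then show ?thesis using phi_square by (cases s) (simp_all add: field_simps power2_eq_square)
qed

context
  fixes \<tau> :: "tile set"
  assumes penrose: "penrose_tiling \<tau>"
begin

lemma til: "tiling \<tau>" and ete: "edge_to_edge \<tau>" and lab: "labels_match \<tau>"
  using penrose by (auto simp: penrose_tiling_def)

lemma conj_weight_tiles:
  "\<exists>C\<ge>0::real. \<forall>U. bounded U \<longrightarrow>
    \<bar>\<Sum>t\<in>{t \<in> \<tau>. region t \<inter> U \<noteq> {}}. conj_weight (fst t)\<bar> \<le>
      C * card {t \<in> \<tau>. region t \<inter> U \<noteq> {} \<and> \<not> region t \<subseteq> U}"
proof -
  have "\<tau> \<noteq> {}" using til by (auto simp: tiling_def)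
  then obtain t0 where t0: "t0 \<in> \<tau>" by blast
  obtain g where g: "\<And>x y. dist (g x) (g y) = dist x y" "ctile_of g t0 = (fst t0, 0, 1)"
    using normalized_tiling[OF til t0] by blast
  define c where "c = ctile_of g"
  note ct = complex_tiling_of[OF til ete lab g(1), folded c_def]
  interpret complex_tiling "c ` \<tau>" by (rule ct(1))
  interpret half_tiling halves by (rule half_tiling_halves)
  have inj_g: "inj g" using isometry_bij[OF g(1)] by (rule bij_is_inj)
  have "(fst t0, 0, 1) \<in> c ` \<tau>" using g(2) t0 by (metis c_def image_eqI)
  from conj_weight_bound[OF graded_halves[OF this] connected_halves]
  obtain C :: real where C: "C \<ge> 0" "\<And>P. finite P \<Longrightarrow> P \<subseteq> halves \<Longrightarrow> \<forall>h\<in>P. twin h \<in> P \<Longrightarrow>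
    \<bar>\<Sum>h\<in>P. conj_weight (shape_of h)\<bar> \<le> C * card {h \<in> P. \<exists>k\<in>halves. half_adj h k \<and> k \<notin> P}"
    by blast
  have shape: "fst (c t) = fst t" for t by (cases t) (simp add: c_def)
  have half: "half_of d z = (fst d, fst (snd d), snd (snd d), z)" for d z by (cases d) simp
  define H where "H = (\<lambda>(t, z). half_of (c t) z)"
  have Hinj: "inj_on H (A \<times> wing_dirs)" if "A \<subseteq> \<tau>" for A
  proof (rule inj_onI, clarify)
    fix t z t' z' assume "t \<in> A" "t' \<in> A" "H (t, z) = H (t', z')"
    then have "c t = c t'" "z = z'" by (auto simp: H_def half prod_eq_iff)
    then show "t = t' \<and> z = z'" using ct(2) that \<open>t \<in> A\<close> \<open>t' \<in> A\<close> by (auto dest: inj_onD)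
  qed
  have cw: "card wing_dirs = 2" using wing_dirs_rel(3)[OF zeta_in(1)] by (simp add: wing_dirs_def)
  have fw: "finite wing_dirs" by (simp add: wing_dirs_def)
  have Hhalves: "H ` (\<tau> \<times> wing_dirs) = halves"
  proof
    have "H (t, z) \<in> halves" if "t \<in> \<tau>" "z \<in> wing_dirs" for t z
      using that by (cases "c t") (force simp: H_def in_halves)
    then show "H ` (\<tau> \<times> wing_dirs) \<subseteq> halves" by blast
    show "halves \<subseteq> H ` (\<tau> \<times> wing_dirs)"
    proof
      fix h assume "h \<in> halves"
      then obtain s p u z where h: "h = (s, p, u, z)" "(s, p, u) \<in> c ` \<tau>" "z \<in> wing_dirs"
        unfolding halves_def by blast
      then obtain t where "t \<in> \<tau>" "c t = (s, p, u)" by force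
      then have "h = H (t, z)" by (simp add: H_def h)
      then show "h \<in> H ` (\<tau> \<times> wing_dirs)" using \<open>t \<in> \<tau>\<close> h(3) by blast
    qed
  qed
  have "\<bar>\<Sum>t\<in>A. conj_weight (fst t)\<bar> \<le> C * card M"
    if U: "bounded U" and A: "A = {t \<in> \<tau>. region t \<inter> U \<noteq> {}}"
      and M: "M = {t \<in> \<tau>. region t \<inter> U \<noteq> {} \<and> \<not> region t \<subseteq> U}" for U A M
  proof -
    obtain r where "U \<subseteq> cball 0 r"
      using bounded_subset_ballD[OF U, of 0] ball_subset_cball by (metis order_trans)
    then have fA: "finite A"
      unfolding A by (intro finite_subset[OF _ finite_tiles_near[OF til, of 0 r]]) blast
    have AM: "A \<subseteq> \<tau>" "M \<subseteq> A" by (auto simp: A M)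
    have fM: "finite M" using AM(2) fA by (rule finite_subset)
    let ?P = "H ` (A \<times> wing_dirs)"
    have "(\<Sum>h\<in>?P. conj_weight (shape_of h)) = (\<Sum>(t, z)\<in>A \<times> wing_dirs. conj_weight (fst t))"
      by (subst sum.reindex[OF Hinj[OF AM(1)]]) (auto simp: H_def half shape intro!: sum.cong)
    also have "\<dots> = 2 * (\<Sum>t\<in>A. conj_weight (fst t))"
      by (simp add: sum.cartesian_product[symmetric] cw sum_distrib_left)
    finally have sum: "(\<Sum>h\<in>?P. conj_weight (shape_of h)) = 2 * (\<Sum>t\<in>A. conj_weight (fst t))" .
    have P: "finite ?P" "?P \<subseteq> halves"
      using fA fw AM(1) unfolding Hhalves[symmetric] by (auto intro!: image_mono)
    have tw: "\<forall>h\<in>?P. twin h \<in> ?P"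
    proof -
      have "twin (H (t, z)) = H (t, cnj z)" for t z by (simp add: H_def half)
      then have "twin (H (t, z)) \<in> ?P" if "t \<in> A" "z \<in> wing_dirs" for t z
        using that wing_dirs_cnj by auto
      then show ?thesis by blast
    qed
    have "{h \<in> ?P. \<exists>k\<in>halves. half_adj h k \<and> k \<notin> ?P} \<subseteq> H ` (M \<times> wing_dirs)"
    proof
      fix h assume "h \<in> {h \<in> ?P. \<exists>k\<in>halves. half_adj h k \<and> k \<notin> ?P}"
      then obtain t z k where h: "t \<in> A" "z \<in> wing_dirs" "h = H (t, z)" "k \<in> halves" "half_adj h k" "k \<notin> ?P"
        by blast
      from h(4) obtain t' z' where k: "t' \<in> \<tau>" "z' \<in> wing_dirs" "k = H (t', z')"
        unfolding Hhalves[symmetric] by blast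
      have t': "t' \<notin> A" using h(6) k by blast
      have corners: "{tip (H (t, z)), wing (H (t, z)), far (H (t, z))} \<subseteq> g ` region t"
        if "t \<in> \<tau>" "z \<in> wing_dirs" for t z
      proof -
        have "{tip (H (t, z)), wing (H (t, z)), far (H (t, z))} \<subseteq> corners_c (c t)"
          using that(2) by (auto simp: corners_c_def H_def)
        also have "\<dots> \<subseteq> region_c (c t)" by (rule corners_subset) (use nz' that(1) in blast)
        finally show ?thesis using ct(3)[OF that(1)] by simp
      qed
      obtain x where "x \<in> {tip h, wing h, far h}" "x \<in> {tip k, wing k, far k}"
        using half_adj_corner[OF h(2)] h(5) unfolding h(3) H_def half prod.case by blast
      then have "x \<in> g ` region t" "x \<in> g ` region t'"
        using corners[of t z] corners[of t' z'] h(1-3) k AM(1) by blast+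
      then obtain v where "v \<in> region t" "v \<in> region t'" using inj_g by (auto dest: injD)
      then have "\<not> region t \<subseteq> U" using t' k(1) by (auto simp: A)
      then have "t \<in> M" using h(1) by (auto simp: A M)
      then show "h \<in> H ` (M \<times> wing_dirs)" using h(2,3) by blast
    qed
    then have "card {h \<in> ?P. \<exists>k\<in>halves. half_adj h k \<and> k \<notin> ?P} \<le> card (H ` (M \<times> wing_dirs))"
      using fM fw by (intro card_mono) auto
    also have "\<dots> \<le> 2 * card M"
      using card_image_le[of "M \<times> wing_dirs" H] fM fw by (simp add: card_cartesian_product cw)
    finally have "real (card {h \<in> ?P. \<exists>k\<in>halves. half_adj h k \<and> k \<notin> ?P}) \<le> 2 * real (card M)" by simp
    from mult_left_mono[OF this C(1)] C(2)[OF P tw] show ?thesis unfolding sum by simp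
  qed
  then show ?thesis using C(1) by (intro exI[of _ C]) blast
qed

lemma boundary_tiles:
  assumes l: "l \<ge> 1"
  shows "finite {t \<in> \<tau>. region t \<inter> square j k l \<noteq> {}}"
    "card {t \<in> \<tau>. region t \<inter> square j k l \<noteq> {} \<and> \<not> region t \<subseteq> square j k l} * (phi * sin (pi / 5)) \<le> 64 * l"
proof -
  let ?U = "square j k l"
  define \<psi> where "\<psi> = phi * sin (pi / 5)"
  define M where "M = {t \<in> \<tau>. region t \<inter> ?U \<noteq> {} \<and> \<not> region t \<subseteq> ?U}"
  have "bounded ?U" by (simp add: square_def bounded_cbox)
  then obtain r where "?U \<subseteq> cball 0 r"
    using bounded_subset_ballD[of ?U 0] ball_subset_cball by (metis order_trans)
  then show fA: "finite {t \<in> \<tau>. region t \<inter> ?U \<noteq> {}}"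
    by (intro finite_subset[OF _ finite_tiles_near[OF til, of 0 r]]) blast
  then have fM: "finite M" unfolding M_def by (rule finite_subset[rotated]) blast
  have M\<tau>: "M \<subseteq> \<tau>" by (auto simp: M_def)
  let ?big = "cbox (vector [real j - 2, real k - 2]) (vector [real j + l + 2, real k + l + 2]) :: (real ^ 2) set"
  let ?small = "cbox (vector [real j + 2, real k + 2]) (vector [real j + l - 2, real k + l - 2]) :: (real ^ 2) set"
  have near: "\<bar>x $ i - y $ i\<bar> \<le> 2" if "t \<in> \<tau>" "x \<in> region t" "y \<in> region t" for t x y i
    using region_dist_le[OF til that] component_le_norm_cart[of "x - y" i] by (simp add: dist_norm)
  have sub: "(\<Union>t\<in>M. region t) \<subseteq> ?big - ?small"
  proof
    fix q assume "q \<in> (\<Union>t\<in>M. region t)"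
    then obtain t x y where t: "t \<in> \<tau>" "q \<in> region t" "x \<in> region t" "x \<in> ?U" "y \<in> region t" "y \<notin> ?U"
      unfolding M_def by blast
    have "\<bar>q $ i - x $ i\<bar> \<le> 2" "\<bar>q $ i - y $ i\<bar> \<le> 2" for i
      using near t by blast+
    from this[of 1] this[of 2] t(4,6) show "q \<in> ?big - ?small"
      by (auto simp: square_def mem_box_cart forall_2)
  qed
  have "card M * \<psi> \<le> measure lebesgue (\<Union>t\<in>M. region t)"
  proof -
    have "axis_len s \<ge> 1" for s using phi_bounds by (cases s) auto
    then have "(\<Sum>t\<in>M. \<psi>) \<le> (\<Sum>t\<in>M. axis_len (fst t) * \<psi>)"
      using phi_bounds sin_pos mult_right_mono[of 1 _ \<psi>] by (intro sum_mono) (simp add: \<psi>_def)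
    also have "\<dots> = (\<Sum>t\<in>M. measure lebesgue (region t))"
      using region_measure(2)[OF til] M\<tau> unfolding \<psi>_def by (intro sum.cong) auto
    finally show ?thesis using measure_Union_regions[OF til fM M\<tau>] by simp
  qed
  also have "\<dots> \<le> measure lebesgue (?big - ?small)"
  proof (rule measure_mono_fmeasurable[OF sub])
    show "(\<Union>t\<in>M. region t) \<in> sets lebesgue"
      using fM M\<tau> region_measure(1)[OF til] by (intro fmeasurableD fmeasurable.finite_UN) blast+
    show "?big - ?small \<in> lmeasurable" by (intro fmeasurable.Diff) simp_all
  qed
  also have "\<dots> \<le> 64 * l"
  proof (cases "l \<ge> 4")
    case True
    have "?small \<subseteq> ?big" by (auto simp: mem_box_cart forall_2)
    then have "measure lebesgue (?big - ?small) = measure lebesgue ?big - measure lebesgue ?small"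
      by (intro measurable_measure_Diff) simp_all
    also have "\<dots> = (l + 4) * (l + 4) - (l - 4) * (l - 4)"
      using True by (subst (1 2) measure_cbox_2) (simp_all add: algebra_simps)
    also have "\<dots> = 16 * l" by (simp add: algebra_simps)
    finally show ?thesis using True by simp
  next
    case False
    have "measure lebesgue (?big - ?small) \<le> measure lebesgue ?big"
      by (intro measure_mono_fmeasurable) auto
    also have "\<dots> = (l + 4) * (l + 4)"
      using l by (subst measure_cbox_2) (simp_all add: algebra_simps)
    also have "\<dots> \<le> 8 * 8" using False l by (intro mult_mono) auto
    finally show ?thesis using l by simp
  qed
  finally show "card {t \<in> \<tau>. region t \<inter> ?U \<noteq> {} \<and> \<not> region t \<subseteq> ?U} * (phi * sin (pi / 5)) \<le> 64 * l"
    unfolding M_def \<psi>_def .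
qed

lemma area_count:
  fixes j k :: nat
  assumes l: "l \<ge> 1"
  defines "A \<equiv> {t \<in> \<tau>. region t \<inter> square j k l \<noteq> {}}"
    and "M \<equiv> {t \<in> \<tau>. region t \<inter> square j k l \<noteq> {} \<and> \<not> region t \<subseteq> square j k l}"
    and "\<psi> \<equiv> phi * sin (pi / 5)"
  shows "\<bar>(\<Sum>t\<in>A. axis_len (fst t)) - l\<^sup>2 / \<psi>\<bar> \<le> 2 * card M"
proof -
  let ?U = "square j k l"
  have \<psi>: "\<psi> > 0" using phi_bounds sin_pos by (simp add: \<psi>_def)
  have fA: "finite A" unfolding A_def by (rule boundary_tiles(1)[OF l])
  have AM: "A \<subseteq> \<tau>" "M \<subseteq> A" by (auto simp: A_def M_def)
  have area: "measure lebesgue (\<Union>t\<in>F. region t) = \<psi> * (\<Sum>t\<in>F. axis_len (fst t))" if "F \<subseteq> A" for F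
  proof -
    have F: "finite F" "F \<subseteq> \<tau>" using that fA AM(1) finite_subset by blast+
    have "measure lebesgue (\<Union>t\<in>F. region t) = (\<Sum>t\<in>F. axis_len (fst t) * \<psi>)"
      unfolding measure_Union_regions[OF til F] \<psi>_def
      using region_measure(2)[OF til] F(2) by (intro sum.cong) auto
    then show ?thesis by (simp add: sum_distrib_left mult.commute)
  qed
  have meas: "(\<Union>t\<in>F. region t) \<in> lmeasurable" if "F \<subseteq> A" for F
  proof (rule fmeasurable.finite_UN)
    show "finite F" by (rule finite_subset[OF that fA])
    show "region t \<in> lmeasurable" if "t \<in> F" for t
      by (rule region_measure(1)[OF til]) (use that \<open>F \<subseteq> A\<close> AM(1) in blast)
  qed
  have U: "?U \<in> lmeasurable" "measure lebesgue ?U = l\<^sup>2"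
    using measure_square[of l j k] l by (auto simp: square_def)
  have UA: "?U \<subseteq> (\<Union>t\<in>A. region t)"
  proof
    fix x assume x: "x \<in> ?U"
    have "x \<in> (\<Union>t\<in>\<tau>. region t)" using til by (simp add: tiling_def)
    then obtain t where "t \<in> \<tau>" "x \<in> region t" by blast
    with x show "x \<in> (\<Union>t\<in>A. region t)" unfolding A_def by blast
  qed
  have "l\<^sup>2 \<le> \<psi> * (\<Sum>t\<in>A. axis_len (fst t))"
    using measure_mono_fmeasurable[OF UA fmeasurableD[OF U(1)] meas[OF order_refl]]
    unfolding U(2) area[OF order_refl] .
  then have 1: "l\<^sup>2 / \<psi> \<le> (\<Sum>t\<in>A. axis_len (fst t))" using \<psi> by (simp add: field_simps)
  have AMU: "(\<Union>t\<in>A - M. region t) \<subseteq> ?U" by (auto simp: A_def M_def)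
  have "\<psi> * (\<Sum>t\<in>A - M. axis_len (fst t)) \<le> l\<^sup>2"
    using measure_mono_fmeasurable[OF AMU fmeasurableD[OF meas[OF Diff_subset]] U(1)]
    unfolding U(2) area[OF Diff_subset] .
  then have 2: "(\<Sum>t\<in>A - M. axis_len (fst t)) \<le> l\<^sup>2 / \<psi>" using \<psi> by (simp add: field_simps)
  have al: "axis_len s \<le> 2" for s using phi_bounds by (cases s) auto
  have "(\<Sum>t\<in>M. axis_len (fst t)) \<le> 2 * card M"
    using sum_bounded_above[of M "\<lambda>t. axis_len (fst t)" 2] al by (simp add: mult.commute)
  moreover have "(\<Sum>t\<in>A. axis_len (fst t)) = (\<Sum>t\<in>A - M. axis_len (fst t)) + (\<Sum>t\<in>M. axis_len (fst t))"
    using sum.subset_diff[OF AM(2) fA] by simp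
  ultimately show ?thesis using 1 2 by linarith
qed

theorem net_count:
  assumes net: "net_created_by \<tau> Y"
  shows "\<exists>C\<ge>0::real. \<forall>j k. \<forall>l\<ge>1. finite (square j k l \<inter> Y) \<and>
    \<bar>real (card (square j k l \<inter> Y)) - phi / (2 * phi - 1) * (l\<^sup>2 / (phi * sin (pi / 5)))\<bar> \<le> C * l"
proof -
  define \<psi> where "\<psi> = phi * sin (pi / 5)"
  have \<psi>: "\<psi> > 0" using phi_bounds sin_pos by (simp add: \<psi>_def)
  obtain p c where p: "\<forall>t\<in>\<tau>. p t \<in> region t" "Y = p ` \<tau>" "c > 0"
    "\<forall>t\<in>\<tau>. \<forall>t'\<in>\<tau>. t \<noteq> t' \<longrightarrow> c \<le> dist (p t) (p t')"
    using net unfolding net_created_by_def by blast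
  have inj: "inj_on p \<tau>"
  proof (rule inj_onI, rule ccontr)
    fix t t' assume "t \<in> \<tau>" "t' \<in> \<tau>" "p t = p t'" "t \<noteq> t'"
    then show False using p(3,4) by fastforce
  qed
  obtain C :: real where C: "C \<ge> 0" "\<And>U. bounded U \<Longrightarrow>
    \<bar>\<Sum>t\<in>{t \<in> \<tau>. region t \<inter> U \<noteq> {}}. conj_weight (fst t)\<bar> \<le>
      C * card {t \<in> \<tau>. region t \<inter> U \<noteq> {} \<and> \<not> region t \<subseteq> U}"
    using conj_weight_tiles by blast
  have main: "finite (square j k l \<inter> Y) \<and>
    \<bar>real (card (square j k l \<inter> Y)) - phi / (2 * phi - 1) * (l\<^sup>2 / \<psi>)\<bar> \<le> (3 + C) * (64 / \<psi>) * l"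
    if l: "l \<ge> 1" for j k l
  proof -
    let ?U = "square j k l"
    define A where "A = {t \<in> \<tau>. region t \<inter> ?U \<noteq> {}}"
    define M where "M = {t \<in> \<tau>. region t \<inter> ?U \<noteq> {} \<and> \<not> region t \<subseteq> ?U}"
    define B where "B = {t \<in> \<tau>. p t \<in> ?U}"
    have fA: "finite A" unfolding A_def by (rule boundary_tiles(1)[OF l])
    have M: "card M * \<psi> \<le> 64 * l" unfolding M_def \<psi>_def by (rule boundary_tiles(2)[OF l])
    have a: "\<bar>(\<Sum>t\<in>A. axis_len (fst t)) - l\<^sup>2 / \<psi>\<bar> \<le> 2 * card M"
      unfolding A_def M_def \<psi>_def by (rule area_count[OF l])
    have e: "\<bar>\<Sum>t\<in>A. conj_weight (fst t)\<bar> \<le> C * card M"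
      unfolding A_def M_def by (rule C(2)) (simp add: square_def bounded_cbox)
    have UY: "?U \<inter> Y = p ` B" unfolding p(2) B_def by blast
    have BA: "B \<subseteq> A" using p(1) by (auto simp: B_def A_def)
    have AMB: "A - M \<subseteq> B" using p(1) by (auto simp: B_def A_def M_def)
    have fB: "finite B" using BA fA by (rule finite_subset)
    have cB: "card (?U \<inter> Y) = card B"
      unfolding UY by (rule card_image) (rule inj_on_subset[OF inj], auto simp: B_def)
    have "card B \<le> card A" using BA fA by (intro card_mono)
    moreover have "card A \<le> card B + card M"
    proof -
      have "M \<subseteq> A" by (auto simp: A_def M_def)
      then have fM: "finite M" using fA finite_subset by blast
      have "A \<subseteq> B \<union> M" using AMB by blast
      then have "card A \<le> card (B \<union> M)" using fB fM by (intro card_mono) auto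
      also have "\<dots> \<le> card B + card M" by (rule card_Un_le)
      finally show ?thesis .
    qed
    ultimately have ba: "\<bar>real (card B) - real (card A)\<bar> \<le> card M" by linarith
    define c1 c2 where "c1 = phi / (2 * phi - 1)" and "c2 = (phi - 1) / (2 * phi - 1)"
    have c12: "0 \<le> c1" "c1 \<le> 1" "0 \<le> c2" "c2 \<le> 1" using phi_bounds by (simp_all add: c1_def c2_def)
    have "real (card A) = (\<Sum>t\<in>A. c1 * axis_len (fst t) + c2 * conj_weight (fst t))"
      using tile_count_identity by (simp add: c1_def c2_def flip: tile_count_identity)
    then have n: "real (card A) = c1 * (\<Sum>t\<in>A. axis_len (fst t)) + c2 * (\<Sum>t\<in>A. conj_weight (fst t))"
      by (simp add: sum.distrib sum_distrib_left)
    define X W T where "X = c1 * ((\<Sum>t\<in>A. axis_len (fst t)) - l\<^sup>2 / \<psi>)"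
      and "W = c2 * (\<Sum>t\<in>A. conj_weight (fst t))" and "T = c1 * (l\<^sup>2 / \<psi>)"
    have "\<bar>X\<bar> \<le> 2 * real (card M)"
      using mult_mono[OF c12(2) a] c12 by (simp add: X_def abs_mult)
    moreover have "\<bar>W\<bar> \<le> C * card M"
      using mult_mono[OF c12(4) e] c12 C(1) by (simp add: W_def abs_mult)
    moreover have "real (card A) - T = X + W"
      unfolding n X_def W_def T_def by (simp add: algebra_simps)
    ultimately have "\<bar>real (card B) - T\<bar> \<le> card M + (2 * real (card M) + C * card M)"
      using ba by linarith
    also have "\<dots> = (3 + C) * card M" by (simp add: algebra_simps)
    also have "\<dots> \<le> (3 + C) * (64 / \<psi> * l)"
      using M C(1) \<psi> by (intro mult_left_mono) (simp_all add: field_simps)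
    finally have "\<bar>real (card B) - T\<bar> \<le> (3 + C) * (64 / \<psi> * l)" .
    moreover have "finite (?U \<inter> Y)" unfolding UY using fB by (rule finite_imageI)
    ultimately show ?thesis unfolding cB T_def c1_def mult.assoc by blast
  qed
  have "0 \<le> (3 + C) * (64 / \<psi>)" using C(1) \<psi> by simp
  with main show ?thesis unfolding \<psi>_def by blast
qed

lemma square_meets_net:
  assumes net: "net_created_by \<tau> Y" and l: "l \<ge> 1"
  shows "\<exists>j k. square j k l \<inter> Y \<noteq> {}"
proof -
  obtain y where y: "y \<in> Y" "dist (vector [2, 2]) y \<le> 2"
    using net_point_near[OF til net] by blast
  have c: "\<bar>2 - y $ i\<bar> \<le> 2" for i
    using component_le_norm_cart[of "vector [2, 2] - y" i] y(2) exhaust_2[of i]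
    by (auto simp: dist_norm)
  have fl: "\<exists>m::nat. real m \<le> y $ i \<and> y $ i \<le> real m + l" for i
    using c[of i] l by (intro exI[of _ "nat \<lfloor>y $ i\<rfloor>"]) linarith
  obtain j k :: nat where "real j \<le> y $ 1 \<and> y $ 1 \<le> real j + l" "real k \<le> y $ 2 \<and> y $ 2 \<le> real k + l"
    using fl[of 1] fl[of 2] by blast
  then have "y \<in> square j k l" by (simp add: square_def mem_box_cart forall_2)
  then show ?thesis using y(1) by blast
qed

end

section \<open>The discrepancy\<close>

lemma ratio_bound:
  fixes \<rho> C l N :: real
  assumes \<rho>: "\<rho> > 0" and C: "C \<ge> 0" and l: "l \<ge> 1" and N: "N \<ge> 1" "\<bar>N - \<rho> * l\<^sup>2\<bar> \<le> C * l"
  shows "N / (\<rho> * l\<^sup>2) \<le> 1 + (2 * C / \<rho> + \<rho> * (2 * C / \<rho>) ^ 3) / l"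
    and "\<rho> * l\<^sup>2 / N \<le> 1 + (2 * C / \<rho> + \<rho> * (2 * C / \<rho>) ^ 3) / l"
proof -
  define a where "a = 2 * C / \<rho>"
  have a: "a \<ge> 0" and Ca: "C = \<rho> * a / 2" using \<rho> C by (simp_all add: a_def)
  have l0: "l > 0" and R0: "\<rho> * l\<^sup>2 > 0" using l \<rho> by simp_all
  have mono: "1 + x / l \<le> 1 + (a + \<rho> * a ^ 3) / l" if "x \<le> a + \<rho> * a ^ 3" for x
    using that l0 by (simp add: divide_right_mono)
  have x: "0 \<le> \<rho> * a ^ 3" using \<rho> a by simp
  have "N \<le> \<rho> * l\<^sup>2 + C * l" using N(2) by linarith
  then have "N / (\<rho> * l\<^sup>2) \<le> (\<rho> * l\<^sup>2 + C * l) / (\<rho> * l\<^sup>2)"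
    using R0 by (intro divide_right_mono) auto
  also have "\<dots> = 1 + a / 2 / l"
    using \<rho> l0 by (simp add: Ca field_simps power2_eq_square)
  also have "\<dots> \<le> 1 + (a + \<rho> * a ^ 3) / l" using a x by (intro mono) simp
  finally show "N / (\<rho> * l\<^sup>2) \<le> 1 + (2 * C / \<rho> + \<rho> * (2 * C / \<rho>) ^ 3) / l" by (simp add: a_def)
  show "\<rho> * l\<^sup>2 / N \<le> 1 + (2 * C / \<rho> + \<rho> * (2 * C / \<rho>) ^ 3) / l"
  proof (cases "l \<ge> a")
    case True
    have "C * l \<le> \<rho> * l\<^sup>2 / 2"
      using True \<rho> l0 by (simp add: Ca power2_eq_square)
    then have half: "\<rho> * l\<^sup>2 / 2 \<le> N" using N(2) by linarith
    have "\<rho> * l\<^sup>2 / N = 1 + (\<rho> * l\<^sup>2 - N) / N" using N(1) by (simp add: field_simps)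
    also have "(\<rho> * l\<^sup>2 - N) / N \<le> C * l / N" using N by (intro divide_right_mono) auto
    also have "C * l / N \<le> C * l / (\<rho> * l\<^sup>2 / 2)"
      using half R0 C l0 by (intro divide_left_mono) auto
    also have "C * l / (\<rho> * l\<^sup>2 / 2) = a / l"
      using \<rho> l0 by (simp add: Ca field_simps power2_eq_square)
    also have "1 + a / l \<le> 1 + (a + \<rho> * a ^ 3) / l" using x by (intro mono) simp
    finally show ?thesis by (simp add: a_def)
  next
    case False
    have "\<rho> * l\<^sup>2 / N \<le> \<rho> * l\<^sup>2 / 1"
      using N(1) R0 by (intro divide_left_mono) auto
    also have "\<dots> = \<rho> * l ^ 3 / l" using l0 by (simp add: power2_eq_square power3_eq_cube)
    also have "\<dots> \<le> \<rho> * a ^ 3 / l"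
      using False l0 \<rho> by (intro divide_right_mono mult_left_mono power_mono) auto
    also have "\<dots> \<le> 1 + \<rho> * a ^ 3 / l" by simp
    also have "\<dots> \<le> 1 + (a + \<rho> * a ^ 3) / l" using a by (intro mono) simp
    finally show ?thesis by (simp add: a_def)
  qed
qed

lemma discrepancy_bounds:
  assumes \<rho>: "\<rho> > 0" and C: "C \<ge> 0" and l: "l \<ge> 1"
    and Y: "finite (square j k l \<inter> Y)" "square j k l \<inter> Y \<noteq> {}"
    and N: "\<bar>real (card (square j k l \<inter> Y)) - \<rho> * l\<^sup>2\<bar> \<le> C * l"
  shows "1 \<le> discrepancy \<rho> Y (square j k l)"
    and "discrepancy \<rho> Y (square j k l) \<le> ennreal (1 + (2 * C / \<rho> + \<rho> * (2 * C / \<rho>) ^ 3) / l)"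
proof -
  define n where "n = real (card (square j k l \<inter> Y))"
  have "card (square j k l \<inter> Y) > 0" using Y by (simp add: card_gt_0_iff)
  then have n1: "n \<ge> 1" by (simp add: n_def)
  have R0: "\<rho> * l\<^sup>2 > 0" using \<rho> l by simp
  have d: "discrepancy \<rho> Y (square j k l) = ennreal (max (\<rho> * l\<^sup>2 / n) (n / (\<rho> * l\<^sup>2)))"
  proof -
    have "of_nat (card (square j k l \<inter> Y)) = ennreal n" by (simp add: n_def ennreal_of_nat_eq_real_of_nat)
    then show ?thesis
      using n1 R0 l unfolding discrepancy_def by (simp add: measure_square divide_ennreal max_def ennreal_leI ennreal_le_iff)
  qed
  have "\<rho> * l\<^sup>2 / n \<ge> 1 \<or> n / (\<rho> * l\<^sup>2) \<ge> 1" using n1 R0 by (auto simp: field_simps)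
  then have "1 \<le> max (\<rho> * l\<^sup>2 / n) (n / (\<rho> * l\<^sup>2))" by auto
  then show "1 \<le> discrepancy \<rho> Y (square j k l)" unfolding d by (metis ennreal_1 ennreal_leI)
  show "discrepancy \<rho> Y (square j k l) \<le> ennreal (1 + (2 * C / \<rho> + \<rho> * (2 * C / \<rho>) ^ 3) / l)"
    unfolding d using ratio_bound[OF \<rho> C l n1] N by (intro ennreal_leI) (simp add: n_def)
qed

lemma prod_converges:
  fixes E :: "nat \<Rightarrow> ennreal"
  assumes lower: "\<And>i. i \<ge> 1 \<Longrightarrow> 1 \<le> E i" and upper: "\<And>i. i \<ge> 1 \<Longrightarrow> E i \<le> ennreal (1 + K / 2 ^ i)"
    and K: "K \<ge> 0"
  shows "\<exists>L<\<infinity>. (\<lambda>n. \<Prod>i=1..n. E i) \<longlonglongrightarrow> L"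
proof -
  define P where "P n = (\<Prod>i=1..n. E i)" for n
  have Suc: "P (Suc n) = P n * E (Suc n)" for n by (simp add: P_def)
  have "incseq P"
  proof (rule incseq_SucI)
    fix n
    have "P n * 1 \<le> P n * E (Suc n)" using lower[of "Suc n"] by (intro mult_left_mono) auto
    then show "P n \<le> P (Suc n)" by (simp add: Suc)
  qed
  then have lim: "P \<longlonglongrightarrow> (SUP n. P n)" by (rule LIMSEQ_SUP)
  have "P n \<le> ennreal (exp (K * (1 - 1 / 2 ^ n)))" for n
  proof (induction n)
    case 0
    then show ?case by (simp add: P_def)
  next
    case (Suc n)
    have "P (Suc n) \<le> ennreal (exp (K * (1 - 1 / 2 ^ n))) * ennreal (exp (K / 2 ^ Suc n))"
      unfolding \<open>P (Suc n) = P n * E (Suc n)\<close>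
    proof (rule mult_mono[OF Suc])
      have "E (Suc n) \<le> ennreal (1 + K / 2 ^ Suc n)" by (rule upper) simp
      also have "\<dots> \<le> ennreal (exp (K / 2 ^ Suc n))" by (intro ennreal_leI exp_ge_add_one_self)
      finally show "E (Suc n) \<le> ennreal (exp (K / 2 ^ Suc n))" .
    qed simp_all
    also have "\<dots> = ennreal (exp (K * (1 - 1 / 2 ^ n) + K / 2 ^ Suc n))"
      by (simp add: exp_add flip: ennreal_mult)
    also have "K * (1 - 1 / 2 ^ n) + K / 2 ^ Suc n = K * (1 - 1 / 2 ^ Suc n)"
      by (simp add: field_simps)
    finally show ?case .
  qed
  moreover have "ennreal (exp (K * (1 - 1 / 2 ^ n))) \<le> ennreal (exp K)" for n
    using K by (intro ennreal_leI) (simp add: mult_left_le)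
  ultimately have "P n \<le> ennreal (exp K)" for n using order_trans by blast
  then have "(SUP n. P n) \<le> ennreal (exp K)" by (rule SUP_least)
  then have "(SUP n. P n) < \<infinity>" using ennreal_less_top order_le_less_trans by (metis infinity_ennreal_def)
  then show ?thesis using lim unfolding P_def by blast
qed

theorem corollary2p4:
  fixes \<tau> :: "tile set" and Y :: "(real ^ 2) set" and \<psi> \<rho> :: real
  assumes "penrose_tiling \<tau>"
    and "net_created_by \<tau> Y"
    and "\<psi> = measure lebesgue (prototile Dart)"
    and "\<rho> = phi\<^sup>2 / ((1 + phi\<^sup>2) * \<psi>)"
  shows "\<exists>L<\<infinity>. (\<lambda>n. \<Prod>i=1..n. max_discrepancy \<rho> Y (2 ^ i)) \<longlonglongrightarrow> L"
proof -
  have \<psi>: "\<psi> = phi * sin (pi / 5)" unfolding assms(3) measure_prototile by simp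
  have \<psi>0: "\<psi> > 0" using phi_bounds sin_pos by (simp add: \<psi>)
  have \<rho>0: "\<rho> > 0" using \<psi>0 phi_bounds by (simp add: assms(4) add_pos_pos)
  have "phi / (2 * phi - 1) = phi\<^sup>2 / (1 + phi\<^sup>2)"
  proof -
    have "phi * (1 + phi\<^sup>2) = phi\<^sup>2 * (2 * phi - 1)" using phi_square by algebra
    moreover have "2 * phi - 1 \<noteq> 0" "1 + phi\<^sup>2 \<noteq> 0" using phi_bounds by (auto simp: add_pos_pos less_imp_neq[symmetric])
    ultimately show ?thesis by (simp add: frac_eq_eq)
  qed
  then have \<rho>: "phi / (2 * phi - 1) * (l\<^sup>2 / (phi * sin (pi / 5))) = \<rho> * l\<^sup>2" for l
    by (simp add: assms(4) \<psi>)
  obtain C :: real where C: "C \<ge> 0" "\<And>j k l. l \<ge> 1 \<Longrightarrow> finite (square j k l \<inter> Y) \<and>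
      \<bar>real (card (square j k l \<inter> Y)) - \<rho> * l\<^sup>2\<bar> \<le> C * l"
    using net_count[OF assms(1,2)] unfolding \<rho> by blast
  define K where "K = 2 * C / \<rho> + \<rho> * (2 * C / \<rho>) ^ 3"
  have K0: "K \<ge> 0" using C(1) \<rho>0 by (simp add: K_def)
  note bounds = discrepancy_bounds[OF \<rho>0 C(1) _ conjunct1[OF C(2)] _ conjunct2[OF C(2)], folded K_def]
  have one: "1 \<le> (2 :: real) ^ i" for i by simp
  show ?thesis
  proof (rule prod_converges[where K = K])
    fix i :: nat
    obtain j k where jk: "square j k (2 ^ i) \<inter> Y \<noteq> {}"
      using square_meets_net[OF assms(1,2) one] by blast
    have "1 \<le> discrepancy \<rho> Y (square j k (2 ^ i))" by (rule bounds(1)[OF one one jk one])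
    also have "\<dots> \<le> max_discrepancy \<rho> Y (2 ^ i)"
      unfolding max_discrepancy_def using jk by (intro SUP_upper2[of "(j, k)"]) auto
    finally show "1 \<le> max_discrepancy \<rho> Y (2 ^ i)" .
    show "max_discrepancy \<rho> Y (2 ^ i) \<le> ennreal (1 + K / 2 ^ i)"
      unfolding max_discrepancy_def using bounds(2)[OF one one _ one] by (intro SUP_least) auto
  qed (rule K0)
qed

end
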